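(* Let $n\ge 1$ be an integer, $\sigma\ge 1$, $\sigma/2<\delta_2<\sigma$, $j\in\{0,1\}$ and $s\ge 0$. Assume $n>2\sigma$ and $$(u_0,u_1)\in \big(L^1(\mathbb{R}^n)\cap H^{s+2j\delta_2}(\mathbb{R}^n)\big)\times\big(L^1(\mathbb{R}^n)\cap H^{[s+2(j-1)\delta_2]^+}(\mathbb{R}^n)\big).$$ Let $u$ be the Sobolev solution of $$u_{tt}+(-\Delta)^\sigma u+(-\Delta)^{\delta_2}u_t=0,\qquad u(0,x)=u_0(x),\quad u_t(0,x)=u_1(x),$$ and let $P_1=\int_{\mathbb{R}^n}u_1(x)\,dx$. Then, as $t\to\infty$, $$\Big\||D|^s \Big(u(t,\cdot)- P_1\,\mathfrak{F}^{-1}\Big(e^{-\frac{1}{2}t|\xi|^{2\delta_2}}\frac{\sin(t|\xi|^\sigma)}{|\xi|^\sigma}\Big)(t,\cdot)\Big)\Big\|_{L^2}= o\Big(t^{-\frac{n}{4\delta_2}-\frac{s}{2\delta_2}+\frac{\sigma}{2\delta_2}}\Big),$$ $$\Big\|\partial_t |D|^s u(t,\cdot)- P_1\,|D|^s \mathfrak{F}^{-1}\Big(e^{-\frac{1}{2}t|\xi|^{2\delta_2}}\cos(t|\xi|^\sigma)\Big)(t,\cdot)\Big\|_{L^2}= o\Big(t^{-\frac{n}{4\delta_2}-\frac{s}{2\delta_2}}\Big).$$ Moreover, if $P_1\neq 0$, then there are positive constants $C_1,C_2$ (independent of $t$) such that for all sufficiently large $t\ge 1$ $$C_1\,t^{-\frac{n}{4\delta_2}-\frac{s+(j-1)\sigma}{2\delta_2}}\le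 \big\|\partial_t^j |D|^s u(t,\cdot)\big\|_{L^2}\le C_2\,t^{-\frac{n}{4\delta_2}-\frac{s+(j-1)\sigma}{2\delta_2}}.$$
   Context: $H^a$ ($a\ge0$) is the $L^2$-based Bessel potential (Sobolev) space on $\mathbb{R}^n$; $[r]^+=\max\{r,0\}$. $\widehat{w}=\mathfrak{F}(w)$ is the Fourier transform in $x$, normalized so that $\widehat w(\xi)=\int_{\mathbb{R}^n}e^{-ix\cdot\xi}w(x)\,dx$ for $w \in L^1$, and $\mathfrak{F}^{-1}$ is its inverse. $|D|^s$ and $(-\Delta)^{\alpha}$ are the Fourier multipliers with symbols $|\xi|^s$ and $|\xi|^{2\alpha}$. The Sobolev solution $u$ is the one whose partial Fourier transform solves, for a.e. $\xi$, the ODE $\widehat u_{tt}+|\xi|^{2\delta_2}\widehat u_t+|\xi|^{2\sigma}\widehat u=0$ with $\widehat u(0,\xi)=\widehat{u_0}(\xi)$, $\widehat u_t(0,\xi)=\widehat{u_1}(\xi)$. *)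

theory Defs
  imports "HOL-Analysis.Analysis" "HOL-Library.Landau_Symbols"
begin

text \<open>Elements of \<open>L\<^sup>2\<close> are represented by Lebesgue measurable functions; nothing below
  depends on the choice of representative. Since \<open>L2_norm\<close> is a real number, it is only
  meaningful on \<open>L2\<close> (it is 0 for functions that are not square integrable).\<close>

definition L1 :: "('a::euclidean_space \<Rightarrow> complex) set" where
  "L1 = {f. integrable lebesgue f}"

definition L2 :: "('a::euclidean_space \<Rightarrow> complex) set" where
  "L2 = {f \<in> borel_measurable lebesgue. integrable lebesgue (\<lambda>x. (cmod (f x))\<^sup>2)}"

definition L2_norm :: "('a::euclidean_space \<Rightarrow> complex) \<Rightarrow> real" where
  "L2_norm f = sqrt (\<integral>x. (cmod (f x))\<^sup>2 \<partial>lebesgue)"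

definition tendsto_L2 ::
    "('i \<Rightarrow> 'a::euclidean_space \<Rightarrow> complex) \<Rightarrow> ('a \<Rightarrow> complex) \<Rightarrow> 'i filter \<Rightarrow> bool" where
  "tendsto_L2 \<phi> g A \<longleftrightarrow>
     (\<forall>\<^sub>F i in A. \<phi> i \<in> L2) \<and> g \<in> L2 \<and> ((\<lambda>i. L2_norm (\<lambda>x. \<phi> i x - g x)) \<longlongrightarrow> 0) A"

definition fourier_integral :: "('a::euclidean_space \<Rightarrow> complex) \<Rightarrow> 'a \<Rightarrow> complex" where
  "fourier_integral w \<xi> = (\<integral>x. exp (- \<i> * complex_of_real (x \<bullet> \<xi>)) * w x \<partial>lebesgue)"

text \<open>The Fourier transform on \<open>L\<^sup>2\<close>: the \<open>L\<^sup>2\<close>-limit, as \<open>R \<rightarrow> \<infinity>\<close>, of the Fourier integrals of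
  \<open>w\<close> over the balls of radius \<open>R\<close>. By Plancherel's theorem this relation is (the graph of) a
  bijection of \<open>L\<^sup>2\<close> modulo null sets, so the choices below are unique almost everywhere, and on
  \<open>L\<^sup>1 \<inter> L\<^sup>2\<close> the transform is the Fourier integral almost everywhere.\<close>

definition has_fourier :: "('a::euclidean_space \<Rightarrow> complex) \<Rightarrow> ('a \<Rightarrow> complex) \<Rightarrow> bool" where
  "has_fourier w g \<longleftrightarrow> w \<in> L2 \<and>
     tendsto_L2 (\<lambda>R::real. fourier_integral (\<lambda>x. indicator (cball 0 R) x * w x)) g at_top"

definition fourier :: "('a::euclidean_space \<Rightarrow> complex) \<Rightarrow> 'a \<Rightarrow> complex" where
  "fourier w = (SOME g. has_fourier w g)"

definition inv_fourier :: "('a::euclidean_space \<Rightarrow> complex) \<Rightarrow> 'a \<Rightarrow> complex" where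
  "inv_fourier g = (SOME w. has_fourier w g)"

definition sobolev :: "real \<Rightarrow> ('a::euclidean_space \<Rightarrow> complex) set" where
  "sobolev a =
     {w \<in> L2. (\<lambda>\<xi>. complex_of_real ((1 + (norm \<xi>)\<^sup>2) powr (a / 2)) * fourier w \<xi>) \<in> L2}"

text \<open>The multiplier \<open>|D|\<^sup>s\<close>, for \<open>s \<ge> 0\<close> meaningful on \<open>sobolev s\<close>.\<close>

definition abs_D :: "real \<Rightarrow> ('a::euclidean_space \<Rightarrow> complex) \<Rightarrow> 'a \<Rightarrow> complex" where
  "abs_D s w = inv_fourier (\<lambda>\<xi>. complex_of_real (norm \<xi> powr s) * fourier w \<xi>)"

text \<open>The time derivative of a curve \<open>t \<mapsto> f(t, \<cdot>)\<close> in \<open>L\<^sup>2\<close>, as an \<open>L\<^sup>2\<close>-limit of difference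
  quotients.\<close>

definition has_L2_time_derivative ::
    "(real \<Rightarrow> 'a::euclidean_space \<Rightarrow> complex) \<Rightarrow> ('a \<Rightarrow> complex) \<Rightarrow> real \<Rightarrow> bool" where
  "has_L2_time_derivative f v t \<longleftrightarrow>
     tendsto_L2 (\<lambda>h x. (f (t + h) x - f t x) / complex_of_real h) v (at 0)"

definition time_deriv ::
    "(real \<Rightarrow> 'a::euclidean_space \<Rightarrow> complex) \<Rightarrow> real \<Rightarrow> 'a \<Rightarrow> complex" where
  "time_deriv f t = (SOME v. has_L2_time_derivative f v t)"

text \<open>Sobolev solutions of \<open>u\<^sub>t\<^sub>t + (-\<Delta>)\<^sup>\<sigma> u + (-\<Delta>)\<^sup>\<delta> u\<^sub>t = 0\<close>, \<open>u(0) = u0\<close>, \<open>u\<^sub>t(0) = u1\<close>. Here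
  \<open>U\<close> is the partial Fourier transform of \<open>u\<close>, in a version that is a classical solution of the
  ordinary differential equation in \<open>t \<ge> 0\<close> for almost every \<open>\<xi>\<close>. Values of \<open>u\<close> at negative times
  are irrelevant.\<close>

definition sobolev_solution ::
    "real \<Rightarrow> real \<Rightarrow> ('a::euclidean_space \<Rightarrow> complex) \<Rightarrow> ('a \<Rightarrow> complex) \<Rightarrow>
     (real \<Rightarrow> 'a \<Rightarrow> complex) \<Rightarrow> bool" where
  "sobolev_solution \<sigma> \<delta> u0 u1 u \<longleftrightarrow>
     (\<exists>U. (\<forall>t\<ge>0. has_fourier (u t) (U t)) \<and>
       (AE \<xi> in lebesgue. \<exists>V W.
          (\<forall>t\<ge>0. ((\<lambda>\<tau>. U \<tau> \<xi>) has_vector_derivative V t) (at t within {0..}) \<and>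
                 (V has_vector_derivative W t) (at t within {0..}) \<and>
                 W t + complex_of_real (norm \<xi> powr (2 * \<delta>)) * V t
                     + complex_of_real (norm \<xi> powr (2 * \<sigma>)) * U t \<xi> = 0) \<and>
          U 0 \<xi> = fourier u0 \<xi> \<and> V 0 = fourier u1 \<xi>))"

definition sin_profile :: "real \<Rightarrow> real \<Rightarrow> real \<Rightarrow> 'a::euclidean_space \<Rightarrow> complex" where
  "sin_profile \<sigma> \<delta> t = inv_fourier (\<lambda>\<xi>. complex_of_real
     (exp (- (1 / 2) * t * norm \<xi> powr (2 * \<delta>)) * (sin (t * norm \<xi> powr \<sigma>) / norm \<xi> powr \<sigma>)))"

definition cos_profile :: "real \<Rightarrow> real \<Rightarrow> real \<Rightarrow> 'a::euclidean_space \<Rightarrow> complex" where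
  "cos_profile \<sigma> \<delta> t = inv_fourier (\<lambda>\<xi>. complex_of_real
     (exp (- (1 / 2) * t * norm \<xi> powr (2 * \<delta>)) * cos (t * norm \<xi> powr \<sigma>)))"

end

theory Submission
  imports Defs "HOL-Probability.Characteristic_Functions"
begin

text \<open>By Plancherel's theorem all norms may be computed on the frequency side. There the equation is,
  for each \<open>\<xi>\<close> with \<open>r = |\<xi>|\<close>, the damped oscillator with characteristic polynomial
  \<open>\<lambda>\<^sup>2 + r\<^bsup>2\<delta>\<^esup> \<lambda> + r\<^bsup>2\<sigma>\<^esup>\<close>. Because \<open>\<delta> > \<sigma>/2\<close>, it oscillates for \<open>r \<le> 1\<close>, with the damping factor
  \<open>exp (- t r\<^bsup>2\<delta>\<^esup> / 2)\<close> and a frequency close to \<open>r\<^sup>\<sigma>\<close> (\<open>underdamped_solution\<close>). For \<open>r \<ge> 1\<close> an energy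
  estimate gives decay like \<open>exp (- c t r\<^bsup>2(\<sigma> - \<delta>)\<^esup>)\<close> (\<open>overdamped_energy\<close>); since \<open>\<delta> < \<sigma>\<close>, this is
  exponential decay in \<open>t\<close>, uniformly in \<open>r\<close>, and it smooths the solution as soon as \<open>t > 0\<close>
  (\<open>high_bound\<close>).

  The long-time behaviour is thus decided by the low frequencies, on the scale \<open>\<xi> = t\<^bsup>-1/(2\<delta>)\<^esup> \<eta>\<close> on which
  \<open>t r\<^bsup>2\<delta>\<^esup>\<close> is constant. As \<open>t \<rightarrow> \<infinity>\<close> with \<open>\<eta>\<close> fixed, the transform of \<open>u1\<close> tends to its value \<open>P\<^sub>1\<close> at the
  origin, the contribution of \<open>u0\<close> is of smaller order, and the difference between the true phase and
  \<open>t r\<^sup>\<sigma>\<close> tends to 0 (\<open>phase_difference\<close>). So the rescaled difference between the solution and \<open>P\<^sub>1\<close> times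
  the profile tends to 0 pointwise, and it is dominated by a multiple of
  \<open>|\<eta>|\<^bsup>s - \<sigma>\<^esup> exp (- |\<eta>|\<^bsup>2\<delta>\<^esup> / 2)\<close>, or of \<open>|\<eta>|\<^sup>s exp (- |\<eta>|\<^bsup>2\<delta>\<^esup> / 2)\<close> for the time derivative. The first of
  these is square integrable because \<open>n > 2\<sigma>\<close>. Dominated convergence together with the Jacobian of the
  scaling gives the two statements about \<open>o\<close> (\<open>scaled_L2_norm_smallo\<close>, \<open>frequency_asymptotics\<close>).

  For the two-sided bounds it remains to estimate the profiles. After scaling, their squared norms are
  integrals of a fixed integrable weight against \<open>cos\<^sup>2 (T |\<eta>|\<^sup>\<sigma> + \<phi>)\<close> with \<open>T = t\<^bsup>1 - \<sigma>/(2\<delta>)\<^esup> \<rightarrow> \<infinity>\<close>; the upper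
  bound is trivial, and the lower bound says that the oscillating factor has a positive mean
  (\<open>oscillation_lower_bound\<close>).

  The first half of the development supplies the Fourier transform on \<open>L\<^sup>2\<close>: completeness
  (\<open>L2_complete\<close>), the Plancherel identity (\<open>plancherel_L1_L2\<close>), which rests on Gaussian regularization
  and on continuity of translations in the mean, and inversion (\<open>has_fourier_inversion_L1_L2\<close>). They
  show that the transform is defined on all of \<open>L\<^sup>2\<close> and maps onto \<open>L\<^sup>2\<close>.\<close>

section \<open>Square integrable functions\<close>

lemma L2_measurable: "f \<in> L2 \<Longrightarrow> f \<in> borel_measurable lebesgue"
  by (simp add: L2_def)

lemma L2_integrable: "f \<in> L2 \<Longrightarrow> integrable lebesgue (\<lambda>x. (cmod (f x))\<^sup>2)"
  by (simp add: L2_def)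

lemma L2_I_integrable:
  assumes "f \<in> borel_measurable lebesgue" "integrable lebesgue G"
    and "AE x in lebesgue. (cmod (f x))\<^sup>2 \<le> G x"
  shows "f \<in> L2"
  unfolding L2_def using assms
  by (auto intro!: Bochner_Integration.integrable_bound[OF assms(2)])

lemma L2_I_dominated:
  assumes "f \<in> borel_measurable lebesgue" "g \<in> L2"
    and "AE x in lebesgue. cmod (f x) \<le> C * cmod (g x)"
  shows "f \<in> L2"
proof (rule L2_I_integrable[OF assms(1)])
  show "integrable lebesgue (\<lambda>x. C\<^sup>2 * (cmod (g x))\<^sup>2)"
    using L2_integrable[OF assms(2)] by simp
  show "AE x in lebesgue. (cmod (f x))\<^sup>2 \<le> C\<^sup>2 * (cmod (g x))\<^sup>2"
    using assms(3)
  proof eventually_elim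
    case (elim x)
    then have "(cmod (f x))\<^sup>2 \<le> (C * cmod (g x))\<^sup>2" by (intro power_mono) auto
    then show ?case by (simp add: power_mult_distrib)
  qed
qed

lemma L2_cmult: "f \<in> L2 \<Longrightarrow> (\<lambda>x. c * f x) \<in> L2"
  by (rule L2_I_dominated[where C="cmod c" and g=f])
     (auto dest: L2_measurable intro!: borel_measurable_times simp: norm_mult)

lemma square_of_sum_le: "(a + b)\<^sup>2 \<le> 2 * a\<^sup>2 + 2 * (b::real)\<^sup>2"
  using zero_le_power2[of "a - b"] by (simp add: power2_eq_square algebra_simps)

lemma cmod_add_square_le: "(cmod (a + b))\<^sup>2 \<le> 2 * (cmod a)\<^sup>2 + 2 * (cmod b)\<^sup>2"
proof -
  have "(cmod (a + b))\<^sup>2 \<le> (cmod a + cmod b)\<^sup>2"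
    by (intro power_mono norm_triangle_ineq) auto
  then show ?thesis by (rule order_trans[OF _ square_of_sum_le])
qed

lemma L2_add: assumes "f \<in> L2" "g \<in> L2" shows "(\<lambda>x. f x + g x) \<in> L2"
proof (rule L2_I_integrable)
  show "(\<lambda>x. f x + g x) \<in> borel_measurable lebesgue"
    using assms[THEN L2_measurable] by measurable
  show "integrable lebesgue (\<lambda>x. 2 * (cmod (f x))\<^sup>2 + 2 * (cmod (g x))\<^sup>2)"
    using assms[THEN L2_integrable] by simp
qed (auto intro: cmod_add_square_le)

lemma L2_diff: assumes "f \<in> L2" "g \<in> L2" shows "(\<lambda>x. f x - g x) \<in> L2"
  using L2_add[OF assms(1) L2_cmult[OF assms(2), of "-1"]] by simp

lemma L2_norm_nonneg [simp]: "0 \<le> L2_norm f"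
  by (simp add: L2_norm_def)

lemma L2_norm_power2: "(L2_norm f)\<^sup>2 = (\<integral>x. (cmod (f x))\<^sup>2 \<partial>lebesgue)"
  by (simp add: L2_norm_def)

lemma L2_norm_cmult: "L2_norm (\<lambda>x. c * f x) = cmod c * L2_norm f"
  by (simp add: L2_norm_def norm_mult power_mult_distrib real_sqrt_mult)

lemma L2_norm_minus_commute: "L2_norm (\<lambda>x. f x - g x) = L2_norm (\<lambda>x. g x - f x)"
  by (simp add: L2_norm_def norm_minus_commute)

lemma L2_norm_cong_AE:
  assumes "f \<in> borel_measurable lebesgue" "g \<in> borel_measurable lebesgue"
    and "AE x in lebesgue. f x = g x"
  shows "L2_norm f = L2_norm g"
  unfolding L2_norm_def using assms
  by (intro arg_cong[where f=sqrt] integral_cong_AE) auto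

lemma L2_cong_AE:
  assumes "f \<in> L2" "g \<in> borel_measurable lebesgue" "AE x in lebesgue. f x = g x"
  shows "g \<in> L2"
  by (rule L2_I_dominated[OF assms(2,1), where C=1]) (use assms(3) in auto)

lemma L2_norm_mono:
  assumes "f \<in> borel_measurable lebesgue" "g \<in> L2" "AE x in lebesgue. cmod (f x) \<le> cmod (g x)"
  shows "L2_norm f \<le> L2_norm g"
proof -
  have "f \<in> L2" by (rule L2_I_dominated[OF assms(1,2), where C=1]) (use assms in auto)
  then show ?thesis
    unfolding L2_norm_def using assms(2,3)
    by (intro real_sqrt_le_mono integral_mono_AE) (auto simp: L2_integrable elim: eventually_mono)
qed

lemma L2_norm_eq_0_iff:
  assumes "f \<in> L2" shows "L2_norm f = 0 \<longleftrightarrow> (AE x in lebesgue. f x = 0)"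
  unfolding L2_norm_def
  using integral_nonneg_eq_0_iff_AE[OF L2_integrable[OF assms]] by simp

lemma nn_integral_L2:
  assumes "f \<in> L2"
  shows "(\<integral>\<^sup>+x. ennreal ((cmod (f x))\<^sup>2) \<partial>lebesgue) = ennreal ((L2_norm f)\<^sup>2)"
  using nn_integral_eq_integral[OF L2_integrable[OF assms]] by (simp add: L2_norm_power2)

lemma L2_of_nn_integral_le:
  assumes "f \<in> borel_measurable lebesgue" "0 \<le> e"
    and "(\<integral>\<^sup>+x. ennreal ((cmod (f x))\<^sup>2) \<partial>lebesgue) \<le> ennreal (e\<^sup>2)"
  shows "f \<in> L2" "L2_norm f \<le> e"
proof -
  have "(\<integral>\<^sup>+x. ennreal ((cmod (f x))\<^sup>2) \<partial>lebesgue) < \<infinity>"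
    using assms(3) by (rule le_less_trans) simp
  then show f: "f \<in> L2"
    using assms(1) unfolding L2_def by (auto intro!: integrableI_bounded)
  from nn_integral_L2[OF this] assms(3) have "(L2_norm f)\<^sup>2 \<le> e\<^sup>2" by simp
  then show "L2_norm f \<le> e" using assms(2) by (rule power2_le_imp_le)
qed

text \<open>Minkowski's inequality: for \<open>\<lambda> > 0\<close> the pointwise bound
  \<open>|f + g|\<^sup>2 \<le> (1 + \<lambda>) |f|\<^sup>2 + (1 + 1/\<lambda>) |g|\<^sup>2\<close> integrates to \<open>(A + B)\<^sup>2\<close> for \<open>\<lambda> = B / A\<close>, where
  \<open>A\<close> and \<open>B\<close> are the two norms.\<close>

lemma L2_norm_triangle:
  assumes "f \<in> L2" "g \<in> L2"
  shows "L2_norm (\<lambda>x. f x + g x) \<le> L2_norm f + L2_norm g"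
proof -
  note m = assms[THEN L2_measurable]
  have m3: "(\<lambda>x. f x + g x) \<in> borel_measurable lebesgue" using m by measurable
  define A B where "A = L2_norm f" and "B = L2_norm g"
  consider "A = 0" | "B = 0" | "A > 0" "B > 0"
    unfolding A_def B_def by (metis L2_norm_nonneg less_eq_real_def)
  then show ?thesis
  proof cases
    case 1
    then have "AE x in lebesgue. f x = 0" using L2_norm_eq_0_iff[OF assms(1)] by (simp add: A_def)
    then have "L2_norm (\<lambda>x. f x + g x) = L2_norm g" by (intro L2_norm_cong_AE m m3) auto
    then show ?thesis by simp
  next
    case 2
    then have "AE x in lebesgue. g x = 0" using L2_norm_eq_0_iff[OF assms(2)] by (simp add: B_def)
    then have "L2_norm (\<lambda>x. f x + g x) = L2_norm f" by (intro L2_norm_cong_AE m m3) auto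
    then show ?thesis by simp
  next
    case 3
    have *: "(cmod (f x + g x))\<^sup>2 \<le> (1 + B/A) * (cmod (f x))\<^sup>2 + (1 + A/B) * (cmod (g x))\<^sup>2" for x
    proof -
      have "0 \<le> (B * cmod (f x) - A * cmod (g x))\<^sup>2 / (A * B)"
        using 3 by simp
      then have "2 * cmod (f x) * cmod (g x) \<le> B / A * (cmod (f x))\<^sup>2 + A / B * (cmod (g x))\<^sup>2"
        using 3 by (simp add: field_simps power2_eq_square)
      moreover have "(cmod (f x + g x))\<^sup>2 \<le> (cmod (f x) + cmod (g x))\<^sup>2"
        by (intro power_mono norm_triangle_ineq) auto
      ultimately show ?thesis by (simp add: algebra_simps power2_eq_square)
    qed
    have "(L2_norm (\<lambda>x. f x + g x))\<^sup>2 \<le>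
        (\<integral>x. (1 + B/A) * (cmod (f x))\<^sup>2 + (1 + A/B) * (cmod (g x))\<^sup>2 \<partial>lebesgue)"
      unfolding L2_norm_power2
      by (intro integral_mono_AE) (use * assms[THEN L2_integrable] L2_integrable[OF L2_add[OF assms]] in auto)
    also have "\<dots> = (1 + B/A) * A\<^sup>2 + (1 + A/B) * B\<^sup>2"
      unfolding A_def B_def L2_norm_power2 using assms[THEN L2_integrable] by simp
    also have "\<dots> = (A + B)\<^sup>2" using 3 by (simp add: field_simps power2_eq_square)
    finally show ?thesis unfolding A_def B_def by (rule power2_le_imp_le) simp
  qed
qed

lemma L2_norm_triangle_diff:
  assumes "f \<in> L2" "g \<in> L2" "h \<in> L2"
  shows "L2_norm (\<lambda>x. f x - h x) \<le> L2_norm (\<lambda>x. f x - g x) + L2_norm (\<lambda>x. g x - h x)"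
  using L2_norm_triangle[OF L2_diff[OF assms(1,2)] L2_diff[OF assms(2,3)]] by simp

lemma L2_norm_diff_ge:
  assumes "f \<in> L2" "g \<in> L2"
  shows "\<bar>L2_norm f - L2_norm g\<bar> \<le> L2_norm (\<lambda>x. f x - g x)"
  using L2_norm_triangle[OF L2_diff[OF assms] assms(2)]
    L2_norm_triangle[OF L2_diff[OF assms(2,1)] assms(1)] L2_norm_minus_commute[of f g]
  by simp

lemma L2_dominated_convergence:
  fixes s :: "nat \<Rightarrow> 'a::euclidean_space \<Rightarrow> complex"
  assumes "\<And>i. s i \<in> borel_measurable lebesgue" "f \<in> borel_measurable lebesgue"
    and w: "integrable lebesgue w"
    and lim: "AE x in lebesgue. (\<lambda>i. s i x) \<longlonglongrightarrow> f x"
    and bound: "\<And>i. AE x in lebesgue. (cmod (s i x - f x))\<^sup>2 \<le> w x"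
  shows "(\<lambda>i. L2_norm (\<lambda>x. s i x - f x)) \<longlonglongrightarrow> 0"
proof -
  have "(\<lambda>i. \<integral>x. (cmod (s i x - f x))\<^sup>2 \<partial>lebesgue) \<longlonglongrightarrow> integral\<^sup>L (lebesgue :: 'a measure) (\<lambda>x. 0)"
  proof (rule integral_dominated_convergence[where w=w])
    show "AE x in lebesgue. (\<lambda>i. (cmod (s i x - f x))\<^sup>2) \<longlonglongrightarrow> 0"
      using lim by eventually_elim (auto intro!: tendsto_eq_intros)
    show "AE x in lebesgue. norm ((cmod (s i x - f x))\<^sup>2) \<le> w x" for i
      using bound[of i] by simp
  qed (use assms in auto)
  from tendsto_real_sqrt[OF this] show ?thesis by (simp add: L2_norm_def)
qed

lemma power2_power: "((1/2)^k)\<^sup>2 = ((1/4)^k :: real)"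
proof -
  have "(1/4 :: real) = (1/2)\<^sup>2" by (simp add: power2_eq_square)
  then show ?thesis by (metis power_mult mult.commute)
qed

text \<open>The Riesz--Fischer theorem. Along a subsequence whose increments \<open>d\<^sub>k\<close> have norms at most
  \<open>4\<^sup>-\<^sup>k\<close>, the series of \<open>4\<^sup>k |d\<^sub>k|\<^sup>2\<close> has a finite integral, so \<open>|d\<^sub>k|\<close> is almost everywhere
  bounded by a multiple of \<open>2\<^sup>-\<^sup>k\<close> and the subsequence converges pointwise; Fatou's lemma turns
  this into convergence in norm.\<close>

lemma L2_complete:
  fixes \<phi> :: "nat \<Rightarrow> 'a::euclidean_space \<Rightarrow> complex"
  assumes L2: "\<And>n. \<phi> n \<in> L2"
    and Cauchy: "\<And>e. e > 0 \<Longrightarrow> \<exists>N. \<forall>m\<ge>N. \<forall>n\<ge>N. L2_norm (\<lambda>x. \<phi> m x - \<phi> n x) < e"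
  obtains g where "g \<in> L2" "(\<lambda>n. L2_norm (\<lambda>x. \<phi> n x - g x)) \<longlonglongrightarrow> 0"
proof -
  have "\<forall>k. \<exists>N. \<forall>m\<ge>N. \<forall>n\<ge>N. L2_norm (\<lambda>x. \<phi> m x - \<phi> n x) < (1/4)^k"
    using Cauchy by simp
  then obtain N where N: "\<And>k m n. m \<ge> N k \<Longrightarrow> n \<ge> N k \<Longrightarrow> L2_norm (\<lambda>x. \<phi> m x - \<phi> n x) < (1/4)^k"
    by metis
  define r where "r k = (\<Sum>i\<le>k. Suc (N i))" for k
  have rN: "r k \<ge> N k" for k
    unfolding r_def by (induction k) auto
  have r_Suc: "r (Suc k) > r k" for k
    by (simp add: r_def)
  then have mono: "strict_mono r" by (rule strict_monoI_Suc)
  define d where "d k x = \<phi> (r (Suc k)) x - \<phi> (r k) x" for k x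
  have m[measurable]: "\<phi> n \<in> borel_measurable lebesgue" for n using L2 L2_measurable by blast
  have dL2: "d k \<in> L2" for k unfolding d_def by (intro L2_diff L2)
  have dm[measurable]: "d k \<in> borel_measurable lebesgue" for k using dL2 L2_measurable by blast
  have dn: "L2_norm (d k) \<le> (1/4)^k" for k
    unfolding d_def using N[of k "r (Suc k)" "r k"] rN[of k] r_Suc[of k] by simp
  have "(\<integral>\<^sup>+x. (\<Sum>k. ennreal (4^k * (cmod (d k x))\<^sup>2)) \<partial>lebesgue)
      = (\<Sum>k. \<integral>\<^sup>+x. ennreal (4^k * (cmod (d k x))\<^sup>2) \<partial>lebesgue)"
    by (intro nn_integral_suminf) measurable
  also have "\<dots> = (\<Sum>k. ennreal (4^k * (L2_norm (d k))\<^sup>2))"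
    by (simp add: ennreal_mult nn_integral_cmult nn_integral_L2[OF dL2])
  also have "\<dots> \<le> (\<Sum>k. ennreal ((1/4)^k))"
  proof (intro suminf_le ennreal_leI)
    fix k
    have "(L2_norm (d k))\<^sup>2 \<le> ((1/4)^k)\<^sup>2" using dn by (intro power_mono) auto
    then have "4^k * (L2_norm (d k))\<^sup>2 \<le> 4^k * ((1/4)^k)\<^sup>2" by (intro mult_left_mono) auto
    also have "\<dots> = (1/4)^k" by (simp add: power2_eq_square field_simps)
    finally show "4^k * (L2_norm (d k))\<^sup>2 \<le> (1/4)^k" .
  qed auto
  also have "\<dots> < \<infinity>"
    by (subst suminf_ennreal2) (auto intro!: summable_geometric)
  finally have fin: "(\<integral>\<^sup>+x. (\<Sum>k. ennreal (4^k * (cmod (d k x))\<^sup>2)) \<partial>lebesgue) \<noteq> \<infinity>" by simp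
  have "AE x in lebesgue. (\<Sum>k. ennreal (4^k * (cmod (d k x))\<^sup>2)) \<noteq> \<infinity>"
    by (rule nn_integral_PInf_AE[OF _ fin]) measurable
  then have conv: "AE x in lebesgue. convergent (\<lambda>k. \<phi> (r k) x)"
  proof eventually_elim
    case (elim x)
    have "summable (\<lambda>k. 4^k * (cmod (d k x))\<^sup>2)"
      by (rule summable_suminf_not_top) (use elim in auto)
    then have "Bseq (\<lambda>k. 4^k * (cmod (d k x))\<^sup>2)"
      by (intro convergent_imp_Bseq convergentI[OF summable_LIMSEQ_zero])
    then obtain M where M: "M > 0" "\<And>k. norm (4^k * (cmod (d k x))\<^sup>2) \<le> M" by (auto elim: BseqE)
    have bd: "cmod (d k x) \<le> sqrt M * (1/2)^k" for k
    proof (rule power2_le_imp_le)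
      have "4^k * (cmod (d k x))\<^sup>2 \<le> M" using M(2)[of k] by simp
      then have "(cmod (d k x))\<^sup>2 \<le> M * (1/4)^k" by (simp add: field_simps)
      also have "\<dots> = (sqrt M * (1/2)^k)\<^sup>2"
        using M(1) by (simp add: power_mult_distrib power2_power)
      finally show "(cmod (d k x))\<^sup>2 \<le> (sqrt M * (1/2)^k)\<^sup>2" .
    qed (use M in auto)
    have "summable (\<lambda>k. sqrt M * (1/2 :: real)^k)"
      by (intro summable_mult summable_geometric) simp
    then have "summable (\<lambda>k. d k x)" by (rule summable_comparison_test'[OF _ bd])
    then have "convergent (\<lambda>n. \<Sum>k<n. d k x)" by (simp add: summable_iff_convergent)
    then have "convergent (\<lambda>n. \<phi> (r 0) x + (\<Sum>k<n. d k x))" by (intro convergent_add convergent_const)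
    also have "(\<lambda>n. \<phi> (r 0) x + (\<Sum>k<n. d k x)) = (\<lambda>n. \<phi> (r n) x)"
      using sum_lessThan_telescope[of "\<lambda>n. \<phi> (r n) x"] by (simp add: d_def)
    finally show ?case .
  qed
  define g where "g x = lim (\<lambda>k. \<phi> (r k) x)" for x
  have gm[measurable]: "g \<in> borel_measurable lebesgue"
    unfolding g_def by measurable
  have close: "(\<lambda>x. \<phi> n x - g x) \<in> L2 \<and> L2_norm (\<lambda>x. \<phi> n x - g x) \<le> (1/4)^j" if "n \<ge> N j" for n j
  proof -
    have "(\<integral>\<^sup>+x. ennreal ((cmod (\<phi> n x - g x))\<^sup>2) \<partial>lebesgue)
        = (\<integral>\<^sup>+x. liminf (\<lambda>k. ennreal ((cmod (\<phi> n x - \<phi> (r k) x))\<^sup>2)) \<partial>lebesgue)"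
    proof (rule nn_integral_cong_AE)
      show "AE x in lebesgue. ennreal ((cmod (\<phi> n x - g x))\<^sup>2)
          = liminf (\<lambda>k. ennreal ((cmod (\<phi> n x - \<phi> (r k) x))\<^sup>2))"
        using conv
      proof eventually_elim
        case (elim x)
        then have "(\<lambda>k. \<phi> (r k) x) \<longlonglongrightarrow> g x" by (simp add: g_def convergent_LIMSEQ_iff)
        then have "(\<lambda>k. ennreal ((cmod (\<phi> n x - \<phi> (r k) x))\<^sup>2)) \<longlonglongrightarrow> ennreal ((cmod (\<phi> n x - g x))\<^sup>2)"
          by (intro tendsto_intros)
        from lim_imp_Liminf[OF _ this] show ?case by simp
      qed
    qed
    also have "\<dots> \<le> liminf (\<lambda>k. \<integral>\<^sup>+x. ennreal ((cmod (\<phi> n x - \<phi> (r k) x))\<^sup>2) \<partial>lebesgue)"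
      by (rule nn_integral_liminf) measurable
    also have "\<dots> \<le> ennreal (((1/4)^j)\<^sup>2)"
    proof (rule order_trans[OF Liminf_le_Limsup Limsup_bounded])
      show "\<forall>\<^sub>F k in sequentially. (\<integral>\<^sup>+x. ennreal ((cmod (\<phi> n x - \<phi> (r k) x))\<^sup>2) \<partial>lebesgue)
          \<le> ennreal (((1/4)^j)\<^sup>2)"
        using eventually_ge_at_top[of "N j"]
      proof eventually_elim
        case (elim k)
        then have "r k \<ge> N j" using seq_suble[OF mono, of k] by simp
        from N[OF that this] show ?case
          using nn_integral_L2[OF L2_diff[OF L2 L2], of n "r k"]
          by (auto intro!: ennreal_leI power_mono)
      qed
    qed simp
    finally show ?thesis
      by (intro conjI L2_of_nn_integral_le) auto
  qed
  show thesis
  proof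
    from L2_diff[OF L2[of "N 0"] conjunct1[OF close[of 0 "N 0"]]] show "g \<in> L2" by simp
    show "(\<lambda>n. L2_norm (\<lambda>x. \<phi> n x - g x)) \<longlonglongrightarrow> 0"
    proof (rule LIMSEQ_I)
      fix e :: real assume "e > 0"
      then obtain j where "(1/4)^j < e" using real_arch_pow_inv[of e "1/4"] by auto
      then show "\<exists>no. \<forall>n\<ge>no. norm (L2_norm (\<lambda>x. \<phi> n x - g x) - 0) < e"
        using close[of j] by (intro exI[of _ "N j"]) (auto intro: le_less_trans)
    qed
  qed
qed

lemma indicator_mult_L2:
  assumes "f \<in> L2" "A \<in> sets lebesgue"
  shows "(\<lambda>x. indicator A x * f x) \<in> L2"
proof (rule L2_I_dominated[OF _ assms(1), where C=1])
  show "(\<lambda>x. indicator A x * f x) \<in> borel_measurable lebesgue"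
    using L2_measurable[OF assms(1)] assms(2) by measurable
qed (auto simp: indicator_def)

text \<open>Truncations lie in \<open>L\<^sup>1 \<inter> L\<^sup>2\<close>, where the Fourier transform is an integral; they are the
  approximants in all limit arguments for the transform.\<close>

lemma truncation_tendsto_L2:
  fixes f :: "'a::euclidean_space \<Rightarrow> complex"
  assumes "f \<in> L2"
  shows "((\<lambda>R. L2_norm (\<lambda>x. indicator (cball 0 R) x * f x - f x)) \<longlongrightarrow> 0) at_top"
proof (rule tendsto_at_topI_sequentially)
  fix X :: "nat \<Rightarrow> real" assume X: "filterlim X at_top sequentially"
  note [measurable] = L2_measurable[OF assms]
  show "(\<lambda>n. L2_norm (\<lambda>x. indicator (cball 0 (X n)) x * f x - f x)) \<longlonglongrightarrow> 0"
  proof (rule L2_dominated_convergence[OF _ _ L2_integrable[OF assms]])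
    show "AE x in lebesgue. (\<lambda>i. indicator (cball 0 (X i)) x * f x) \<longlonglongrightarrow> f x"
    proof (intro always_eventually allI)
      fix x :: 'a
      have "\<forall>\<^sub>F i in sequentially. X i \<ge> norm x" using X by (simp add: filterlim_at_top)
      then show "(\<lambda>i. indicator (cball 0 (X i)) x * f x) \<longlonglongrightarrow> f x"
        by (intro tendsto_eventually) (erule eventually_mono, simp)
    qed
    show "(\<lambda>x. indicator (cball 0 (X i)) x * f x) \<in> borel_measurable lebesgue" for i
      by (rule L2_measurable[OF indicator_mult_L2[OF assms]]) simp
  qed (auto simp: indicator_def)
qed

lemma truncation_L1:
  fixes f :: "'a::euclidean_space \<Rightarrow> complex"
  assumes "f \<in> L2" "A \<in> lmeasurable"
  shows "(\<lambda>x. indicator A x * f x) \<in> L1"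
  unfolding L1_def mem_Collect_eq
proof (rule Bochner_Integration.integrable_bound)
  have "integrable lebesgue (\<lambda>x. indicator A x :: real)"
    using assms(2) by (intro integrable_real_indicator) (auto simp: fmeasurable_def)
  then show "integrable lebesgue (\<lambda>x. indicator A x + (cmod (f x))\<^sup>2)"
    using L2_integrable[OF assms(1)] by (rule Bochner_Integration.integrable_add)
  show "(\<lambda>x. indicator A x * f x) \<in> borel_measurable lebesgue"
    using L2_measurable[OF assms(1)] assms(2) by measurable
  have "a \<le> 1 + a\<^sup>2" for a :: real
  proof -
    have "0 \<le> (a - 1)\<^sup>2" "0 \<le> a\<^sup>2" by auto
    moreover have "(a - 1)\<^sup>2 = a\<^sup>2 - 2 * a + 1" by (simp add: power2_eq_square algebra_simps)
    ultimately show ?thesis by linarith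
  qed
  then show "AE x in lebesgue. norm (indicator A x * f x) \<le> norm (indicator A x + (cmod (f x))\<^sup>2)"
    by (auto simp: indicator_def)
qed

section \<open>Continuity of translations in the mean\<close>

definition translation_defect :: "('a::euclidean_space \<Rightarrow> complex) \<Rightarrow> 'a \<Rightarrow> ennreal" where
  "translation_defect f h = (\<integral>\<^sup>+x. ennreal ((cmod (f (x + h) - f x))\<^sup>2) \<partial>lborel)"

lemma nn_integral_lborel_translate:
  fixes f :: "'a::euclidean_space \<Rightarrow> ennreal"
  assumes [measurable]: "f \<in> borel_measurable borel"
  shows "(\<integral>\<^sup>+x. f (x + h) \<partial>lborel) = (\<integral>\<^sup>+x. f x \<partial>lborel)"
proof -
  have "(\<integral>\<^sup>+x. f x \<partial>lborel) = (\<integral>\<^sup>+x. f x \<partial>distr lborel borel ((+) h))"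
    by (simp add: lborel_distr_plus)
  also have "\<dots> = (\<integral>\<^sup>+x. f (x + h) \<partial>lborel)"
    by (subst nn_integral_distr) (auto simp: add.commute)
  finally show ?thesis by simp
qed

lemma nn_integral_square_add_le:
  assumes [measurable]: "f \<in> borel_measurable M" "g \<in> borel_measurable M"
  shows "(\<integral>\<^sup>+x. ennreal ((cmod (f x + g x))\<^sup>2) \<partial>M)
     \<le> 2 * (\<integral>\<^sup>+x. ennreal ((cmod (f x))\<^sup>2) \<partial>M) + 2 * (\<integral>\<^sup>+x. ennreal ((cmod (g x))\<^sup>2) \<partial>M)"
proof -
  have "(\<integral>\<^sup>+x. ennreal ((cmod (f x + g x))\<^sup>2) \<partial>M)
      \<le> (\<integral>\<^sup>+x. 2 * ennreal ((cmod (f x))\<^sup>2) + 2 * ennreal ((cmod (g x))\<^sup>2) \<partial>M)"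
  proof (rule nn_integral_mono)
    fix x
    have "ennreal ((cmod (f x + g x))\<^sup>2) \<le> ennreal (2 * (cmod (f x))\<^sup>2 + 2 * (cmod (g x))\<^sup>2)"
      by (intro ennreal_leI cmod_add_square_le)
    then show "ennreal ((cmod (f x + g x))\<^sup>2) \<le> 2 * ennreal ((cmod (f x))\<^sup>2) + 2 * ennreal ((cmod (g x))\<^sup>2)"
      by (simp add: ennreal_plus ennreal_mult)
  qed
  then show ?thesis by (simp add: nn_integral_add nn_integral_cmult)
qed

lemma translation_defect_add_le:
  assumes [measurable]: "f \<in> borel_measurable borel" "g \<in> borel_measurable borel"
  shows "translation_defect (\<lambda>x. f x + g x) h \<le> 2 * translation_defect f h + 2 * translation_defect g h"
  using nn_integral_square_add_le[of "\<lambda>x. f (x + h) - f x" lborel "\<lambda>x. g (x + h) - g x"]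
  unfolding translation_defect_def by (simp add: algebra_simps)

lemma translation_defect_cmult:
  assumes [measurable]: "f \<in> borel_measurable borel"
  shows "translation_defect (\<lambda>x. c * f x) h = ennreal ((cmod c)\<^sup>2) * translation_defect f h"
proof -
  have "(cmod (c * f (x + h) - c * f x))\<^sup>2 = (cmod c)\<^sup>2 * (cmod (f (x + h) - f x))\<^sup>2" for x
    by (simp add: norm_mult power_mult_distrib flip: right_diff_distrib)
  then show ?thesis
    unfolding translation_defect_def by (simp add: ennreal_mult nn_integral_cmult)
qed

lemma translation_defect_le:
  assumes [measurable]: "f \<in> borel_measurable borel"
  shows "translation_defect f h \<le> 4 * (\<integral>\<^sup>+x. ennreal ((cmod (f x))\<^sup>2) \<partial>lborel)"
proof -
  have "translation_defect f h \<le> 2 * (\<integral>\<^sup>+x. ennreal ((cmod (f (x + h)))\<^sup>2) \<partial>lborel)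
      + 2 * (\<integral>\<^sup>+x. ennreal ((cmod (f x))\<^sup>2) \<partial>lborel)"
    unfolding translation_defect_def
    using nn_integral_square_add_le[of "\<lambda>x. f (x + h)" lborel "\<lambda>x. - f x"] by simp
  also have "(\<integral>\<^sup>+x. ennreal ((cmod (f (x + h)))\<^sup>2) \<partial>lborel) = (\<integral>\<^sup>+x. ennreal ((cmod (f x))\<^sup>2) \<partial>lborel)"
    by (rule nn_integral_lborel_translate) measurable
  also have "2 * (\<integral>\<^sup>+x. ennreal ((cmod (f x))\<^sup>2) \<partial>lborel) + 2 * (\<integral>\<^sup>+x. ennreal ((cmod (f x))\<^sup>2) \<partial>lborel)
     = 4 * (\<integral>\<^sup>+x. ennreal ((cmod (f x))\<^sup>2) \<partial>lborel)"
    by (simp flip: distrib_right)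
  finally show ?thesis .
qed

definition mean_continuous :: "('a::euclidean_space \<Rightarrow> complex) \<Rightarrow> bool" where
  "mean_continuous f \<longleftrightarrow> f \<in> borel_measurable borel \<and>
     (\<forall>X. X \<longlonglongrightarrow> 0 \<longrightarrow> (\<lambda>k::nat. translation_defect f (X k)) \<longlonglongrightarrow> 0)"

lemma ennreal_tendsto_0_I:
  fixes F :: "nat \<Rightarrow> ennreal"
  assumes "\<And>e::real. e > 0 \<Longrightarrow> \<forall>\<^sub>F k in sequentially. F k \<le> ennreal e"
  shows "F \<longlonglongrightarrow> 0"
proof (rule order_tendstoI)
  fix a :: ennreal assume "0 < a"
  then obtain e where e: "0 < e" "ennreal e < a"
  proof (cases a)
    case (real r)
    with \<open>0 < a\<close> have "0 < r / 2" "ennreal (r / 2) < a" by (auto intro!: ennreal_lessI)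
    then show ?thesis by (rule that)
  next
    case top
    then show ?thesis using that[of 1] by simp
  qed
  from assms[OF e(1)] show "\<forall>\<^sub>F k in sequentially. F k < a"
    by eventually_elim (use e(2) in auto)
qed auto

lemma mean_continuous_add:
  assumes "mean_continuous f" "mean_continuous g"
  shows "mean_continuous (\<lambda>x. f x + g x)"
  unfolding mean_continuous_def
proof (intro conjI allI impI)
  have [measurable]: "f \<in> borel_measurable borel" "g \<in> borel_measurable borel"
    using assms by (auto simp: mean_continuous_def)
  show "(\<lambda>x. f x + g x) \<in> borel_measurable borel" by measurable
  fix X :: "nat \<Rightarrow> 'a" assume "X \<longlonglongrightarrow> 0"
  then have "(\<lambda>k. translation_defect f (X k)) \<longlonglongrightarrow> 0" "(\<lambda>k. translation_defect g (X k)) \<longlonglongrightarrow> 0"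
    using assms by (auto simp: mean_continuous_def)
  then have "(\<lambda>k. 2 * translation_defect f (X k) + 2 * translation_defect g (X k)) \<longlonglongrightarrow> 2 * 0 + 2 * 0"
    by (intro tendsto_add ennreal_tendsto_cmult) auto
  then have "(\<lambda>k. 2 * translation_defect f (X k) + 2 * translation_defect g (X k)) \<longlonglongrightarrow> 0"
    by simp
  from tendsto_sandwich[OF _ _ tendsto_const this]
  show "(\<lambda>k. translation_defect (\<lambda>x. f x + g x) (X k)) \<longlonglongrightarrow> 0"
    using translation_defect_add_le[of f g] by simp
qed

lemma mean_continuous_cmult:
  assumes "mean_continuous f"
  shows "mean_continuous (\<lambda>x. c * f x)"
  unfolding mean_continuous_def
proof (intro conjI allI impI)
  have [measurable]: "f \<in> borel_measurable borel"
    using assms by (auto simp: mean_continuous_def)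
  show "(\<lambda>x. c * f x) \<in> borel_measurable borel" by measurable
  fix X :: "nat \<Rightarrow> 'a" assume "X \<longlonglongrightarrow> 0"
  then have "(\<lambda>k. translation_defect f (X k)) \<longlonglongrightarrow> 0"
    using assms by (auto simp: mean_continuous_def)
  then have "(\<lambda>k. ennreal ((cmod c)\<^sup>2) * translation_defect f (X k)) \<longlonglongrightarrow> ennreal ((cmod c)\<^sup>2) * 0"
    by (intro ennreal_tendsto_cmult) auto
  then show "(\<lambda>k. translation_defect (\<lambda>x. c * f x) (X k)) \<longlonglongrightarrow> 0"
    by (simp add: translation_defect_cmult)
qed

lemma mean_continuous_0: "mean_continuous (\<lambda>x. 0)"
  by (simp add: mean_continuous_def translation_defect_def)

lemma mean_continuous_sum:
  assumes "\<And>i. i \<in> I \<Longrightarrow> mean_continuous (f i)"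
  shows "mean_continuous (\<lambda>x. \<Sum>i\<in>I. f i x)"
  using assms
  by (induction I rule: infinite_finite_induct) (auto intro: mean_continuous_0 mean_continuous_add)

text \<open>The defect of \<open>f - g\<close> is at most four times its squared norm, for every translation.\<close>

lemma mean_continuous_approx:
  fixes f :: "'a::euclidean_space \<Rightarrow> complex"
  assumes [measurable]: "f \<in> borel_measurable borel"
    and approx: "\<And>e::real. e > 0 \<Longrightarrow>
      \<exists>g. mean_continuous g \<and> (\<integral>\<^sup>+x. ennreal ((cmod (f x - g x))\<^sup>2) \<partial>lborel) \<le> ennreal e"
  shows "mean_continuous f"
  unfolding mean_continuous_def
proof (intro conjI allI impI)
  fix X :: "nat \<Rightarrow> 'a" assume X: "X \<longlonglongrightarrow> 0"
  show "(\<lambda>k. translation_defect f (X k)) \<longlonglongrightarrow> 0"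
  proof (rule ennreal_tendsto_0_I)
    fix e :: real assume e: "e > 0"
    then obtain g where g: "mean_continuous g"
      and d: "(\<integral>\<^sup>+x. ennreal ((cmod (f x - g x))\<^sup>2) \<partial>lborel) \<le> ennreal (e / 16)"
      using approx[of "e / 16"] by auto
    have [measurable]: "g \<in> borel_measurable borel" using g by (simp add: mean_continuous_def)
    have "(\<lambda>k. translation_defect g (X k)) \<longlonglongrightarrow> 0" using g X by (simp add: mean_continuous_def)
    then have "\<forall>\<^sub>F k in sequentially. translation_defect g (X k) < ennreal (e / 4)"
      using e by (intro order_tendstoD(2)) auto
    then show "\<forall>\<^sub>F k in sequentially. translation_defect f (X k) \<le> ennreal e"
    proof eventually_elim
      case (elim k)
      have "translation_defect f (X k) \<le> 2 * translation_defect g (X k)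
          + 2 * translation_defect (\<lambda>x. f x - g x) (X k)"
        using translation_defect_add_le[of g "\<lambda>x. f x - g x"] by simp
      also have "\<dots> \<le> 2 * ennreal (e / 4) + 2 * (4 * ennreal (e / 16))"
      proof (intro add_mono mult_left_mono)
        have "translation_defect (\<lambda>x. f x - g x) (X k) \<le> 4 * (\<integral>\<^sup>+x. ennreal ((cmod (f x - g x))\<^sup>2) \<partial>lborel)"
          by (rule translation_defect_le) measurable
        also have "\<dots> \<le> 4 * ennreal (e / 16)" using d by (rule mult_left_mono) simp
        finally show "translation_defect (\<lambda>x. f x - g x) (X k) \<le> 4 * ennreal (e / 16)" .
      qed (use elim in auto)
      also have "\<dots> = ennreal (2 * (e/4) + 2 * (4 * (e / 16)))"
        using e by (simp only: ennreal_plus ennreal_mult ennreal_numeral)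
      also have "2 * (e/4) + 2 * (4 * (e / 16)) = e" by simp
      finally show ?case .
    qed
  qed
qed fact

text \<open>A point \<open>x\<close> of \<open>U\<close> stays in \<open>U\<close> under small translations, so the measure of
  \<open>{x \<in> U. x + h \<notin> U}\<close> tends to 0 by dominated convergence. The other half of the symmetric
  difference is a translate of the same set for \<open>- h\<close>.\<close>

lemma mean_continuous_open_set:
  fixes U :: "'a::euclidean_space set"
  assumes U: "open U" "emeasure lborel U < \<infinity>"
  shows "mean_continuous (\<lambda>x. indicator U x)"
  unfolding mean_continuous_def
proof (intro conjI allI impI)
  have [measurable]: "U \<in> sets borel" using U by auto
  show "(\<lambda>x. indicator U x :: complex) \<in> borel_measurable borel" by measurable
  have lim: "(\<lambda>k. \<integral>\<^sup>+x. indicator U x * indicator (- U) (x + X k) \<partial>lborel) \<longlonglongrightarrow> 0"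
    if X: "X \<longlonglongrightarrow> 0" for X :: "nat \<Rightarrow> 'a"
  proof -
    have "(\<lambda>k. \<integral>\<^sup>+x. indicator U x * indicator (- U) (x + X k) \<partial>lborel)
        \<longlonglongrightarrow> nn_integral (lborel :: 'a measure) (\<lambda>x. 0)"
    proof (rule nn_integral_dominated_convergence[where w="indicator U"])
      show "AE x in lborel. (\<lambda>k. indicator U x * indicator (- U) (x + X k) :: ennreal) \<longlonglongrightarrow> 0"
      proof (intro always_eventually allI)
        fix x
        show "(\<lambda>k. indicator U x * indicator (- U) (x + X k) :: ennreal) \<longlonglongrightarrow> 0"
        proof (cases "x \<in> U")
          case True
          have "(\<lambda>k. x + X k) \<longlonglongrightarrow> x" using tendsto_add[OF tendsto_const X, of x] by simp
          from topological_tendstoD[OF this U(1) True] show ?thesis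
            by (intro tendsto_eventually) (erule eventually_mono, simp)
        qed simp
      qed
      show "(\<integral>\<^sup>+x. indicator U x \<partial>lborel) < \<infinity>" using U by simp
    qed (auto simp: indicator_def)
    then show ?thesis by simp
  qed
  fix X :: "nat \<Rightarrow> 'a" assume X: "X \<longlonglongrightarrow> 0"
  have eq: "translation_defect (indicator U) (X k)
      = (\<integral>\<^sup>+x. indicator U x * indicator (- U) (x + X k) \<partial>lborel)
      + (\<integral>\<^sup>+x. indicator U x * indicator (- U) (x + (- X k)) \<partial>lborel)" for k
  proof -
    have "translation_defect (indicator U) (X k)
        = (\<integral>\<^sup>+x. indicator U x * indicator (- U) (x + X k) + indicator (- U) x * indicator U (x + X k) \<partial>lborel)"
      unfolding translation_defect_def by (intro nn_integral_cong) (auto simp: indicator_def)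
    also have "\<dots> = (\<integral>\<^sup>+x. indicator U x * indicator (- U) (x + X k) \<partial>lborel)
       + (\<integral>\<^sup>+x. indicator (- U) x * indicator U (x + X k) \<partial>lborel)"
      by (intro nn_integral_add) auto
    also have "(\<integral>\<^sup>+x. indicator (- U) x * indicator U (x + X k) \<partial>lborel)
       = (\<integral>\<^sup>+x. indicator U x * indicator (- U) (x + (- X k)) \<partial>lborel)"
      using nn_integral_lborel_translate[of "\<lambda>x. indicator (- U) x * indicator U (x + X k)" "- X k"]
      by (simp add: mult.commute)
    finally show ?thesis .
  qed
  have "(\<lambda>k. - X k) \<longlonglongrightarrow> 0" using tendsto_minus[OF X] by simp
  from tendsto_add[OF lim[OF X] lim[OF this]]
  show "(\<lambda>k. translation_defect (indicator U) (X k)) \<longlonglongrightarrow> 0"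
    by (simp add: eq)
qed

lemma mean_continuous_set:
  fixes A :: "'a::euclidean_space set"
  assumes A: "A \<in> sets borel" "emeasure lborel A < \<infinity>"
  shows "mean_continuous (\<lambda>x. indicator A x)"
proof (rule mean_continuous_approx)
  show "(\<lambda>x. indicator A x :: complex) \<in> borel_measurable borel" using A by measurable
  fix e :: real assume "e > 0"
  with A obtain U where U: "open U" "A \<subseteq> U" "emeasure lborel (U - A) < e"
    using outer_regular_lborel by metis
  have [measurable]: "U \<in> sets borel" "A \<in> sets borel" using U A by auto
  have "emeasure lborel U \<le> emeasure lborel A + emeasure lborel (U - A)"
    using U(2) by (subst plus_emeasure) (auto simp: Un_absorb1)
  also have "\<dots> < \<infinity>" using A U(3) less_trans[OF U(3) ennreal_less_top] by (simp add: less_top)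
  finally have "mean_continuous (\<lambda>x. indicator U x)" using U by (intro mean_continuous_open_set)
  moreover have "(\<integral>\<^sup>+x. ennreal ((cmod (indicator A x - indicator U x))\<^sup>2) \<partial>lborel) = emeasure lborel (U - A)"
  proof -
    have "(\<lambda>x. ennreal ((cmod (indicator A x - indicator U x))\<^sup>2)) = indicator (U - A)"
      using U(2) by (auto simp: fun_eq_iff split: split_indicator)
    then show ?thesis by simp
  qed
  ultimately show "\<exists>g. mean_continuous g \<and>
      (\<integral>\<^sup>+x. ennreal ((cmod (indicator A x - g x))\<^sup>2) \<partial>lborel) \<le> ennreal e"
    using U(3) by (intro exI[of _ "\<lambda>x. indicator U x"]) auto
qed

text \<open>Continuity in the mean passes from open sets of finite measure, where it is dominated
  convergence, to sets of finite measure by outer regularity, to simple functions by linearity and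
  to all square integrable functions by approximation.\<close>

lemma mean_continuous_square_integrable:
  fixes f :: "'a::euclidean_space \<Rightarrow> complex"
  assumes [measurable]: "f \<in> borel_measurable borel"
    and fin: "(\<integral>\<^sup>+x. ennreal ((cmod (f x))\<^sup>2) \<partial>lborel) < \<infinity>"
  shows "mean_continuous f"
proof (rule mean_continuous_approx)
  obtain S where S: "\<And>i. simple_function lborel (S i)" "\<And>x. (\<lambda>i. S i x) \<longlonglongrightarrow> f x"
    "\<And>i x. dist (S i x) 0 \<le> 2 * dist (f x) 0"
    using borel_measurable_implies_sequence_metric[of f lborel 0] by auto
  have Sm[measurable]: "S i \<in> borel_measurable borel" for i
    using borel_measurable_simple_function[OF S(1)] by simp
  have "mean_continuous (S i)" for i
  proof -
    have finite: "finite (range (S i))" using simple_functionD(1)[OF S(1)] by simp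
    have rep: "S i = (\<lambda>x. \<Sum>y\<in>range (S i) - {0}. y * indicator (S i -` {y}) x)"
    proof
      fix x
      have "(\<Sum>y\<in>range (S i) - {0}. y * indicator (S i -` {y}) x)
          = (\<Sum>y\<in>range (S i) - {0}. if y = S i x then S i x else 0)"
        by (intro sum.cong) (auto simp: indicator_def)
      also have "\<dots> = S i x" using finite by (simp add: sum.delta')
      finally show "S i x = (\<Sum>y\<in>range (S i) - {0}. y * indicator (S i -` {y}) x)" by simp
    qed
    have "mean_continuous (\<lambda>x. \<Sum>y\<in>range (S i) - {0}. y * indicator (S i -` {y}) x)"
    proof (intro mean_continuous_sum mean_continuous_cmult mean_continuous_set)
      fix y assume y: "y \<in> range (S i) - {0}"
      have ms: "S i -` {y} \<in> sets borel"
        using measurable_sets[OF Sm, of "{y}" i] by simp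
      then show "S i -` {y} \<in> sets borel" .
      have "ennreal ((cmod y)\<^sup>2) * emeasure lborel (S i -` {y})
          = (\<integral>\<^sup>+x. ennreal ((cmod y)\<^sup>2) * indicator (S i -` {y}) x \<partial>lborel)"
        using ms by (simp add: nn_integral_cmult)
      also have "\<dots> \<le> (\<integral>\<^sup>+x. 4 * ennreal ((cmod (f x))\<^sup>2) \<partial>lborel)"
      proof (rule nn_integral_mono)
        fix x
        have "(cmod (S i x))\<^sup>2 \<le> (2 * cmod (f x))\<^sup>2"
          using S(3)[of i x] by (intro power_mono) auto
        then have "ennreal ((cmod (S i x))\<^sup>2) \<le> ennreal (4 * (cmod (f x))\<^sup>2)"
          by (intro ennreal_leI) (simp add: power_mult_distrib)
        then show "ennreal ((cmod y)\<^sup>2) * indicator (S i -` {y}) x \<le> 4 * ennreal ((cmod (f x))\<^sup>2)"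
          by (auto simp: indicator_def ennreal_mult)
      qed
      also have "\<dots> < \<infinity>" using fin by (simp add: nn_integral_cmult ennreal_mult_less_top)
      finally show "emeasure lborel (S i -` {y}) < \<infinity>"
        using y by (auto simp: ennreal_mult_less_top)
    qed
    then show ?thesis using rep by simp
  qed
  moreover have "\<exists>i. (\<integral>\<^sup>+x. ennreal ((cmod (f x - S i x))\<^sup>2) \<partial>lborel) \<le> ennreal e" if e: "e > 0" for e
  proof -
    have "(\<lambda>i. \<integral>\<^sup>+x. ennreal ((cmod (f x - S i x))\<^sup>2) \<partial>lborel) \<longlonglongrightarrow> nn_integral (lborel :: 'a measure) (\<lambda>x. ennreal 0)"
    proof (rule nn_integral_dominated_convergence[where w="\<lambda>x. 9 * ennreal ((cmod (f x))\<^sup>2)"])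
      show "AE x in lborel. ennreal ((cmod (f x - S i x))\<^sup>2) \<le> 9 * ennreal ((cmod (f x))\<^sup>2)" for i
      proof (intro always_eventually allI)
        fix x
        have "cmod (f x - S i x) \<le> 3 * cmod (f x)"
          using S(3)[of i x] norm_triangle_ineq4[of "f x" "S i x"] by simp
        then have "(cmod (f x - S i x))\<^sup>2 \<le> (3 * cmod (f x))\<^sup>2" by (intro power_mono) auto
        then have "ennreal ((cmod (f x - S i x))\<^sup>2) \<le> ennreal (9 * (cmod (f x))\<^sup>2)"
          by (intro ennreal_leI) (simp add: power_mult_distrib)
        then show "ennreal ((cmod (f x - S i x))\<^sup>2) \<le> 9 * ennreal ((cmod (f x))\<^sup>2)"
          by (simp add: ennreal_mult)
      qed
      show "(\<integral>\<^sup>+x. 9 * ennreal ((cmod (f x))\<^sup>2) \<partial>lborel) < \<infinity>"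
        using fin by (simp add: nn_integral_cmult ennreal_mult_less_top)
      show "AE x in lborel. (\<lambda>i. ennreal ((cmod (f x - S i x))\<^sup>2)) \<longlonglongrightarrow> ennreal 0"
      proof (intro always_eventually allI tendsto_ennrealI)
        fix x
        have "(\<lambda>i. (cmod (f x - S i x))\<^sup>2) \<longlonglongrightarrow> (cmod (f x - f x))\<^sup>2"
          by (intro tendsto_intros S(2))
        then show "(\<lambda>i. (cmod (f x - S i x))\<^sup>2) \<longlonglongrightarrow> 0" by simp
      qed
    qed auto
    then have "(\<lambda>i. \<integral>\<^sup>+x. ennreal ((cmod (f x - S i x))\<^sup>2) \<partial>lborel) \<longlonglongrightarrow> 0" by simp
    then have "\<forall>\<^sub>F i in sequentially. (\<integral>\<^sup>+x. ennreal ((cmod (f x - S i x))\<^sup>2) \<partial>lborel) < ennreal e"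
      using e by (intro order_tendstoD(2)) auto
    from eventually_happens'[OF sequentially_bot this] show ?thesis by (auto intro: less_imp_le)
  qed
  ultimately show "\<exists>g. mean_continuous g \<and> (\<integral>\<^sup>+x. ennreal ((cmod (f x - g x))\<^sup>2) \<partial>lborel) \<le> ennreal e"
    if "e > 0" for e using that by blast
qed fact

section \<open>The Plancherel identity\<close>

subsection \<open>Gaussians\<close>

lemma borel_measurable_cnj [measurable (raw)]:
  assumes "f \<in> borel_measurable M"
  shows "(\<lambda>x. cnj (f x)) \<in> borel_measurable M"
  using borel_measurable_continuous_onI[OF continuous_on_cnj[OF continuous_on_id]] assms
  by (rule measurable_compose_rev)

text \<open>The standard normal density, in product form so that its integrals factor.\<close>

definition gauss :: "'a::euclidean_space \<Rightarrow> real" where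
  "gauss x = (\<Prod>b\<in>Basis. std_normal_density (x \<bullet> b))"

lemma gauss_measurable [measurable]: "gauss \<in> borel_measurable borel"
  unfolding gauss_def by measurable

lemma gauss_nonneg [simp]: "0 \<le> gauss x"
  unfolding gauss_def by (intro prod_nonneg) (simp add: std_normal_density_def)

lemma gauss_eq:
  fixes x :: "'a::euclidean_space"
  shows "gauss x = exp (- (norm x)\<^sup>2 / 2) / sqrt (2 * pi) ^ DIM('a)"
proof -
  have "(norm x)\<^sup>2 = (\<Sum>b\<in>Basis. (x \<bullet> b)\<^sup>2)"
    by (simp add: norm_eq_sqrt_inner euclidean_inner[of x x] power2_eq_square[of "x \<bullet> _"] sum_nonneg)
  then have "- (norm x)\<^sup>2 / 2 = (\<Sum>b\<in>Basis. - (x \<bullet> b)\<^sup>2 / 2)"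
    by (simp add: sum_negf flip: sum_divide_distrib)
  then have "exp (- (norm x)\<^sup>2 / 2) = (\<Prod>b\<in>Basis. exp (- (x \<bullet> b)\<^sup>2 / 2))"
    by (simp only: exp_sum finite_Basis)
  then show ?thesis
    by (simp add: gauss_def std_normal_density_def prod_dividef)
qed

lemma lborel_prod_integral:
  fixes f :: "'a::euclidean_space \<Rightarrow> real \<Rightarrow> 'b::{real_normed_field,banach,second_countable_topology}"
  assumes "\<And>b. b \<in> Basis \<Longrightarrow> integrable lborel (f b)"
  shows "integrable lborel (\<lambda>x::'a. \<Prod>b\<in>Basis. f b (x \<bullet> b))"
    and "(\<integral>x. (\<Prod>b\<in>Basis. f b (x \<bullet> b)) \<partial>(lborel :: 'a measure)) = (\<Prod>b\<in>Basis. \<integral>x. f b x \<partial>lborel)"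
proof -
  interpret product_sigma_finite "\<lambda>_::'a. lborel :: real measure" by standard
  have [measurable]: "f b \<in> borel_measurable borel" if "b \<in> Basis" for b
    using borel_measurable_integrable[OF assms[OF that]] by simp
  have m: "(\<lambda>g. \<Sum>b\<in>Basis. g b *\<^sub>R b) \<in> measurable (Pi\<^sub>M Basis (\<lambda>_. lborel :: real measure)) (borel :: 'a measure)"
    by measurable
  have m2: "(\<lambda>x::'a. \<Prod>b\<in>Basis. f b (x \<bullet> b)) \<in> borel_measurable borel"
    by measurable
  have eq: "(\<Prod>b\<in>Basis. f b ((\<Sum>b\<in>Basis. g b *\<^sub>R b) \<bullet> b)) = (\<Prod>b\<in>Basis. f b (g b))" for g :: "'a \<Rightarrow> real"
    by (intro prod.cong refl) simp
  show "integrable lborel (\<lambda>x::'a. \<Prod>b\<in>Basis. f b (x \<bullet> b))"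
    by (subst lborel_eq, subst integrable_distr_eq[OF m m2], unfold eq)
       (rule product_integrable_prod, use assms in auto)
  show "(\<integral>x. (\<Prod>b\<in>Basis. f b (x \<bullet> b)) \<partial>(lborel :: 'a measure)) = (\<Prod>b\<in>Basis. \<integral>x. f b x \<partial>lborel)"
    by (subst lborel_eq, subst integral_distr[OF m m2], unfold eq)
       (rule product_integral_prod, use assms in auto)
qed

lemma gauss_integral: "integrable lborel (gauss :: 'a::euclidean_space \<Rightarrow> real)"
    "(\<integral>x. gauss (x::'a) \<partial>lborel) = 1"
  unfolding gauss_def
  using lborel_prod_integral[of "\<lambda>_::'a. std_normal_density"]
  by (auto simp: integrable_normal_density integral_normal_density)

text \<open>In each coordinate this is the characteristic function of the normal distribution.\<close>

lemma gauss_fourier: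
  fixes z :: "'a::euclidean_space"
  shows "(\<integral>x. gauss x * exp (\<i> * complex_of_real (z \<bullet> x)) \<partial>lborel)
     = sqrt (2 * pi) ^ DIM('a) * gauss z"
proof -
  define f where "f b x = complex_of_real (std_normal_density x) * exp (\<i> * complex_of_real ((z \<bullet> b) * x))"
    for b x
  have int: "integrable lborel (f b)" for b
    unfolding f_def
    by (rule Bochner_Integration.integrable_bound[OF integrable_normal_density[of 1 0]])
       (auto simp: norm_mult)
  have val: "(\<integral>x. f b x \<partial>lborel) = exp (- (z \<bullet> b)\<^sup>2 / 2)" for b
  proof -
    have "char std_normal_distribution (z \<bullet> b) = (\<integral>x. f b x \<partial>lborel)"
      unfolding char_def f_def
      by (subst integral_density) (auto simp: std_normal_density_def scaleR_conv_of_real)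
    then show ?thesis by (simp add: char_std_normal_distribution)
  qed
  have "gauss x * exp (\<i> * complex_of_real (z \<bullet> x)) = (\<Prod>b\<in>Basis. f b (x \<bullet> b))" for x
    by (subst euclidean_inner[of z x])
       (simp add: gauss_def f_def prod.distrib sum_distrib_left exp_sum)
  then have "(\<integral>x. gauss x * exp (\<i> * complex_of_real (z \<bullet> x)) \<partial>lborel)
      = (\<Prod>b\<in>Basis. complex_of_real (exp (- (z \<bullet> b)\<^sup>2 / 2)))"
    using lborel_prod_integral(2)[of f, OF int] by (simp add: val)
  also have "\<dots> = sqrt (2 * pi) ^ DIM('a) * gauss z"
    by (simp add: gauss_def std_normal_density_def prod_dividef)
  finally show ?thesis .
qed

subsection \<open>The identity\<close>

text \<open>The kernels will be \<open>exp (\<plusminus> i x \<bullet> \<xi>)\<close>: exchanging the integrals moves a Fourier transform from one factor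
  of a pairing to the other.\<close>

lemma Fubini_bounded_kernel:
  fixes f g :: "'a::euclidean_space \<Rightarrow> complex" and k :: "'a \<Rightarrow> 'a \<Rightarrow> complex"
  assumes f: "integrable lborel f" and g: "integrable lborel g"
    and k[measurable]: "(\<lambda>(x, y). k x y) \<in> borel_measurable (borel \<Otimes>\<^sub>M borel)"
    and k1: "\<And>x y. cmod (k x y) \<le> 1"
  shows "(\<integral>x. f x * (\<integral>y. k x y * g y \<partial>lborel) \<partial>lborel)
       = (\<integral>y. (\<integral>x. k x y * f x \<partial>lborel) * g y \<partial>lborel)"
proof -
  have [measurable]: "f \<in> borel_measurable borel" "g \<in> borel_measurable borel"
    using f g by auto
  have int: "integrable (lborel \<Otimes>\<^sub>M lborel) (\<lambda>(x, y). f x * (k x y * g y))"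
  proof (rule lborel_pair.Fubini_integrable)
    have bd: "norm (f x * (k x y * g y)) \<le> norm (f x) * norm (g y)" for x y
      using k1[of x y] by (simp add: norm_mult mult_left_le_one_le mult_left_mono)
    have iy: "integrable lborel (\<lambda>y. f x * (k x y * g y))" for x
      by (rule Bochner_Integration.integrable_bound[OF integrable_mult_right[OF integrable_norm[OF g], of "norm (f x)"]])
         (use bd in auto)
    then show "AE x in lborel. integrable lborel (\<lambda>y. (\<lambda>(x, y). f x * (k x y * g y)) (x, y))" by simp
    show "integrable lborel (\<lambda>x. \<integral>y. norm ((\<lambda>(x, y). f x * (k x y * g y)) (x, y)) \<partial>lborel)"
    proof (rule Bochner_Integration.integrable_bound)
      show "integrable lborel (\<lambda>x. norm (f x) * (\<integral>y. norm (g y) \<partial>lborel))"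
        using f by simp
      show "AE x in lborel. norm (\<integral>y. norm ((\<lambda>(x, y). f x * (k x y * g y)) (x, y)) \<partial>lborel)
          \<le> norm (norm (f x) * (\<integral>y. norm (g y) \<partial>lborel))"
      proof (intro always_eventually allI)
        fix x
        have "(\<integral>y. norm (f x * (k x y * g y)) \<partial>lborel) \<le> (\<integral>y. norm (f x) * norm (g y) \<partial>lborel)"
          by (intro integral_mono bd integrable_norm iy) (use g in simp)
        then show "norm (\<integral>y. norm ((\<lambda>(x, y). f x * (k x y * g y)) (x, y)) \<partial>lborel)
          \<le> norm (norm (f x) * (\<integral>y. norm (g y) \<partial>lborel))"
          by simp
      qed
    qed measurable
  qed measurable
  have "(\<integral>x. f x * (\<integral>y. k x y * g y \<partial>lborel) \<partial>lborel)
      = (\<integral>x. (\<integral>y. f x * (k x y * g y) \<partial>lborel) \<partial>lborel)"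
    by simp
  also have "\<dots> = (\<integral>y. (\<integral>x. f x * (k x y * g y) \<partial>lborel) \<partial>lborel)"
    using lborel_pair.Fubini_integral[OF int] by simp
  also have "\<dots> = (\<integral>y. (\<integral>x. k x y * f x \<partial>lborel) * g y \<partial>lborel)"
  proof (intro Bochner_Integration.integral_cong refl)
    fix y
    have "(\<lambda>x. f x * (k x y * g y)) = (\<lambda>x. (k x y * f x) * g y)" by (simp add: mult_ac)
    then show "(\<integral>x. f x * (k x y * g y) \<partial>lborel) = (\<integral>x. k x y * f x \<partial>lborel) * g y" by simp
  qed
  finally show ?thesis .
qed

lemma integral_lborel_scale:
  fixes f :: "'a::euclidean_space \<Rightarrow> 'b::{banach,second_countable_topology}"
  assumes "c > 0" and [measurable]: "f \<in> borel_measurable borel"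
  shows "(\<integral>x. f x \<partial>lborel) = c ^ DIM('a) *\<^sub>R (\<integral>x. f (t + c *\<^sub>R x) \<partial>lborel)"
  using assms(1)
  by (subst lborel_affine[of c t]) (simp_all add: integral_density integral_distr)

lemma integrable_lborel_scale:
  fixes f :: "'a::euclidean_space \<Rightarrow> 'b::{banach,second_countable_topology}"
  assumes "c > 0" and f: "integrable lborel f"
  shows "integrable lborel (\<lambda>x. f (t + c *\<^sub>R x))"
proof -
  have [measurable]: "f \<in> borel_measurable borel" using f by auto
  have "integrable (density (distr lborel borel (\<lambda>x. t + c *\<^sub>R x)) (\<lambda>_. ennreal (c ^ DIM('a)))) f"
    using f lborel_affine[of c t] assms(1) by simp
  then have "integrable lborel (\<lambda>x. c ^ DIM('a) *\<^sub>R f (t + c *\<^sub>R x))"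
    using assms(1) by (simp add: integrable_density integrable_distr_eq)
  from integrable_scaleR_right[OF this, of "1 / c ^ DIM('a)"] show ?thesis
    using assms(1) by simp
qed

lemma gauss_fourier_scaled:
  fixes z :: "'a::euclidean_space"
  assumes "e > 0"
  shows "(\<integral>x. gauss (e *\<^sub>R x) * exp (\<i> * complex_of_real (z \<bullet> x)) \<partial>lborel)
     = (sqrt (2 * pi) / e) ^ DIM('a) * gauss (z /\<^sub>R e)"
proof -
  have "(\<integral>x. gauss (e *\<^sub>R x) * exp (\<i> * complex_of_real (z \<bullet> x)) \<partial>lborel)
    = (1/e) ^ DIM('a) *\<^sub>R (\<integral>x. gauss (e *\<^sub>R (0 + (1/e) *\<^sub>R x)) * exp (\<i> * complex_of_real (z \<bullet> (0 + (1/e) *\<^sub>R x))) \<partial>lborel)"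
    using assms by (intro integral_lborel_scale) auto
  also have "\<dots> = (1/e) ^ DIM('a) *\<^sub>R (\<integral>x. gauss x * exp (\<i> * complex_of_real ((z /\<^sub>R e) \<bullet> x)) \<partial>lborel)"
    using assms by (simp add: divide_inverse mult.commute)
  also have "\<dots> = (sqrt (2 * pi) / e) ^ DIM('a) * gauss (z /\<^sub>R e)"
    by (subst gauss_fourier) (simp add: power_divide scaleR_conv_of_real)
  finally show ?thesis .
qed

lemma gauss_scale_integrable: "e > 0 \<Longrightarrow> integrable lborel (\<lambda>x::'a::euclidean_space. gauss (e *\<^sub>R x))"
  using integrable_lborel_scale[OF _ gauss_integral(1), of e 0] by simp

text \<open>Inserting the definition of \<open>F\<close> twice and carrying out the integration over \<open>\<xi>\<close> turns the
  regularized norm of the transform into the correlation of \<open>f\<close> with its translates.\<close>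

lemma gauss_regularized_norm:
  fixes f :: "'a::euclidean_space \<Rightarrow> complex"
  assumes f: "integrable lborel f" and e: "e > 0"
  defines "F \<equiv> (\<lambda>\<xi>. \<integral>x. exp (- \<i> * complex_of_real (x \<bullet> \<xi>)) * f x \<partial>lborel)"
  shows "complex_of_real (\<integral>\<xi>. gauss (e *\<^sub>R \<xi>) * (cmod (F \<xi>))\<^sup>2 \<partial>lborel)
    = sqrt (2 * pi) ^ DIM('a) * (\<integral>x. f x * (\<integral>z. gauss z * cnj (f (x + e *\<^sub>R z)) \<partial>lborel) \<partial>lborel)"
    and "F \<in> borel_measurable borel" and "cmod (F \<xi>) \<le> (\<integral>x. cmod (f x) \<partial>lborel)"
proof -
  have fm[measurable]: "f \<in> borel_measurable borel" using f by auto
  show Fm[measurable]: "F \<in> borel_measurable borel"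
    unfolding F_def by (intro lborel.borel_measurable_lebesgue_integral) measurable
  show F_bound: "cmod (F \<xi>) \<le> (\<integral>x. cmod (f x) \<partial>lborel)" for \<xi>
  proof -
    have "cmod (F \<xi>) \<le> (\<integral>x. cmod (exp (- \<i> * complex_of_real (x \<bullet> \<xi>)) * f x) \<partial>lborel)"
      unfolding F_def by (rule integral_norm_bound)
    then show ?thesis by (simp add: norm_mult)
  qed
  define B where "B = (\<integral>x. cmod (f x) \<partial>lborel)"
  define g where "g \<xi> = complex_of_real (gauss (e *\<^sub>R \<xi>)) * cnj (F \<xi>)" for \<xi>
  have g: "integrable lborel g"
  proof (rule Bochner_Integration.integrable_bound)
    show "integrable lborel (\<lambda>\<xi>::'a. gauss (e *\<^sub>R \<xi>) * B)" 
      by (intro integrable_mult_left gauss_scale_integrable e)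
    show "AE \<xi> in lborel. norm (g \<xi>) \<le> norm (gauss (e *\<^sub>R \<xi>) * B)"
      using F_bound unfolding g_def B_def
      by (intro always_eventually allI) (simp add: norm_mult abs_mult mult_left_mono order_trans[OF _ abs_ge_self])
    show "g \<in> borel_measurable lborel" unfolding g_def by measurable
  qed
  have inner: "(\<integral>\<xi>. exp (- \<i> * complex_of_real (x \<bullet> \<xi>)) * g \<xi> \<partial>lborel)
      = sqrt (2 * pi) ^ DIM('a) * (\<integral>z. gauss z * cnj (f (x + e *\<^sub>R z)) \<partial>lborel)" for x
  proof -
    define h where "h \<xi> = exp (- \<i> * complex_of_real (x \<bullet> \<xi>)) * complex_of_real (gauss (e *\<^sub>R \<xi>))" for \<xi>
    have [measurable]: "h \<in> borel_measurable borel" unfolding h_def by measurable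
    have h: "integrable lborel h"
      by (rule Bochner_Integration.integrable_bound[OF gauss_scale_integrable[OF e]])
         (auto simp: h_def norm_mult)
    have cF: "cnj (F \<xi>) = (\<integral>y. exp (\<i> * complex_of_real (y \<bullet> \<xi>)) * cnj (f y) \<partial>lborel)" for \<xi>
      unfolding F_def by (subst Bochner_Integration.integral_cnj[symmetric]) (simp add: exp_cnj)
    have "(\<integral>\<xi>. exp (- \<i> * complex_of_real (x \<bullet> \<xi>)) * g \<xi> \<partial>lborel)
       = (\<integral>\<xi>. h \<xi> * (\<integral>y. exp (\<i> * complex_of_real (y \<bullet> \<xi>)) * cnj (f y) \<partial>lborel) \<partial>lborel)"
      by (simp add: g_def h_def cF mult_ac)
    also have "\<dots> = (\<integral>y. (\<integral>\<xi>. exp (\<i> * complex_of_real (y \<bullet> \<xi>)) * h \<xi> \<partial>lborel) * cnj (f y) \<partial>lborel)"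
      by (rule Fubini_bounded_kernel[OF h]) (use f in auto)
    also have "\<dots> = (\<integral>y. ((sqrt (2 * pi) / e) ^ DIM('a) * gauss ((y - x) /\<^sub>R e)) * cnj (f y) \<partial>lborel)"
    proof (intro Bochner_Integration.integral_cong refl arg_cong2[where f="(*)"])
      fix y
      have "exp (\<i> * complex_of_real (y \<bullet> \<xi>)) * h \<xi>
          = gauss (e *\<^sub>R \<xi>) * exp (\<i> * complex_of_real ((y - x) \<bullet> \<xi>))" for \<xi>
        by (simp add: h_def inner_diff_left algebra_simps flip: exp_add)
      then show "(\<integral>\<xi>. exp (\<i> * complex_of_real (y \<bullet> \<xi>)) * h \<xi> \<partial>lborel)
          = complex_of_real ((sqrt (2 * pi) / e) ^ DIM('a) * gauss ((y - x) /\<^sub>R e))"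
        using gauss_fourier_scaled[OF e, of "y - x"] by simp
    qed
    also have "\<dots> = e ^ DIM('a) *\<^sub>R (\<integral>z. ((sqrt (2 * pi) / e) ^ DIM('a) * gauss ((x + e *\<^sub>R z - x) /\<^sub>R e)) * cnj (f (x + e *\<^sub>R z)) \<partial>lborel)"
      by (rule integral_lborel_scale[OF e]) measurable
    also have "\<dots> = e ^ DIM('a) *\<^sub>R (\<integral>z. complex_of_real ((sqrt (2 * pi) / e) ^ DIM('a)) * (gauss z * cnj (f (x + e *\<^sub>R z))) \<partial>lborel)"
      using e by (simp add: mult.assoc)
    also have "\<dots> = sqrt (2 * pi) ^ DIM('a) * (\<integral>z. gauss z * cnj (f (x + e *\<^sub>R z)) \<partial>lborel)"
      using e by (simp only: integral_mult_right_zero) (simp add: power_divide scaleR_conv_of_real)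
    finally show ?thesis .
  qed
  have "complex_of_real (\<integral>\<xi>. gauss (e *\<^sub>R \<xi>) * (cmod (F \<xi>))\<^sup>2 \<partial>lborel) = (\<integral>\<xi>. F \<xi> * g \<xi> \<partial>lborel)"
  proof -
    have "F \<xi> * g \<xi> = complex_of_real (gauss (e *\<^sub>R \<xi>) * (cmod (F \<xi>))\<^sup>2)" for \<xi>
      using complex_norm_square[of "F \<xi>"] unfolding g_def by (simp add: mult_ac)
    then show ?thesis by (simp only: integral_complex_of_real)
  qed
  also have "\<dots> = (\<integral>\<xi>. (\<integral>x. exp (- \<i> * complex_of_real (x \<bullet> \<xi>)) * f x \<partial>lborel) * g \<xi> \<partial>lborel)"
    by (simp add: F_def)
  also have "\<dots> = (\<integral>x. f x * (\<integral>\<xi>. exp (- \<i> * complex_of_real (x \<bullet> \<xi>)) * g \<xi> \<partial>lborel) \<partial>lborel)"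
    by (rule Fubini_bounded_kernel[OF f g, symmetric]) auto
  also have "\<dots> = (\<integral>x. sqrt (2 * pi) ^ DIM('a) * (f x * (\<integral>z. gauss z * cnj (f (x + e *\<^sub>R z)) \<partial>lborel)) \<partial>lborel)"
    by (simp only: inner mult.left_commute)
  finally show "complex_of_real (\<integral>\<xi>. gauss (e *\<^sub>R \<xi>) * (cmod (F \<xi>))\<^sup>2 \<partial>lborel)
    = sqrt (2 * pi) ^ DIM('a) * (\<integral>x. f x * (\<integral>z. gauss z * cnj (f (x + e *\<^sub>R z)) \<partial>lborel) \<partial>lborel)"
    by simp
qed

text \<open>Polarization, \<open>|f(x + e z) - f(x)|\<^sup>2 = |f(x + e z)|\<^sup>2 + |f(x)|\<^sup>2 - 2 Re (f(x) cnj (f(x + e z)))\<close>,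
  integrated over \<open>x\<close> and against the Gaussian in \<open>z\<close>: both squares contribute the squared norm of \<open>f\<close>,
  since translations preserve it. The limit is dominated convergence in \<open>z\<close>.\<close>

lemma gauss_correlation:
  fixes f :: "'a::euclidean_space \<Rightarrow> complex"
  assumes [measurable]: "f \<in> borel_measurable borel" and f2: "integrable lborel (\<lambda>x. (cmod (f x))\<^sup>2)"
  defines "D \<equiv> (\<lambda>e. \<integral>\<^sup>+z. ennreal (gauss z) * translation_defect f (e *\<^sub>R z) \<partial>lborel)"
  shows "Re (\<integral>x. f x * (\<integral>z. gauss z * cnj (f (x + e *\<^sub>R z)) \<partial>lborel) \<partial>lborel)
    = (\<integral>x. (cmod (f x))\<^sup>2 \<partial>lborel) - enn2real (D e) / 2"
    and "(\<lambda>k. enn2real (D (1 / Suc k))) \<longlonglongrightarrow> 0"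
proof -
  define N where "N = (\<integral>x. (cmod (f x))\<^sup>2 \<partial>lborel)"
  have Nn: "(\<integral>\<^sup>+x. ennreal ((cmod (f x))\<^sup>2) \<partial>lborel) = ennreal N"
    unfolding N_def by (rule nn_integral_eq_integral[OF f2]) simp
  have [simp]: "0 \<le> N" unfolding N_def by simp
  have gn: "(\<integral>\<^sup>+z. ennreal (gauss z) \<partial>(lborel :: 'a measure)) = 1"
    by (subst nn_integral_eq_integral[OF gauss_integral(1)]) (auto simp: gauss_integral(2))
  have tdm[measurable]: "translation_defect f \<in> borel_measurable borel"
    unfolding translation_defect_def by (intro lborel.borel_measurable_nn_integral) measurable
  have tdle: "translation_defect f h \<le> ennreal (4 * N)" for h
    using translation_defect_le[of f h] by (simp add: Nn ennreal_mult)
  \<comment> \<open>the three functions on the product space that the polarization identity relates\<close>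
  define H where "H = (\<lambda>(x, z). complex_of_real (gauss z) * (f x * cnj (f (x + e *\<^sub>R z))))"
  define P1 where "P1 = (\<lambda>(x, z::'a). gauss z * (cmod (f x))\<^sup>2)"
  define P2 where "P2 = (\<lambda>(x, z). gauss z * (cmod (f (x + e *\<^sub>R z)))\<^sup>2)"
  define Q where "Q = (\<lambda>(x, z). gauss z * (cmod (f (x + e *\<^sub>R z) - f x))\<^sup>2)"
  have [measurable]: "H \<in> borel_measurable (lborel \<Otimes>\<^sub>M lborel)" "P1 \<in> borel_measurable (lborel \<Otimes>\<^sub>M lborel)"
    "P2 \<in> borel_measurable (lborel \<Otimes>\<^sub>M lborel)" "Q \<in> borel_measurable (lborel \<Otimes>\<^sub>M lborel)"
    unfolding H_def P1_def P2_def Q_def by measurable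
  have nonneg: "0 \<le> P1 p" "0 \<le> P2 p" "0 \<le> Q p" for p
    by (auto simp: P1_def P2_def Q_def split: prod.split)
  have n: "(\<integral>\<^sup>+p. ennreal (P p) \<partial>(lborel \<Otimes>\<^sub>M lborel)) = (\<integral>\<^sup>+z. \<integral>\<^sup>+x. ennreal (P (x, z)) \<partial>lborel \<partial>lborel)"
    if [measurable]: "P \<in> borel_measurable (lborel \<Otimes>\<^sub>M lborel)" for P :: "'a \<times> 'a \<Rightarrow> real"
    by (rule lborel_pair.nn_integral_snd[symmetric]) measurable
  have n1: "(\<integral>\<^sup>+p. ennreal (P1 p) \<partial>(lborel \<Otimes>\<^sub>M lborel)) = ennreal N"
    by (subst n) (auto simp: P1_def ennreal_mult nn_integral_cmult Nn nn_integral_multc gn)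
  have n2: "(\<integral>\<^sup>+p. ennreal (P2 p) \<partial>(lborel \<Otimes>\<^sub>M lborel)) = ennreal N"
    using nn_integral_lborel_translate[of "\<lambda>x. ennreal ((cmod (f x))\<^sup>2)"]
    by (subst n) (auto simp: P2_def ennreal_mult nn_integral_cmult Nn nn_integral_multc gn)
  have n3: "(\<integral>\<^sup>+p. ennreal (Q p) \<partial>(lborel \<Otimes>\<^sub>M lborel)) = D e"
    by (subst n) (auto simp: Q_def D_def translation_defect_def ennreal_mult nn_integral_cmult)
  have i1: "integrable (lborel \<Otimes>\<^sub>M lborel) P1" and i2: "integrable (lborel \<Otimes>\<^sub>M lborel) P2"
    using n1 n2 nonneg by (auto intro!: integrableI_nonneg)
  have iv1: "integral\<^sup>L (lborel \<Otimes>\<^sub>M lborel) P1 = N" and iv2: "integral\<^sup>L (lborel \<Otimes>\<^sub>M lborel) P2 = N"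
    by (subst integral_eq_nn_integral; use n1 n2 nonneg in simp)+
  have iH: "integrable (lborel \<Otimes>\<^sub>M lborel) H"
  proof (rule Bochner_Integration.integrable_bound[OF Bochner_Integration.integrable_add[OF i1 i2]])
    have "gauss z * (cmod (f x) * cmod (f y)) \<le> gauss z * (cmod (f x))\<^sup>2 + gauss z * (cmod (f y))\<^sup>2" for x y z
    proof -
      have "0 \<le> (cmod (f x) - cmod (f y))\<^sup>2" "0 \<le> (cmod (f x))\<^sup>2" "0 \<le> (cmod (f y))\<^sup>2" by auto
      then have "cmod (f x) * cmod (f y) \<le> (cmod (f x))\<^sup>2 + (cmod (f y))\<^sup>2"
        unfolding power2_diff by linarith
      from mult_left_mono[OF this gauss_nonneg] show ?thesis by (simp add: distrib_left)
    qed
    then show "AE p in lborel \<Otimes>\<^sub>M lborel. norm (H p) \<le> norm (P1 p + P2 p)"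
      by (intro always_eventually) (auto simp: H_def P1_def P2_def norm_mult)
  qed measurable
  have Q_eq: "Q p = P1 p + P2 p - 2 * Re (H p)" for p
  proof (cases p)
    case (Pair x z)
    have ab: "(cmod (a - b))\<^sup>2 = (cmod a)\<^sup>2 + (cmod b)\<^sup>2 - 2 * Re (b * cnj a)" for a b
      by (simp add: cmod_power2 power2_diff)
    have "Q p = gauss z * ((cmod (f (x + e *\<^sub>R z)))\<^sup>2 + (cmod (f x))\<^sup>2 - 2 * Re (f x * cnj (f (x + e *\<^sub>R z))))"
      unfolding Pair Q_def by (simp only: prod.case ab)
    then show ?thesis
      by (simp add: Pair P1_def P2_def H_def algebra_simps)
  qed
  have "integral\<^sup>L (lborel \<Otimes>\<^sub>M lborel) Q = 2 * N - 2 * Re (integral\<^sup>L (lborel \<Otimes>\<^sub>M lborel) H)"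
    unfolding Q_eq[abs_def] using i1 i2 iv1 iv2 iH by (simp add: integral_Re)
  moreover have "integral\<^sup>L (lborel \<Otimes>\<^sub>M lborel) Q = enn2real (D e)"
    by (subst integral_eq_nn_integral) (use nonneg n3 in auto)
  moreover have "integral\<^sup>L (lborel \<Otimes>\<^sub>M lborel) H
      = (\<integral>x. f x * (\<integral>z. gauss z * cnj (f (x + e *\<^sub>R z)) \<partial>lborel) \<partial>lborel)"
  proof -
    have "integral\<^sup>L (lborel \<Otimes>\<^sub>M lborel) H = (\<integral>x. (\<integral>z. H (x, z) \<partial>lborel) \<partial>lborel)"
      by (rule lborel_pair.integral_fst'[OF iH, symmetric])
    also have "\<dots> = (\<integral>x. (\<integral>z. f x * (gauss z * cnj (f (x + e *\<^sub>R z))) \<partial>lborel) \<partial>lborel)"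
      by (simp add: H_def mult_ac)
    finally show ?thesis by simp
  qed
  ultimately have "enn2real (D e) = 2 * N
      - 2 * Re (\<integral>x. f x * (\<integral>z. gauss z * cnj (f (x + e *\<^sub>R z)) \<partial>lborel) \<partial>lborel)"
    by simp
  then show "Re (\<integral>x. f x * (\<integral>z. gauss z * cnj (f (x + e *\<^sub>R z)) \<partial>lborel) \<partial>lborel)
    = (\<integral>x. (cmod (f x))\<^sup>2 \<partial>lborel) - enn2real (D e) / 2"
    unfolding N_def[symmetric] by linarith
  have mc: "mean_continuous f"
    by (rule mean_continuous_square_integrable) (auto simp: Nn)
  have "(\<lambda>k. D (1 / Suc k)) \<longlonglongrightarrow> nn_integral (lborel :: 'a measure) (\<lambda>z. ennreal (gauss z) * 0)"
    unfolding D_def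
  proof (rule nn_integral_dominated_convergence[where w="\<lambda>z. ennreal (gauss z) * ennreal (4 * N)"])
    show "AE z in lborel. ennreal (gauss z) * translation_defect f ((1 / Suc k) *\<^sub>R z) \<le> ennreal (gauss z) * ennreal (4 * N)" for k
      by (intro always_eventually allI mult_left_mono tdle) auto
    show "(\<integral>\<^sup>+z. ennreal (gauss z) * ennreal (4 * N) \<partial>(lborel :: 'a measure)) < \<infinity>"
      by (subst nn_integral_multc) (auto simp: gn)
    show "AE z in lborel. (\<lambda>k. ennreal (gauss z) * translation_defect f ((1 / Suc k) *\<^sub>R z)) \<longlonglongrightarrow> ennreal (gauss z) * 0"
    proof (intro always_eventually allI ennreal_tendsto_cmult)
      fix z :: 'a
      have "(\<lambda>k. (1 / real (Suc k)) *\<^sub>R z) \<longlonglongrightarrow> 0 *\<^sub>R z"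
        by (intro tendsto_scaleR tendsto_const LIMSEQ_inverse_real_of_nat[unfolded inverse_eq_divide])
      then show "(\<lambda>k. translation_defect f ((1 / Suc k) *\<^sub>R z)) \<longlonglongrightarrow> 0"
        using mc unfolding mean_continuous_def by simp
    qed auto
  qed measurable
  then have "(\<lambda>k. D (1 / Suc k)) \<longlonglongrightarrow> ennreal 0" by simp
  from tendsto_enn2real[OF this] show "(\<lambda>k. enn2real (D (1 / Suc k))) \<longlonglongrightarrow> 0" by simp
qed

text \<open>Multiply the squared transform by Gaussians that increase to 1. The regularized integral is
  \<open>(2\<pi>)\<^sup>n\<close> times the correlation of \<open>f\<close> with itself at distances of the order of the inverse width, and by
  continuity of translations in the mean this correlation tends to the squared norm.\<close>

lemma plancherel_lborel:
  fixes f :: "'a::euclidean_space \<Rightarrow> complex"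
  assumes f: "integrable lborel f" and f2: "integrable lborel (\<lambda>x. (cmod (f x))\<^sup>2)"
  defines "F \<equiv> (\<lambda>\<xi>. \<integral>x. exp (- \<i> * complex_of_real (x \<bullet> \<xi>)) * f x \<partial>lborel)"
  shows "(\<integral>\<^sup>+\<xi>. ennreal ((cmod (F \<xi>))\<^sup>2) \<partial>lborel) = ennreal ((2 * pi) ^ DIM('a) * (\<integral>x. (cmod (f x))\<^sup>2 \<partial>lborel))"
proof -
  have fm[measurable]: "f \<in> borel_measurable borel" using f by auto
  have Fm[measurable]: "F \<in> borel_measurable borel"
    unfolding F_def using gauss_regularized_norm(2)[OF f, of 1] by simp
  define N where "N = (\<integral>x. (cmod (f x))\<^sup>2 \<partial>lborel)"
  define D where "D e = (\<integral>\<^sup>+z. ennreal (gauss z) * translation_defect f (e *\<^sub>R z) \<partial>lborel)" for e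
  define B where "B = (\<integral>x. cmod (f x) \<partial>lborel)"
  define s where "s = sqrt (2 * pi) ^ DIM('a)"
  have s1: "s * s = (sqrt (2 * pi) * sqrt (2 * pi)) ^ DIM('a)"
    unfolding s_def by (rule power_mult_distrib[symmetric])
  have s: "s > 0" "s * s = (2 * pi) ^ DIM('a)"
    by (simp add: s_def, subst s1, subst real_sqrt_mult_self, simp)
  define G where "G k \<xi> = s * gauss ((1 / real (Suc k)) *\<^sub>R \<xi>)" for k and \<xi> :: 'a
  have G_eq: "G k \<xi> = exp (- (norm \<xi>)\<^sup>2 / (2 * (real (Suc k))\<^sup>2))" for k \<xi>
    unfolding G_def gauss_eq s_def[symmetric] using s(1)
    by (simp add: power_divide power_mult_distrib mult.commute)
  have J: "(\<integral>\<^sup>+\<xi>. ennreal (G k \<xi> * (cmod (F \<xi>))\<^sup>2) \<partial>lborel)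
      = ennreal ((2 * pi) ^ DIM('a) * (N - enn2real (D (1 / Suc k)) / 2))" for k
  proof -
    have e: "1 / real (Suc k) > 0" by simp
    have "integrable lborel (\<lambda>\<xi>. gauss ((1 / real (Suc k)) *\<^sub>R \<xi>) * (cmod (F \<xi>))\<^sup>2)"
    proof (rule Bochner_Integration.integrable_bound)
      show "integrable lborel (\<lambda>\<xi>::'a. gauss ((1 / real (Suc k)) *\<^sub>R \<xi>) * B\<^sup>2)"
        by (intro integrable_mult_left gauss_scale_integrable e)
      have "(cmod (F \<xi>))\<^sup>2 \<le> B\<^sup>2" for \<xi>
        using gauss_regularized_norm(3)[OF f e] unfolding B_def F_def by (intro power_mono) auto
      then show "AE \<xi> in lborel. norm (gauss ((1 / real (Suc k)) *\<^sub>R \<xi>) * (cmod (F \<xi>))\<^sup>2)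
          \<le> norm (gauss ((1 / real (Suc k)) *\<^sub>R \<xi>) * B\<^sup>2)"
        by (intro always_eventually allI) (simp add: abs_mult mult_left_mono)
    qed measurable
    then have "(\<integral>\<^sup>+\<xi>. ennreal (G k \<xi> * (cmod (F \<xi>))\<^sup>2) \<partial>lborel)
      = ennreal (\<integral>\<xi>. s * (gauss ((1 / real (Suc k)) *\<^sub>R \<xi>) * (cmod (F \<xi>))\<^sup>2) \<partial>lborel)"
      using s(1) unfolding G_def mult.assoc by (intro nn_integral_eq_integral) auto
    also have "(\<integral>\<xi>. s * (gauss ((1 / real (Suc k)) *\<^sub>R \<xi>) * (cmod (F \<xi>))\<^sup>2) \<partial>lborel)
       = s * Re (complex_of_real (\<integral>\<xi>. gauss ((1 / real (Suc k)) *\<^sub>R \<xi>) * (cmod (F \<xi>))\<^sup>2 \<partial>lborel))"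
      by simp
    also have "complex_of_real (\<integral>\<xi>. gauss ((1 / real (Suc k)) *\<^sub>R \<xi>) * (cmod (F \<xi>))\<^sup>2 \<partial>lborel)
       = complex_of_real s * (\<integral>x. f x * (\<integral>z. gauss z * cnj (f (x + (1 / real (Suc k)) *\<^sub>R z)) \<partial>lborel) \<partial>lborel)"
      unfolding s_def F_def by (rule gauss_regularized_norm(1)[OF f e])
    also have "Re \<dots> = s * (N - enn2real (D (1 / real (Suc k))) / 2)"
      unfolding D_def N_def gauss_correlation(1)[OF fm f2, symmetric] by simp
    finally show ?thesis using s(2) by (simp add: mult.assoc[symmetric])
  qed
  have "(\<lambda>k. \<integral>\<^sup>+\<xi>. ennreal (G k \<xi> * (cmod (F \<xi>))\<^sup>2) \<partial>lborel) \<longlonglongrightarrow> (\<integral>\<^sup>+\<xi>. ennreal ((cmod (F \<xi>))\<^sup>2) \<partial>lborel)"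
  proof (rule nn_integral_LIMSEQ)
    show "incseq (\<lambda>k \<xi>. ennreal (G k \<xi> * (cmod (F \<xi>))\<^sup>2))"
    proof (intro incseq_SucI le_funI ennreal_leI mult_right_mono)
      fix k and \<xi> :: 'a
      have "(norm \<xi>)\<^sup>2 / (2 * (real (Suc (Suc k)))\<^sup>2) \<le> (norm \<xi>)\<^sup>2 / (2 * (real (Suc k))\<^sup>2)"
        by (intro divide_left_mono mult_left_mono power_mono) auto
      then show "G k \<xi> \<le> G (Suc k) \<xi>" unfolding G_eq by simp
    qed auto
    show "(\<lambda>k. ennreal (G k \<xi> * (cmod (F \<xi>))\<^sup>2)) \<longlonglongrightarrow> ennreal ((cmod (F \<xi>))\<^sup>2)" for \<xi>
    proof (rule tendsto_ennrealI)
      have "(\<lambda>k. - (norm \<xi>)\<^sup>2 / 2 * (inverse (real (Suc k)))\<^sup>2) \<longlonglongrightarrow> - (norm \<xi>)\<^sup>2 / 2 * 0\<^sup>2"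
        by (intro tendsto_intros LIMSEQ_inverse_real_of_nat)
      then have *: "(\<lambda>k. exp (- (norm \<xi>)\<^sup>2 / 2 * (inverse (real (Suc k)))\<^sup>2) * (cmod (F \<xi>))\<^sup>2) \<longlonglongrightarrow> exp 0 * (cmod (F \<xi>))\<^sup>2"
        by (intro tendsto_intros) simp
      show "(\<lambda>k. G k \<xi> * (cmod (F \<xi>))\<^sup>2) \<longlonglongrightarrow> (cmod (F \<xi>))\<^sup>2"
      proof -
        have "G k \<xi> = exp (- (norm \<xi>)\<^sup>2 / 2 * (inverse (real (Suc k)))\<^sup>2)" for k
          unfolding G_eq inverse_eq_divide power_divide times_divide_times_eq
          by (simp only: power_one mult_1_right)
        then show ?thesis using * by (simp only: exp_zero mult_1_left)
      qed
    qed
  qed (auto simp: G_def)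
  moreover have "(\<lambda>k. ennreal ((2 * pi) ^ DIM('a) * (N - enn2real (D (1 / Suc k)) / 2)))
      \<longlonglongrightarrow> ennreal ((2 * pi) ^ DIM('a) * (N - 0 / 2))"
    unfolding D_def
    by (intro tendsto_ennrealI tendsto_mult tendsto_diff tendsto_divide tendsto_const
        gauss_correlation(2)[OF fm f2]) simp
  ultimately show ?thesis
    unfolding J N_def by (auto dest: LIMSEQ_unique)
qed

lemma complex_borel_representative:
  fixes f :: "'a::euclidean_space \<Rightarrow> complex"
  assumes "f \<in> borel_measurable lebesgue"
  obtains g where "g \<in> borel_measurable borel" "AE x in lebesgue. f x = g x"
proof -
  have "(\<lambda>x. Re (f x)) \<in> borel_measurable lebesgue" "(\<lambda>x. Im (f x)) \<in> borel_measurable lebesgue"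
    using assms by measurable
  from this[THEN completion_ex_borel_measurable_real]
  obtain a b where [measurable]: "a \<in> borel_measurable lborel" "b \<in> borel_measurable lborel"
    and "AE x in lborel. Re (f x) = a x" "AE x in lborel. Im (f x) = b x" by auto
  from this(3,4)[THEN AE_completion] have "AE x in lebesgue. f x = Complex (a x) (b x)"
    by eventually_elim (simp add: complex_eq_iff)
  moreover have "(\<lambda>x. Complex (a x) (b x)) \<in> borel_measurable borel"
    unfolding Complex_eq by measurable
  ultimately show thesis using that by blast
qed

text \<open>Measurability on product spaces is a matter of Borel functions, so a Lebesgue measurable function
  is replaced by a Borel representative; the Fourier integral does not see the difference.\<close>

lemma fourier_integral_eq_lborel:
  fixes f :: "'a::euclidean_space \<Rightarrow> complex"
  assumes f: "f \<in> borel_measurable lebesgue" and g[measurable]: "g \<in> borel_measurable borel"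
    and ae: "AE x in lebesgue. f x = g x"
  shows "fourier_integral f = (\<lambda>\<xi>. \<integral>x. exp (- \<i> * complex_of_real (x \<bullet> \<xi>)) * g x \<partial>lborel)"
proof
  fix \<xi> :: 'a
  have gl: "g \<in> borel_measurable lebesgue" by (rule measurable_completion) simp
  have e: "(\<lambda>x. exp (- \<i> * complex_of_real (x \<bullet> \<xi>))) \<in> borel_measurable lebesgue"
    by (rule measurable_completion) measurable
  have "fourier_integral f \<xi> = (\<integral>x. exp (- \<i> * complex_of_real (x \<bullet> \<xi>)) * g x \<partial>lebesgue)"
    unfolding fourier_integral_def
    by (intro integral_cong_AE borel_measurable_times e f gl) (use ae in auto)
  also have "\<dots> = (\<integral>x. exp (- \<i> * complex_of_real (x \<bullet> \<xi>)) * g x \<partial>lborel)"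
    by (rule integral_completion) measurable
  finally show "fourier_integral f \<xi> = (\<integral>x. exp (- \<i> * complex_of_real (x \<bullet> \<xi>)) * g x \<partial>lborel)" .
qed

lemma plancherel_L1_L2:
  fixes f :: "'a::euclidean_space \<Rightarrow> complex"
  assumes "f \<in> L1" "f \<in> L2"
  shows "fourier_integral f \<in> L2"
    and "L2_norm (fourier_integral f) = sqrt ((2 * pi) ^ DIM('a)) * L2_norm f"
    and "fourier_integral f \<in> borel_measurable borel"
proof -
  obtain g where g[measurable]: "g \<in> borel_measurable borel" and ae: "AE x in lebesgue. f x = g x"
    using complex_borel_representative[OF L2_measurable[OF assms(2)]] by blast
  have gl[measurable]: "g \<in> borel_measurable lebesgue" by (rule measurable_completion) simp
  have fm: "f \<in> borel_measurable lebesgue" using assms(2) by (rule L2_measurable)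
  have "integrable lebesgue g"
    using assms(1) ae fm integrable_cong_AE[of f lebesgue g] by (auto simp: L1_def)
  then have g1: "integrable lborel g" by (simp add: integrable_completion)
  have gL2: "g \<in> L2" by (rule L2_cong_AE[OF assms(2) gl ae])
  then have g2: "integrable lborel (\<lambda>x. (cmod (g x))\<^sup>2)"
    using L2_integrable[OF gL2] by (simp add: integrable_completion)
  note Fg = fourier_integral_eq_lborel[OF fm g ae]
  show Fm: "fourier_integral f \<in> borel_measurable borel"
    unfolding Fg using gauss_regularized_norm(2)[OF g1, of 1] by simp
  have norm_g: "L2_norm g = L2_norm f" using ae by (intro L2_norm_cong_AE gl fm) auto
  have "(\<integral>\<^sup>+\<xi>. ennreal ((cmod (fourier_integral f \<xi>))\<^sup>2) \<partial>lebesgue)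
      = (\<integral>\<^sup>+\<xi>. ennreal ((cmod (fourier_integral f \<xi>))\<^sup>2) \<partial>lborel)"
    by (rule nn_integral_completion)
  also have "\<dots> = ennreal ((2 * pi) ^ DIM('a) * (\<integral>x. (cmod (g x))\<^sup>2 \<partial>lborel))"
    unfolding Fg by (rule plancherel_lborel[OF g1 g2])
  also have "(\<integral>x. (cmod (g x))\<^sup>2 \<partial>lborel) = (\<integral>x. (cmod (g x))\<^sup>2 \<partial>lebesgue)"
    by (rule integral_completion[symmetric]) measurable
  also have "(2 * pi) ^ DIM('a) * \<dots> = (sqrt ((2 * pi) ^ DIM('a)) * L2_norm f)\<^sup>2"
    by (simp add: power_mult_distrib norm_g flip: L2_norm_power2)
  finally have nn: "(\<integral>\<^sup>+\<xi>. ennreal ((cmod (fourier_integral f \<xi>))\<^sup>2) \<partial>lebesgue)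
      = ennreal ((sqrt ((2 * pi) ^ DIM('a)) * L2_norm f)\<^sup>2)" .
  show L2: "fourier_integral f \<in> L2"
    by (rule L2_of_nn_integral_le(1)[where e="sqrt ((2 * pi) ^ DIM('a)) * L2_norm f"])
      (use nn Fm in \<open>auto intro!: measurable_completion\<close>)
  from nn_integral_L2[OF L2] nn
  have "(L2_norm (fourier_integral f))\<^sup>2 = (sqrt ((2 * pi) ^ DIM('a)) * L2_norm f)\<^sup>2"
    by simp
  then show "L2_norm (fourier_integral f) = sqrt ((2 * pi) ^ DIM('a)) * L2_norm f"
    by (subst (asm) power2_eq_iff_nonneg) auto
qed

section \<open>The Fourier transform on \<open>L\<^sup>2\<close>\<close>

lemma fourier_integrable:
  assumes "f \<in> L1"
  shows "integrable lebesgue (\<lambda>x. exp (- \<i> * complex_of_real (x \<bullet> \<xi>)) * f x)"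
proof (rule Bochner_Integration.integrable_bound)
  have f: "integrable lebesgue f" using assms by (simp add: L1_def)
  then show "integrable lebesgue (\<lambda>x. norm (f x))" by simp
  have "(\<lambda>x. exp (- \<i> * complex_of_real (x \<bullet> \<xi>))) \<in> borel_measurable lebesgue"
    by (rule measurable_completion) measurable
  then show "(\<lambda>x. exp (- \<i> * complex_of_real (x \<bullet> \<xi>)) * f x) \<in> borel_measurable lebesgue"
    using f by (intro borel_measurable_times) auto
qed (simp add: norm_mult)

lemma fourier_integral_add:
  assumes "f \<in> L1" "g \<in> L1"
  shows "fourier_integral (\<lambda>x. f x + g x) = (\<lambda>\<xi>. fourier_integral f \<xi> + fourier_integral g \<xi>)"
  unfolding fourier_integral_def
  using fourier_integrable[OF assms(1)] fourier_integrable[OF assms(2)] by (simp add: distrib_left)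

lemma fourier_integral_diff:
  assumes "f \<in> L1" "g \<in> L1"
  shows "fourier_integral (\<lambda>x. f x - g x) = (\<lambda>\<xi>. fourier_integral f \<xi> - fourier_integral g \<xi>)"
  unfolding fourier_integral_def
  using fourier_integrable[OF assms(1)] fourier_integrable[OF assms(2)] by (simp add: right_diff_distrib)

lemma fourier_integral_cmult:
  "fourier_integral (\<lambda>x. c * f x) = (\<lambda>\<xi>. c * fourier_integral f \<xi>)"
  unfolding fourier_integral_def by (simp add: mult.left_commute[of _ c])

lemma L1_diff: "f \<in> L1 \<Longrightarrow> g \<in> L1 \<Longrightarrow> (\<lambda>x. f x - g x) \<in> L1"
  by (simp add: L1_def)

text \<open>The factor by which the transform multiplies norms. It depends on the dimension, that is, on the
  type.\<close>

definition plancherel_const :: "'a::euclidean_space itself \<Rightarrow> real" where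
  "plancherel_const _ = sqrt ((2 * pi) ^ DIM('a))"

lemma plancherel_const_pos [simp]: "0 < plancherel_const TYPE('a::euclidean_space)"
  by (simp add: plancherel_const_def)

lemma plancherel:
  fixes f :: "'a::euclidean_space \<Rightarrow> complex"
  assumes "f \<in> L1" "f \<in> L2"
  shows "L2_norm (fourier_integral f) = plancherel_const TYPE('a) * L2_norm f"
  unfolding plancherel_const_def by (rule plancherel_L1_L2[OF assms])

lemma plancherel_diff:
  fixes f g :: "'a::euclidean_space \<Rightarrow> complex"
  assumes "f \<in> L1" "f \<in> L2" "g \<in> L1" "g \<in> L2"
  shows "L2_norm (\<lambda>\<xi>. fourier_integral f \<xi> - fourier_integral g \<xi>)
    = plancherel_const TYPE('a) * L2_norm (\<lambda>x. f x - g x)"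
  using plancherel[OF L1_diff[OF assms(1,3)] L2_diff[OF assms(2,4)]] fourier_integral_diff[OF assms(1,3)]
  by simp

definition truncate :: "real \<Rightarrow> ('a::euclidean_space \<Rightarrow> complex) \<Rightarrow> 'a \<Rightarrow> complex" where
  "truncate R w = (\<lambda>x. indicator (cball 0 R) x * w x)"

lemma truncate_L2: "w \<in> L2 \<Longrightarrow> truncate R w \<in> L2"
  unfolding truncate_def by (rule indicator_mult_L2) auto

lemma truncate_L1: "w \<in> L2 \<Longrightarrow> truncate R w \<in> L1"
  unfolding truncate_def by (rule truncation_L1) auto

lemma truncate_tendsto: "w \<in> L2 \<Longrightarrow> ((\<lambda>R. L2_norm (\<lambda>x. truncate R w x - w x)) \<longlongrightarrow> 0) at_top"
  unfolding truncate_def by (rule truncation_tendsto_L2)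

lemma L2_norm_truncate_le:
  assumes "w \<in> L2" shows "L2_norm (truncate R w) \<le> L2_norm w"
  by (rule L2_norm_mono[OF L2_measurable[OF truncate_L2[OF assms]] assms])
     (auto simp: truncate_def indicator_def)

lemma tendsto_L2_norm:
  assumes "\<And>i. f i \<in> L2" "g \<in> L2" "((\<lambda>i. L2_norm (\<lambda>x. f i x - g x)) \<longlongrightarrow> 0) F"
  shows "((\<lambda>i. L2_norm (f i)) \<longlongrightarrow> L2_norm g) F"
proof (rule Lim_null[THEN iffD2], rule Lim_null_comparison[OF _ assms(3)], intro always_eventually allI)
  show "norm (L2_norm (f i) - L2_norm g) \<le> L2_norm (\<lambda>x. f i x - g x)" for i
    using L2_norm_diff_ge[OF assms(1)[of i] assms(2)] by simp
qed

lemma has_fourier_iff: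
  "has_fourier w g \<longleftrightarrow> w \<in> L2 \<and> g \<in> L2 \<and>
     ((\<lambda>R. L2_norm (\<lambda>\<xi>. fourier_integral (truncate R w) \<xi> - g \<xi>)) \<longlongrightarrow> 0) at_top"
  unfolding has_fourier_def tendsto_L2_def truncate_def[symmetric]
  using plancherel_L1_L2(1)[OF truncate_L1 truncate_L2] by (auto intro!: always_eventually)

lemma has_fourier_L2: "has_fourier w g \<Longrightarrow> w \<in> L2" "has_fourier w g \<Longrightarrow> g \<in> L2"
  by (simp_all add: has_fourier_iff)

lemma has_fourier_fourier_integral:
  fixes w :: "'a::euclidean_space \<Rightarrow> complex"
  assumes "w \<in> L1" "w \<in> L2"
  shows "has_fourier w (fourier_integral w)"
  unfolding has_fourier_iff
proof (intro conjI assms plancherel_L1_L2(1))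
  have "((\<lambda>R. plancherel_const TYPE('a) * L2_norm (\<lambda>x. truncate R w x - w x)) \<longlongrightarrow> plancherel_const TYPE('a) * 0) at_top"
    by (intro tendsto_intros truncate_tendsto assms)
  then show "((\<lambda>R. L2_norm (\<lambda>\<xi>. fourier_integral (truncate R w) \<xi> - fourier_integral w \<xi>)) \<longlongrightarrow> 0) at_top"
    using assms by (simp add: plancherel_diff truncate_L1 truncate_L2)
qed

lemma has_fourier_norm:
  fixes w :: "'a::euclidean_space \<Rightarrow> complex"
  assumes "has_fourier w g"
  shows "L2_norm g = plancherel_const TYPE('a) * L2_norm w"
proof (rule tendsto_unique[OF trivial_limit_at_top_linorder])
  note L2 = has_fourier_L2[OF assms]
  show "((\<lambda>R. L2_norm (fourier_integral (truncate R w))) \<longlongrightarrow> L2_norm g) at_top"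
    using assms L2 by (intro tendsto_L2_norm plancherel_L1_L2(1) truncate_L1 truncate_L2) (auto simp: has_fourier_iff)
  have "((\<lambda>R. plancherel_const TYPE('a) * L2_norm (truncate R w)) \<longlongrightarrow> plancherel_const TYPE('a) * L2_norm w) at_top"
    using L2 by (intro tendsto_intros tendsto_L2_norm truncate_L2 truncate_tendsto) auto
  then show "((\<lambda>R. L2_norm (fourier_integral (truncate R w))) \<longlongrightarrow> plancherel_const TYPE('a) * L2_norm w) at_top"
    using L2 by (simp add: plancherel truncate_L1 truncate_L2)
qed

text \<open>Truncation and transformation are bounded uniformly in the radius, so the limits \<open>R \<rightarrow> \<infinity>\<close> and
  \<open>k \<rightarrow> \<infinity>\<close> may be exchanged.\<close>

lemma has_fourier_closed:
  fixes w :: "'a::euclidean_space \<Rightarrow> complex" and W G :: "nat \<Rightarrow> 'a \<Rightarrow> complex"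
  assumes WG: "\<And>k. has_fourier (W k) (G k)" and w: "w \<in> L2" and g: "g \<in> L2"
    and Ww: "(\<lambda>k. L2_norm (\<lambda>x. W k x - w x)) \<longlonglongrightarrow> 0" and Gg: "(\<lambda>k. L2_norm (\<lambda>x. G k x - g x)) \<longlonglongrightarrow> 0"
  shows "has_fourier w g"
  unfolding has_fourier_iff
proof (intro conjI w g)
  let ?c = "plancherel_const TYPE('a)"
  note L2 = has_fourier_L2[OF WG]
  have tri: "L2_norm (\<lambda>\<xi>. fourier_integral (truncate R w) \<xi> - g \<xi>)
     \<le> ?c * L2_norm (\<lambda>x. W k x - w x)
      + L2_norm (\<lambda>\<xi>. fourier_integral (truncate R (W k)) \<xi> - G k \<xi>) + L2_norm (\<lambda>x. G k x - g x)" for R k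
  proof -
    let ?F = "\<lambda>w. fourier_integral (truncate R w)"
    have F: "?F w \<in> L2" "?F (W k) \<in> L2"
      by (intro plancherel_L1_L2(1) truncate_L1 truncate_L2 w L2)+
    have "L2_norm (\<lambda>\<xi>. ?F w \<xi> - ?F (W k) \<xi>) = ?c * L2_norm (\<lambda>x. truncate R w x - truncate R (W k) x)"
      by (intro plancherel_diff truncate_L1 truncate_L2 w L2)
    also have "(\<lambda>x. truncate R w x - truncate R (W k) x) = truncate R (\<lambda>x. w x - W k x)"
      by (simp add: truncate_def right_diff_distrib)
    also have "?c * L2_norm (truncate R (\<lambda>x. w x - W k x)) \<le> ?c * L2_norm (\<lambda>x. w x - W k x)"
      by (intro mult_left_mono L2_norm_truncate_le L2_diff w L2) (simp add: less_imp_le)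
    finally show ?thesis
      using L2_norm_triangle_diff[OF F g] L2_norm_triangle_diff[OF F(2) L2(2)[of k] g]
        L2_norm_minus_commute[of w "W k"] by simp
  qed
  show "((\<lambda>R. L2_norm (\<lambda>\<xi>. fourier_integral (truncate R w) \<xi> - g \<xi>)) \<longlongrightarrow> 0) at_top"
  proof (rule tendstoI)
    fix e :: real assume e: "e > 0"
    have "(\<lambda>k. ?c * L2_norm (\<lambda>x. W k x - w x) + L2_norm (\<lambda>x. G k x - g x)) \<longlonglongrightarrow> ?c * 0 + 0"
      by (intro tendsto_intros Ww Gg)
    then have "\<forall>\<^sub>F k in sequentially. ?c * L2_norm (\<lambda>x. W k x - w x) + L2_norm (\<lambda>x. G k x - g x) < e / 2"
      using e by (intro order_tendstoD(2)) auto
    then obtain k where k: "?c * L2_norm (\<lambda>x. W k x - w x) + L2_norm (\<lambda>x. G k x - g x) < e / 2"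
      using eventually_happens'[OF sequentially_bot] by blast
    have "((\<lambda>R. L2_norm (\<lambda>\<xi>. fourier_integral (truncate R (W k)) \<xi> - G k \<xi>)) \<longlongrightarrow> 0) at_top"
      using WG by (simp add: has_fourier_iff)
    then have "\<forall>\<^sub>F R in at_top. L2_norm (\<lambda>\<xi>. fourier_integral (truncate R (W k)) \<xi> - G k \<xi>) < e / 2"
      using e by (intro order_tendstoD(2)) auto
    then show "\<forall>\<^sub>F R in at_top. dist (L2_norm (\<lambda>\<xi>. fourier_integral (truncate R w) \<xi> - g \<xi>)) 0 < e"
    proof eventually_elim
      case (elim R)
      with k tri[of R k] show ?case by simp
    qed
  qed
qed

lemma has_fourier_cong_AE:
  assumes "has_fourier w g"
    and "w' \<in> borel_measurable lebesgue" "AE x in lebesgue. w x = w' x"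
    and "g' \<in> borel_measurable lebesgue" "AE x in lebesgue. g x = g' x"
  shows "has_fourier w' g'"
proof -
  note L2 = has_fourier_L2[OF assms(1)]
  have L2': "w' \<in> L2" "g' \<in> L2"
    using L2_cong_AE[OF L2(1) assms(2,3)] L2_cong_AE[OF L2(2) assms(4,5)] by auto
  have 0: "L2_norm (\<lambda>x. w x - w' x) = 0" "L2_norm (\<lambda>x. g x - g' x) = 0"
    using assms(3,5) L2_norm_eq_0_iff[OF L2_diff[OF L2(1) L2'(1)]] L2_norm_eq_0_iff[OF L2_diff[OF L2(2) L2'(2)]]
    by auto
  show ?thesis
    by (rule has_fourier_closed[where W="\<lambda>_. w" and G="\<lambda>_. g"]) (use assms L2' 0 in auto)
qed

lemma has_fourier_add:
  assumes "has_fourier w g" "has_fourier v h"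
  shows "has_fourier (\<lambda>x. w x + v x) (\<lambda>\<xi>. g \<xi> + h \<xi>)"
  unfolding has_fourier_iff
proof (intro conjI L2_add has_fourier_L2[OF assms(1)] has_fourier_L2[OF assms(2)])
  note L2 = has_fourier_L2[OF assms(1)] has_fourier_L2[OF assms(2)]
  have "((\<lambda>R. L2_norm (\<lambda>\<xi>. fourier_integral (truncate R w) \<xi> - g \<xi>)
      + L2_norm (\<lambda>\<xi>. fourier_integral (truncate R v) \<xi> - h \<xi>)) \<longlongrightarrow> 0 + 0) at_top"
    using assms by (intro tendsto_add) (auto simp: has_fourier_iff)
  then have lim: "((\<lambda>R. L2_norm (\<lambda>\<xi>. fourier_integral (truncate R w) \<xi> - g \<xi>)
      + L2_norm (\<lambda>\<xi>. fourier_integral (truncate R v) \<xi> - h \<xi>)) \<longlongrightarrow> 0) at_top" by simp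
  show "((\<lambda>R. L2_norm (\<lambda>\<xi>. fourier_integral (truncate R (\<lambda>x. w x + v x)) \<xi> - (g \<xi> + h \<xi>))) \<longlongrightarrow> 0) at_top"
  proof (rule Lim_null_comparison[OF always_eventually[OF allI] lim])
    fix R
    have "truncate R (\<lambda>x. w x + v x) = (\<lambda>x. truncate R w x + truncate R v x)"
      by (simp add: truncate_def distrib_left)
    then have "(\<lambda>\<xi>. fourier_integral (truncate R (\<lambda>x. w x + v x)) \<xi> - (g \<xi> + h \<xi>))
        = (\<lambda>\<xi>. (fourier_integral (truncate R w) \<xi> - g \<xi>) + (fourier_integral (truncate R v) \<xi> - h \<xi>))"
      using L2 by (simp add: fourier_integral_add truncate_L1 algebra_simps)
    then show "norm (L2_norm (\<lambda>\<xi>. fourier_integral (truncate R (\<lambda>x. w x + v x)) \<xi> - (g \<xi> + h \<xi>)))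
      \<le> L2_norm (\<lambda>\<xi>. fourier_integral (truncate R w) \<xi> - g \<xi>)
      + L2_norm (\<lambda>\<xi>. fourier_integral (truncate R v) \<xi> - h \<xi>)"
      using L2 by (simp add: L2_norm_triangle L2_diff plancherel_L1_L2(1) truncate_L1 truncate_L2)
  qed
qed

lemma has_fourier_cmult:
  assumes "has_fourier w g"
  shows "has_fourier (\<lambda>x. c * w x) (\<lambda>\<xi>. c * g \<xi>)"
  unfolding has_fourier_iff
proof (intro conjI L2_cmult has_fourier_L2[OF assms(1)])
  have "truncate R (\<lambda>x. c * w x) = (\<lambda>x. c * truncate R w x)" for R
    by (simp add: truncate_def mult.left_commute)
  then have eq: "L2_norm (\<lambda>\<xi>. fourier_integral (truncate R (\<lambda>x. c * w x)) \<xi> - c * g \<xi>)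
      = cmod c * L2_norm (\<lambda>\<xi>. fourier_integral (truncate R w) \<xi> - g \<xi>)" for R
    by (simp add: fourier_integral_cmult L2_norm_cmult flip: right_diff_distrib)
  have "((\<lambda>R. cmod c * L2_norm (\<lambda>\<xi>. fourier_integral (truncate R w) \<xi> - g \<xi>)) \<longlongrightarrow> cmod c * 0) at_top"
    using assms by (intro tendsto_intros) (auto simp: has_fourier_iff)
  then show "((\<lambda>R. L2_norm (\<lambda>\<xi>. fourier_integral (truncate R (\<lambda>x. c * w x)) \<xi> - c * g \<xi>)) \<longlongrightarrow> 0) at_top"
    by (simp add: eq)
qed

lemma has_fourier_diff:
  assumes "has_fourier w g" "has_fourier v h"
  shows "has_fourier (\<lambda>x. w x - v x) (\<lambda>\<xi>. g \<xi> - h \<xi>)"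
  using has_fourier_add[OF assms(1) has_fourier_cmult[OF assms(2), of "-1"]] by simp

lemma has_fourier_norm_diff:
  fixes w :: "'a::euclidean_space \<Rightarrow> complex"
  assumes "has_fourier w g" "has_fourier v h"
  shows "L2_norm (\<lambda>\<xi>. g \<xi> - h \<xi>) = plancherel_const TYPE('a) * L2_norm (\<lambda>x. w x - v x)"
  by (rule has_fourier_norm[OF has_fourier_diff[OF assms]])

lemma has_fourier_unique:
  assumes "has_fourier w g" "has_fourier w h"
  shows "AE \<xi> in lebesgue. g \<xi> = h \<xi>"
proof -
  have "L2_norm (\<lambda>\<xi>. g \<xi> - h \<xi>) = 0"
    using has_fourier_norm_diff[OF assms] by (simp add: L2_norm_def)
  then show ?thesis
    using L2_norm_eq_0_iff[OF L2_diff[OF has_fourier_L2(2)[OF assms(1)] has_fourier_L2(2)[OF assms(2)]]] by simp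
qed

lemma L2_Cauchy_of_convergent:
  fixes f :: "nat \<Rightarrow> 'a::euclidean_space \<Rightarrow> complex"
  assumes "\<And>n. f n \<in> L2" "g \<in> L2" "(\<lambda>n. L2_norm (\<lambda>x. f n x - g x)) \<longlonglongrightarrow> 0" "e > 0"
  shows "\<exists>N. \<forall>m\<ge>N. \<forall>n\<ge>N. L2_norm (\<lambda>x. f m x - f n x) < e"
proof -
  have "\<forall>\<^sub>F n in sequentially. L2_norm (\<lambda>x. f n x - g x) < e / 2"
    using assms(3,4) by (intro order_tendstoD(2)) auto
  then obtain N where N: "\<And>n. n \<ge> N \<Longrightarrow> L2_norm (\<lambda>x. f n x - g x) < e / 2"
    by (auto simp: eventually_sequentially)
  show ?thesis
  proof (intro exI allI impI)
    fix m n assume "m \<ge> N" "n \<ge> N"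
    then show "L2_norm (\<lambda>x. f m x - f n x) < e"
      using N[of m] N[of n] L2_norm_triangle_diff[OF assms(1)[of m] assms(2) assms(1)[of n]]
        L2_norm_minus_commute[of "f n" g] by simp
  qed
qed

text \<open>Since the graph is closed and the transform multiplies all distances by the same constant,
  domain and range are closed subspaces.\<close>

lemma has_fourier_limit_domain:
  fixes w :: "'a::euclidean_space \<Rightarrow> complex"
  assumes WG: "\<And>k::nat. has_fourier (W k) (G k)" and w: "w \<in> L2"
    and Ww: "(\<lambda>k. L2_norm (\<lambda>x. W k x - w x)) \<longlonglongrightarrow> 0"
  obtains g where "has_fourier w g" "(\<lambda>k. L2_norm (\<lambda>x. G k x - g x)) \<longlonglongrightarrow> 0"
proof -
  let ?c = "plancherel_const TYPE('a)"
  have "\<exists>N. \<forall>m\<ge>N. \<forall>n\<ge>N. L2_norm (\<lambda>x. G m x - G n x) < e" if "e > 0" for e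
  proof -
    from that have "e / ?c > 0" by simp
    from L2_Cauchy_of_convergent[OF has_fourier_L2(1)[OF WG] w Ww this]
    show ?thesis by (simp add: has_fourier_norm_diff[OF WG WG] field_simps)
  qed
  from L2_complete[OF has_fourier_L2(2)[OF WG] this]
  obtain g where g: "g \<in> L2" "(\<lambda>k. L2_norm (\<lambda>x. G k x - g x)) \<longlonglongrightarrow> 0" by blast
  from has_fourier_closed[OF WG w g(1) Ww g(2)] g(2) show thesis by (rule that)
qed

lemma has_fourier_limit_range:
  fixes g :: "'a::euclidean_space \<Rightarrow> complex"
  assumes WG: "\<And>k::nat. has_fourier (W k) (G k)" and g: "g \<in> L2"
    and Gg: "(\<lambda>k. L2_norm (\<lambda>x. G k x - g x)) \<longlonglongrightarrow> 0"
  obtains w where "has_fourier w g" "(\<lambda>k. L2_norm (\<lambda>x. W k x - w x)) \<longlonglongrightarrow> 0"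
proof -
  let ?c = "plancherel_const TYPE('a)"
  have "\<exists>N. \<forall>m\<ge>N. \<forall>n\<ge>N. L2_norm (\<lambda>x. W m x - W n x) < e" if "e > 0" for e
  proof -
    from that have "?c * e > 0" by simp
    from L2_Cauchy_of_convergent[OF has_fourier_L2(2)[OF WG] g Gg this]
    show ?thesis by (simp add: has_fourier_norm_diff[OF WG WG])
  qed
  from L2_complete[OF has_fourier_L2(1)[OF WG] this]
  obtain w where w: "w \<in> L2" "(\<lambda>k. L2_norm (\<lambda>x. W k x - w x)) \<longlonglongrightarrow> 0" by blast
  from has_fourier_closed[OF WG w(1) g w(2) Gg] w(2) show thesis by (rule that)
qed

lemma truncate_tendsto_seq:
  "w \<in> L2 \<Longrightarrow> (\<lambda>k. L2_norm (\<lambda>x. truncate (real k) w x - w x)) \<longlonglongrightarrow> 0"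
  by (rule filterlim_compose[OF truncate_tendsto filterlim_real_sequentially])

theorem has_fourier_exists:
  assumes "w \<in> L2" shows "\<exists>g. has_fourier w g"
proof -
  have "has_fourier (truncate (real k) w) (fourier_integral (truncate (real k) w))" for k
    using assms by (intro has_fourier_fourier_integral truncate_L1 truncate_L2)
  from has_fourier_limit_domain[OF this assms truncate_tendsto_seq[OF assms]] show ?thesis by blast
qed

lemma L1_borel_representative:
  fixes f :: "'a::euclidean_space \<Rightarrow> complex"
  assumes "f \<in> L1"
  obtains f' where "integrable lborel f'" "f' \<in> borel_measurable lebesgue" "AE x in lebesgue. f x = f' x"
    "fourier_integral f = (\<lambda>\<xi>. \<integral>x. exp (- \<i> * complex_of_real (x \<bullet> \<xi>)) * f' x \<partial>lborel)"
    "fourier_integral f \<in> borel_measurable borel"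
proof -
  have f: "integrable lebesgue f" using assms by (simp add: L1_def)
  then have fm: "f \<in> borel_measurable lebesgue" by auto
  then obtain f' where f'[measurable]: "f' \<in> borel_measurable borel" and ae: "AE x in lebesgue. f x = f' x"
    using complex_borel_representative by blast
  have fl: "f' \<in> borel_measurable lebesgue" by (rule measurable_completion) simp
  have "integrable lebesgue f'" using f ae fm fl integrable_cong_AE[of f lebesgue f'] by auto
  then have i: "integrable lborel f'" by (simp add: integrable_completion)
  note eq = fourier_integral_eq_lborel[OF fm f' ae]
  have "fourier_integral f \<in> borel_measurable borel"
    unfolding eq using gauss_regularized_norm(2)[OF i, of 1] by simp
  with i fl ae eq show thesis by (rule that)
qed

lemma fourier_integral_borel: "f \<in> L1 \<Longrightarrow> fourier_integral f \<in> borel_measurable borel"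
  using L1_borel_representative by blast

lemma fourier_integral_bound:
  "cmod (fourier_integral f \<xi>) \<le> (\<integral>x. cmod (f x) \<partial>lebesgue)"
proof -
  have "cmod (fourier_integral f \<xi>) \<le> (\<integral>x. cmod (exp (- \<i> * complex_of_real (x \<bullet> \<xi>)) * f x) \<partial>lebesgue)"
    unfolding fourier_integral_def by (rule integral_norm_bound)
  then show ?thesis by (simp add: norm_mult)
qed

text \<open>This is how the mean of the initial velocity enters the asymptotics.\<close>

lemma fourier_integral_tendsto_at_0:
  fixes f :: "'a::euclidean_space \<Rightarrow> complex"
  assumes f: "f \<in> L1" and X: "(X \<longlongrightarrow> 0) F"
  shows "((\<lambda>t. fourier_integral f (X t)) \<longlongrightarrow> (\<integral>x. f x \<partial>lebesgue)) F"
proof -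
  have "isCont (fourier_integral f) 0"
    unfolding continuous_at_sequentially comp_def
  proof (intro allI impI)
    fix Y :: "nat \<Rightarrow> 'a" assume Y: "Y \<longlonglongrightarrow> 0"
    have fi: "integrable lebesgue f" using f by (simp add: L1_def)
    show "(\<lambda>n. fourier_integral f (Y n)) \<longlonglongrightarrow> fourier_integral f 0"
      unfolding fourier_integral_def
    proof (rule integral_dominated_convergence[where w="\<lambda>x. cmod (f x)"])
      show "AE x in lebesgue. (\<lambda>n. exp (- \<i> * complex_of_real (x \<bullet> Y n)) * f x)
          \<longlonglongrightarrow> exp (- \<i> * complex_of_real (x \<bullet> 0)) * f x"
        by (intro always_eventually allI tendsto_intros Y)
    qed (use fi fourier_integrable[OF f] in \<open>auto simp: norm_mult\<close>)
  qed
  from isCont_tendsto_compose[OF this X] show ?thesis by (simp add: fourier_integral_def)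
qed

lemma multiplication_formula:
  fixes f g :: "'a::euclidean_space \<Rightarrow> complex"
  assumes "f \<in> L1" "g \<in> L1"
  shows "(\<integral>\<xi>. fourier_integral f \<xi> * g \<xi> \<partial>lebesgue) = (\<integral>x. f x * fourier_integral g x \<partial>lebesgue)"
proof -
  from L1_borel_representative[OF assms(1)] obtain f' where f': "integrable lborel f'" "f' \<in> borel_measurable lebesgue" "AE x in lebesgue. f x = f' x"
    "fourier_integral f = (\<lambda>\<xi>. \<integral>x. exp (- \<i> * complex_of_real (x \<bullet> \<xi>)) * f' x \<partial>lborel)"
    "fourier_integral f \<in> borel_measurable borel" .
  from L1_borel_representative[OF assms(2)] obtain g' where g': "integrable lborel g'" "g' \<in> borel_measurable lebesgue" "AE x in lebesgue. g x = g' x"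
    "fourier_integral g = (\<lambda>\<xi>. \<integral>x. exp (- \<i> * complex_of_real (x \<bullet> \<xi>)) * g' x \<partial>lborel)"
    "fourier_integral g \<in> borel_measurable borel" .
  have [measurable]: "f \<in> borel_measurable lebesgue" "g \<in> borel_measurable lebesgue"
    "f' \<in> borel_measurable lebesgue" "g' \<in> borel_measurable lebesgue"
    "fourier_integral f \<in> borel_measurable lebesgue" "fourier_integral g \<in> borel_measurable lebesgue"
    using assms f' g' by (auto simp: L1_def intro: measurable_completion)
  have "(\<integral>\<xi>. fourier_integral f \<xi> * g \<xi> \<partial>lebesgue) = (\<integral>\<xi>. fourier_integral f \<xi> * g' \<xi> \<partial>lebesgue)"
    using g'(3) by (intro integral_cong_AE borel_measurable_times) auto
  also have "\<dots> = (\<integral>\<xi>. fourier_integral f \<xi> * g' \<xi> \<partial>lborel)"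
    using f' g' by (intro integral_completion borel_measurable_times) auto
  also have "\<dots> = (\<integral>y. (\<integral>x. exp (- \<i> * complex_of_real (x \<bullet> y)) * f' x \<partial>lborel) * g' y \<partial>lborel)"
    unfolding f'(4) ..
  also have "\<dots> = (\<integral>x. f' x * (\<integral>y. exp (- \<i> * complex_of_real (x \<bullet> y)) * g' y \<partial>lborel) \<partial>lborel)"
    by (rule Fubini_bounded_kernel[OF f'(1) g'(1), symmetric]) auto
  also have "\<dots> = (\<integral>x. f' x * fourier_integral g x \<partial>lborel)"
    unfolding g'(4) by (simp add: inner_commute)
  also have "\<dots> = (\<integral>x. f' x * fourier_integral g x \<partial>lebesgue)"
    using f' g' by (intro integral_completion[symmetric] borel_measurable_times) auto
  also have "\<dots> = (\<integral>x. f x * fourier_integral g x \<partial>lebesgue)"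
    using f'(3) by (intro integral_cong_AE borel_measurable_times) auto
  finally show ?thesis .
qed

lemma L2_cnj: "f \<in> L2 \<Longrightarrow> (\<lambda>x. cnj (f x)) \<in> L2"
  by (rule L2_I_dominated[where C=1 and g=f]) (auto dest: L2_measurable intro!: borel_measurable_cnj)

lemma L2_norm_cnj: "L2_norm (\<lambda>x. cnj (f x)) = L2_norm f"
  by (simp add: L2_norm_def)

text \<open>Fourier inversion. Let \<open>v\<close> be the conjugate transform of \<open>g\<close> and \<open>v\<^sub>R\<close> its truncation. The
  multiplication formula gives \<open>\<langle>F v\<^sub>R, g\<rangle> = \<parallel>v\<^sub>R\<parallel>\<^sup>2\<close>, and so, with \<open>c = (2\<pi>)\<^sup>n\<close>, expanding the square
  and using Plancherel's identity twice, \<open>\<parallel>F v\<^sub>R - c g\<parallel>\<^sup>2 = c (\<parallel>v\<parallel>\<^sup>2 - \<parallel>v\<^sub>R\<parallel>\<^sup>2)\<close>, which tends to 0.\<close>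

lemma has_fourier_inversion_L1_L2:
  fixes g :: "'a::euclidean_space \<Rightarrow> complex"
  assumes g: "g \<in> L1" "g \<in> L2"
  shows "has_fourier (\<lambda>x. cnj (fourier_integral (\<lambda>\<xi>. cnj (g \<xi>)) x)) (\<lambda>\<xi>. (plancherel_const TYPE('a))\<^sup>2 * g \<xi>)"
proof -
  let ?c = "plancherel_const TYPE('a)"
  define h where "h = (\<lambda>\<xi>. cnj (g \<xi>))"
  have h: "h \<in> L1" "h \<in> L2"
    using g L2_cnj unfolding h_def by (auto simp: L1_def)
  define v where "v = (\<lambda>x. cnj (fourier_integral h x))"
  have v: "v \<in> L2" unfolding v_def by (intro L2_cnj plancherel_L1_L2(1) h)
  have nv: "L2_norm v = ?c * L2_norm g"
    unfolding v_def L2_norm_cnj plancherel[OF h] by (simp add: h_def L2_norm_cnj)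
  define V where "V R = fourier_integral (truncate R v)" for R
  have V: "V R \<in> L2" for R unfolding V_def by (intro plancherel_L1_L2(1) truncate_L1 truncate_L2 v)
  have nV: "L2_norm (V R) = ?c * L2_norm (truncate R v)" for R
    unfolding V_def by (intro plancherel truncate_L1 truncate_L2 v)
  have pair: "(\<integral>\<xi>. Re (V R \<xi> * cnj (g \<xi>)) \<partial>lebesgue) = (L2_norm (truncate R v))\<^sup>2"
    and int: "integrable lebesgue (\<lambda>\<xi>. Re (V R \<xi> * cnj (g \<xi>)))" for R
  proof -
    have prod_int: "integrable lebesgue (\<lambda>x. a x * b x)" if "a \<in> L2" "b \<in> L2" for a b :: "'a \<Rightarrow> complex"
    proof (rule Bochner_Integration.integrable_bound)
      show "integrable lebesgue (\<lambda>x. (cmod (a x))\<^sup>2 + (cmod (b x))\<^sup>2)"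
        using that[THEN L2_integrable] by simp
      show "(\<lambda>x. a x * b x) \<in> borel_measurable lebesgue"
        using that[THEN L2_measurable] by (rule borel_measurable_times)
      show "AE x in lebesgue. norm (a x * b x) \<le> norm ((cmod (a x))\<^sup>2 + (cmod (b x))\<^sup>2)"
      proof (intro always_eventually allI)
        fix x
        have "0 \<le> (cmod (a x) - cmod (b x))\<^sup>2" "0 \<le> (cmod (a x))\<^sup>2" "0 \<le> (cmod (b x))\<^sup>2" by auto
        then have "cmod (a x) * cmod (b x) \<le> (cmod (a x))\<^sup>2 + (cmod (b x))\<^sup>2"
          unfolding power2_diff by linarith
        then show "norm (a x * b x) \<le> norm ((cmod (a x))\<^sup>2 + (cmod (b x))\<^sup>2)" by (simp add: norm_mult)
      qed
    qed
    have i: "integrable lebesgue (\<lambda>\<xi>. V R \<xi> * h \<xi>)" using V h by (intro prod_int)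
    then show "integrable lebesgue (\<lambda>\<xi>. Re (V R \<xi> * cnj (g \<xi>)))"
      unfolding h_def by (rule integrable_Re)
    have "(\<integral>\<xi>. Re (V R \<xi> * cnj (g \<xi>)) \<partial>lebesgue) = Re (\<integral>\<xi>. V R \<xi> * h \<xi> \<partial>lebesgue)"
      using i unfolding h_def by (rule integral_Re)
    also have "(\<integral>\<xi>. V R \<xi> * h \<xi> \<partial>lebesgue) = (\<integral>x. truncate R v x * fourier_integral h x \<partial>lebesgue)"
      unfolding V_def by (intro multiplication_formula truncate_L1 v h)
    also have "\<dots> = (\<integral>x. complex_of_real ((cmod (truncate R v x))\<^sup>2) \<partial>lebesgue)"
    proof (intro Bochner_Integration.integral_cong refl)
      fix x
      show "truncate R v x * fourier_integral h x = complex_of_real ((cmod (truncate R v x))\<^sup>2)"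
        unfolding complex_norm_square by (simp add: truncate_def v_def indicator_def)
    qed
    also have "\<dots> = complex_of_real ((L2_norm (truncate R v))\<^sup>2)"
      unfolding integral_complex_of_real L2_norm_power2 ..
    finally show "(\<integral>\<xi>. Re (V R \<xi> * cnj (g \<xi>)) \<partial>lebesgue) = (L2_norm (truncate R v))\<^sup>2" by simp
  qed
  have key: "(L2_norm (\<lambda>\<xi>. V R \<xi> - ?c\<^sup>2 * g \<xi>))\<^sup>2 = ?c\<^sup>2 * ((L2_norm v)\<^sup>2 - (L2_norm (truncate R v))\<^sup>2)" for R
  proof -
    have sq: "(cmod (a - r * b))\<^sup>2 = (cmod a)\<^sup>2 + r\<^sup>2 * (cmod b)\<^sup>2 - 2 * r * Re (a * cnj b)"
      for a b :: complex and r :: real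
      unfolding cmod_power2 by (simp add: power2_eq_square algebra_simps)
    have "(L2_norm (\<lambda>\<xi>. V R \<xi> - ?c\<^sup>2 * g \<xi>))\<^sup>2
       = (\<integral>\<xi>. (cmod (V R \<xi>))\<^sup>2 + (?c\<^sup>2)\<^sup>2 * (cmod (g \<xi>))\<^sup>2 - 2 * ?c\<^sup>2 * Re (V R \<xi> * cnj (g \<xi>)) \<partial>lebesgue)"
      unfolding L2_norm_power2 by (simp only: sq)
    also have "\<dots> = (L2_norm (V R))\<^sup>2 + (?c\<^sup>2)\<^sup>2 * (L2_norm g)\<^sup>2 - 2 * ?c\<^sup>2 * (L2_norm (truncate R v))\<^sup>2"
      unfolding pair[symmetric] L2_norm_power2[of "V R"] L2_norm_power2[of g]
      using L2_integrable[OF V] L2_integrable[OF g(2)] int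
      by (simp only: Bochner_Integration.integral_diff Bochner_Integration.integral_add
          Bochner_Integration.integrable_add integrable_mult_right integral_mult_right_zero)
    finally show ?thesis
      unfolding nV nv by (simp add: power_mult_distrib power2_eq_square algebra_simps)
  qed
  have "((\<lambda>R. L2_norm (truncate R v)) \<longlongrightarrow> L2_norm v) at_top"
    by (intro tendsto_L2_norm truncate_L2 truncate_tendsto v)
  then have "((\<lambda>R. sqrt (?c\<^sup>2 * ((L2_norm v)\<^sup>2 - (L2_norm (truncate R v))\<^sup>2)))
      \<longlongrightarrow> sqrt (?c\<^sup>2 * ((L2_norm v)\<^sup>2 - (L2_norm v)\<^sup>2))) at_top"
    by (intro tendsto_intros)
  then have "((\<lambda>R. L2_norm (\<lambda>\<xi>. V R \<xi> - ?c\<^sup>2 * g \<xi>)) \<longlongrightarrow> 0) at_top"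
    unfolding key[symmetric] by simp
  then have "has_fourier v (\<lambda>\<xi>. ?c\<^sup>2 * g \<xi>)"
    unfolding has_fourier_iff V_def using v L2_cmult[OF g(2)] by simp
  then show ?thesis unfolding v_def h_def by simp
qed

text \<open>By inversion the range contains \<open>L\<^sup>1 \<inter> L\<^sup>2\<close>, which is dense, and it is closed.\<close>

theorem has_fourier_surj:
  fixes g :: "'a::euclidean_space \<Rightarrow> complex"
  assumes "g \<in> L2" shows "\<exists>w. has_fourier w g"
proof -
  let ?c = "plancherel_const TYPE('a)"
  define W where "W k = (\<lambda>x. (1 / ?c\<^sup>2) * cnj (fourier_integral (\<lambda>\<xi>. cnj (truncate (real k) g \<xi>)) x))" for k
  have "has_fourier (W k) (\<lambda>\<xi>. (1 / ?c\<^sup>2) * (?c\<^sup>2 * truncate (real k) g \<xi>))" for k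
    unfolding W_def
    by (intro has_fourier_cmult has_fourier_inversion_L1_L2 truncate_L1 truncate_L2 assms)
  then have "has_fourier (W k) (truncate (real k) g)" for k
    using plancherel_const_pos[where 'a='a] by (simp add: less_imp_neq[symmetric])
  from has_fourier_limit_range[OF this assms truncate_tendsto_seq[OF assms]] show ?thesis by blast
qed

lemma has_fourier_fourier: "w \<in> L2 \<Longrightarrow> has_fourier w (fourier w)"
  unfolding fourier_def by (rule someI_ex[OF has_fourier_exists])

lemma has_fourier_inv_fourier: "g \<in> L2 \<Longrightarrow> has_fourier (inv_fourier g) g"
  unfolding inv_fourier_def by (rule someI_ex[OF has_fourier_surj])

lemma fourier_AE_eq: "has_fourier w g \<Longrightarrow> AE \<xi> in lebesgue. fourier w \<xi> = g \<xi>"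
  using has_fourier_unique[OF has_fourier_fourier[OF has_fourier_L2(1)]] by blast

lemma fourier_AE_eq_fourier_integral:
  "w \<in> L1 \<Longrightarrow> w \<in> L2 \<Longrightarrow> AE \<xi> in lebesgue. fourier w \<xi> = fourier_integral w \<xi>"
  by (rule fourier_AE_eq[OF has_fourier_fourier_integral])

section \<open>The ordinary differential equation\<close>

lemma first_order_linear_ode:
  fixes Z :: "real \<Rightarrow> complex"
  assumes Z: "\<And>t. t \<ge> 0 \<Longrightarrow> (Z has_vector_derivative l * Z t) (at t within {0..})" and "t \<ge> 0"
  shows "Z t = exp (l * t) * Z 0"
proof -
  have "((\<lambda>t. exp (- l * t) * Z t) has_vector_derivative 0) (at t within {0..})" if "t \<in> {0..}" for t
  proof -
    have "((\<lambda>t. exp (- l * complex_of_real t)) has_vector_derivative (exp (- l * t) * (- l))) (at t within {0..})"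
      by (rule has_vector_derivative_real_field) (auto intro!: derivative_eq_intros)
    from has_vector_derivative_mult[OF this Z[of t]] that show ?thesis
      by (simp add: algebra_simps)
  qed
  from has_vector_derivative_zero_constant[OF _ this]
  obtain c where c: "\<And>t. t \<in> {0..} \<Longrightarrow> exp (- l * complex_of_real t) * Z t = c" by auto
  have "exp (- l * t) * Z t = Z 0" using c[of t] c[of 0] assms(2) by simp
  then have "exp (l * t) * (exp (- l * t) * Z t) = exp (l * t) * Z 0" by simp
  then show ?thesis by (simp add: mult.assoc[symmetric] exp_add[symmetric])
qed

definition solves_ode :: "real \<Rightarrow> real \<Rightarrow> (real \<Rightarrow> complex) \<Rightarrow> (real \<Rightarrow> complex) \<Rightarrow> bool" where
  "solves_ode a b U V \<longleftrightarrow> (\<forall>t\<ge>0. (U has_vector_derivative V t) (at t within {0..}) \<and>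
     (V has_vector_derivative - (complex_of_real a * V t + complex_of_real b * U t)) (at t within {0..}))"

subsection \<open>The oscillating regime\<close>

text \<open>With the characteristic roots \<open>\<lambda>\<close>, \<open>\<mu>\<close> the combinations \<open>V - \<mu> U\<close> and \<open>V - \<lambda> U\<close> solve
  first-order equations.\<close>

context
  fixes a b \<omega> :: real and U V :: "real \<Rightarrow> complex" and t :: real
  assumes UV: "solves_ode a b U V" and b: "b = a\<^sup>2 / 4 + \<omega>\<^sup>2" and \<omega>: "\<omega> > 0" and t: "t \<ge> 0"
begin

lemma characteristic_component:
  assumes "l + m = - complex_of_real a" "l * m = complex_of_real b"
  shows "V t - m * U t = exp (l * t) * (V 0 - m * U 0)"
proof (rule first_order_linear_ode[OF _ t])
  fix t :: real assume "t \<ge> 0"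
  then have "((\<lambda>t. V t - m * U t) has_vector_derivative
      - (complex_of_real a * V t + complex_of_real b * U t) - m * V t) (at t within {0..})"
    using UV unfolding solves_ode_def
    by (intro has_vector_derivative_diff has_vector_derivative_mult_right) auto
  also have "- (complex_of_real a * V t + complex_of_real b * U t) - m * V t = l * (V t - m * U t)"
  proof -
    have a: "complex_of_real a = - l - m" using assms(1) by (simp add: algebra_simps eq_neg_iff_add_eq_0)
    show ?thesis unfolding a assms(2)[symmetric] by (simp add: algebra_simps)
  qed
  finally show "((\<lambda>t. V t - m * U t) has_vector_derivative l * (V t - m * U t)) (at t within {0..})" .
qed

abbreviation "char_root \<equiv> Complex (- a / 2) \<omega>"

lemma root_sum: "char_root + cnj char_root = - complex_of_real a" "cnj char_root + char_root = - complex_of_real a"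
  and root_prod: "char_root * cnj char_root = complex_of_real b" "cnj char_root * char_root = complex_of_real b"
  unfolding b by (simp_all add: complex_eq_iff power2_eq_square)

lemmas components = characteristic_component[OF root_sum(1) root_prod(1)]
  characteristic_component[OF root_sum(2) root_prod(2)]

lemma exp_root: "exp (char_root * t) = exp (- a * t / 2) * (cos (\<omega> * t) + \<i> * sin (\<omega> * t))"
  and exp_cnj_root: "exp (cnj char_root * t) = exp (- a * t / 2) * (cos (\<omega> * t) - \<i> * sin (\<omega> * t))"
proof -
  have "char_root * t = complex_of_real (- a * t / 2) + \<i> * complex_of_real (\<omega> * t)"
    "cnj char_root * t = complex_of_real (- a * t / 2) + \<i> * complex_of_real (- \<omega> * t)"
    by (simp_all add: complex_eq_iff)
  then show "exp (char_root * t) = exp (- a * t / 2) * (cos (\<omega> * t) + \<i> * sin (\<omega> * t))"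
    "exp (cnj char_root * t) = exp (- a * t / 2) * (cos (\<omega> * t) - \<i> * sin (\<omega> * t))"
    by (simp_all only: exp_add cis_conv_exp[symmetric] exp_of_real) (simp_all add: complex_eq_iff)
qed

lemma underdamped_solution:
  "U t = exp (- a * t / 2) * (U 0 * cos (\<omega> * t) + (V 0 + a / 2 * U 0) * (sin (\<omega> * t) / \<omega>))" (is ?U)
  "V t = exp (- a * t / 2) * (V 0 * cos (\<omega> * t) - (a / 2 * V 0 + b * U 0) * (sin (\<omega> * t) / \<omega>))" (is ?V)
proof -
  define E c s where "E = complex_of_real (exp (- a * t / 2))"
    and "c = complex_of_real (cos (\<omega> * t))" and "s = complex_of_real (sin (\<omega> * t))"
  define A where "A = complex_of_real (a / 2)"
  define w where "w = complex_of_real \<omega>"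
  have w: "w \<noteq> 0" using \<omega> by (simp add: w_def)
  have r: "char_root = - A + \<i> * w" "cnj char_root = - A - \<i> * w"
    by (simp_all add: A_def w_def complex_eq_iff)
  have B: "complex_of_real b = A\<^sup>2 + w\<^sup>2" unfolding b A_def w_def by (simp add: power_divide)
  note 1 = components(1)[unfolded exp_root, folded E_def c_def s_def, unfolded r(2)]
  note 2 = components(2)[unfolded exp_cnj_root, folded E_def c_def s_def, unfolded r(1)]
  have eqU: "2 * \<i> * w * U t = 2 * \<i> * (E * (w * U 0 * c + (V 0 + A * U 0) * s))"
  proof -
    have "2 * \<i> * w * U t = (V t - (- A - \<i> * w) * U t) - (V t - (- A + \<i> * w) * U t)"
      by (simp add: algebra_simps)
    also have "\<dots> = E * (c + \<i> * s) * (V 0 - (- A - \<i> * w) * U 0) - E * (c - \<i> * s) * (V 0 - (- A + \<i> * w) * U 0)"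
      using 1 2 by simp
    also have "\<dots> = 2 * \<i> * (E * (w * U 0 * c + (V 0 + A * U 0) * s))"
      by (simp add: algebra_simps)
    finally show ?thesis .
  qed
  have eqV: "2 * \<i> * w * V t = 2 * \<i> * (E * (w * V 0 * c - (A * V 0 + (A\<^sup>2 + w\<^sup>2) * U 0) * s))"
  proof -
    have "2 * \<i> * w * V t = (- A + \<i> * w) * (V t - (- A - \<i> * w) * U t) - (- A - \<i> * w) * (V t - (- A + \<i> * w) * U t)"
      by (simp add: algebra_simps)
    also have "\<dots> = (- A + \<i> * w) * (E * (c + \<i> * s) * (V 0 - (- A - \<i> * w) * U 0))
        - (- A - \<i> * w) * (E * (c - \<i> * s) * (V 0 - (- A + \<i> * w) * U 0))"
      using 1 2 by simp
    also have "\<dots> = 2 * \<i> * (E * (w * V 0 * c - (A * V 0 + (A\<^sup>2 + w\<^sup>2) * U 0) * s))"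
      by (simp add: algebra_simps power2_eq_square)
    finally show ?thesis .
  qed
  define q where "q = s / w"
  have q: "s = w * q" using w by (simp add: q_def)
  have "(2 * \<i> * w) * U t = (2 * \<i> * w) * (E * (U 0 * c + (V 0 + A * U 0) * q))"
    unfolding eqU q by (simp add: algebra_simps)
  then have "U t = E * (U 0 * c + (V 0 + A * U 0) * q)" using w by simp
  then show ?U by (simp add: E_def c_def s_def A_def w_def q_def)
  have "(2 * \<i> * w) * V t = (2 * \<i> * w) * (E * (V 0 * c - (A * V 0 + complex_of_real b * U 0) * q))"
    unfolding eqV q B by (simp add: algebra_simps)
  then have "V t = E * (V 0 * c - (A * V 0 + complex_of_real b * U 0) * q)" using w by simp
  then show ?V by (simp add: E_def c_def s_def A_def w_def q_def)
qed

end

text \<open>The hypothesis \<open>3 b \<le> 4 \<omega>\<^sup>2\<close> makes \<open>\<omega>\<close> comparable to \<open>\<surd>b\<close>, and \<open>a\<close> at most of the same order. The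
  factors \<open>6/5\<close> and \<open>3/5\<close> in the proof are rational upper bounds for \<open>2/\<surd>3\<close> and \<open>1/\<surd>3\<close>.\<close>

lemma underdamped_bounds:
  fixes a b \<omega> t :: real and v0 v1 :: complex
  assumes b: "b = a\<^sup>2 / 4 + \<omega>\<^sup>2" and \<omega>: "\<omega> > 0" and b\<omega>: "3 * b \<le> 4 * \<omega>\<^sup>2" and a: "a \<ge> 0"
  shows "cmod (exp (- a * t / 2) * (v0 * cos (\<omega> * t) + (v1 + a / 2 * v0) * (sin (\<omega> * t) / \<omega>)))
      \<le> 2 * exp (- a * t / 2) * (cmod v0 + cmod v1 / sqrt b)"
    and "cmod (exp (- a * t / 2) * (v1 * cos (\<omega> * t) - (a / 2 * v1 + b * v0) * (sin (\<omega> * t) / \<omega>)))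
      \<le> 2 * exp (- a * t / 2) * (cmod v1 + sqrt b * cmod v0)"
proof -
  have bp: "b > 0" unfolding b using \<omega> by (simp add: add_nonneg_pos)
  have "(sqrt b)\<^sup>2 \<le> (6/5 * \<omega>)\<^sup>2" using b\<omega> bp \<omega> by (simp add: power2_eq_square)
  then have sb: "sqrt b \<le> 6/5 * \<omega>" by (rule power2_le_imp_le) (use \<omega> in simp)
  have "3 * (a\<^sup>2 / 4 + \<omega>\<^sup>2) \<le> 4 * \<omega>\<^sup>2" using b\<omega> b by simp
  moreover have "0 \<le> \<omega>\<^sup>2" by simp
  ultimately have "25 * a\<^sup>2 \<le> 36 * \<omega>\<^sup>2" by argo
  then have "(a / 2)\<^sup>2 \<le> (3/5 * \<omega>)\<^sup>2" by (simp add: power_mult_distrib power_divide)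
  then have aw: "a / 2 \<le> 3/5 * \<omega>" by (rule power2_le_imp_le) (use \<omega> in simp)
  have c: "\<bar>cos (\<omega> * t)\<bar> \<le> 1" and s: "\<bar>sin (\<omega> * t)\<bar> \<le> 1" by auto
  have i: "1 / \<omega> \<le> 6/5 / sqrt b" using sb \<omega> bp by (simp add: field_simps)
  have so: "\<bar>sin (\<omega> * t)\<bar> / \<omega> \<le> 1 / \<omega>" using s \<omega> by (simp add: divide_right_mono)
  have "cmod (v0 * cos (\<omega> * t) + (v1 + a / 2 * v0) * (sin (\<omega> * t) / \<omega>))
      \<le> cmod v0 * \<bar>cos (\<omega> * t)\<bar> + cmod (v1 + a / 2 * v0) * (\<bar>sin (\<omega> * t)\<bar> / \<omega>)"
    using \<omega> norm_triangle_ineq[of "v0 * cos (\<omega> * t)" "(v1 + a / 2 * v0) * (sin (\<omega> * t) / \<omega>)"]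
    by (simp add: norm_mult norm_divide)
  also have "\<dots> \<le> cmod v0 * 1 + (cmod v1 + a / 2 * cmod v0) * (1 / \<omega>)"
  proof (intro add_mono mult_mono c so)
    show "cmod (v1 + a / 2 * v0) \<le> cmod v1 + a / 2 * cmod v0"
      using norm_triangle_ineq[of v1 "a / 2 * v0"] a by (simp add: norm_mult)
  qed (use a \<omega> in auto)
  also have "\<dots> = cmod v0 + cmod v1 * (1 / \<omega>) + (a / 2 / \<omega>) * cmod v0"
    by (simp add: algebra_simps add_divide_distrib)
  also have "\<dots> \<le> cmod v0 + cmod v1 * (6/5 / sqrt b) + 3/5 * cmod v0"
    using aw \<omega> i by (intro add_mono mult_left_mono mult_right_mono) (auto simp: field_simps)
  also have "\<dots> \<le> 2 * (cmod v0 + cmod v1 / sqrt b)"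
    using bp by (simp add: field_simps)
  finally have 1: "cmod (v0 * cos (\<omega> * t) + (v1 + a / 2 * v0) * (sin (\<omega> * t) / \<omega>))
      \<le> 2 * (cmod v0 + cmod v1 / sqrt b)" .
  show "cmod (exp (- a * t / 2) * (v0 * cos (\<omega> * t) + (v1 + a / 2 * v0) * (sin (\<omega> * t) / \<omega>)))
      \<le> 2 * exp (- a * t / 2) * (cmod v0 + cmod v1 / sqrt b)"
    using mult_left_mono[OF 1, of "exp (- a * t / 2)"]
    unfolding norm_mult[of "complex_of_real (exp _)"] norm_of_real abs_exp_cancel by (simp add: mult_ac)
  have "cmod (v1 * cos (\<omega> * t) - (a / 2 * v1 + b * v0) * (sin (\<omega> * t) / \<omega>))
      \<le> cmod v1 * \<bar>cos (\<omega> * t)\<bar> + cmod (a / 2 * v1 + b * v0) * (\<bar>sin (\<omega> * t)\<bar> / \<omega>)"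
    using \<omega> norm_triangle_ineq4[of "v1 * cos (\<omega> * t)" "(a / 2 * v1 + b * v0) * (sin (\<omega> * t) / \<omega>)"]
    by (simp add: norm_mult norm_divide)
  also have "\<dots> \<le> cmod v1 * 1 + (a / 2 * cmod v1 + b * cmod v0) * (1 / \<omega>)"
  proof (intro add_mono mult_mono c so)
    show "cmod (a / 2 * v1 + b * v0) \<le> a / 2 * cmod v1 + b * cmod v0"
      using norm_triangle_ineq[of "a / 2 * v1" "b * v0"] a bp by (simp add: norm_mult)
  qed (use a bp \<omega> in auto)
  also have "\<dots> = cmod v1 + (a / 2 / \<omega>) * cmod v1 + b * (1 / \<omega>) * cmod v0"
    by (simp add: algebra_simps add_divide_distrib)
  also have "\<dots> \<le> cmod v1 + 3/5 * cmod v1 + b * (6/5 / sqrt b) * cmod v0"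
    using aw \<omega> i bp by (intro add_mono mult_left_mono mult_right_mono) (auto simp: field_simps)
  also have "b * (6/5 / sqrt b) = 6/5 * sqrt b"
    using bp real_sqrt_mult_self[of b] by (simp add: field_simps)
  also have "cmod v1 + 3/5 * cmod v1 + 6/5 * sqrt b * cmod v0 \<le> 2 * (cmod v1 + sqrt b * cmod v0)"
  proof -
    have "0 \<le> sqrt b * cmod v0" "0 \<le> cmod v1" using bp by auto
    then show ?thesis unfolding mult.assoc by argo
  qed
  finally have 2: "cmod (v1 * cos (\<omega> * t) - (a / 2 * v1 + b * v0) * (sin (\<omega> * t) / \<omega>))
      \<le> 2 * (cmod v1 + sqrt b * cmod v0)" .
  show "cmod (exp (- a * t / 2) * (v1 * cos (\<omega> * t) - (a / 2 * v1 + b * v0) * (sin (\<omega> * t) / \<omega>)))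
      \<le> 2 * exp (- a * t / 2) * (cmod v1 + sqrt b * cmod v0)"
    using mult_left_mono[OF 2, of "exp (- a * t / 2)"]
    unfolding norm_mult[of "complex_of_real (exp _)"] norm_of_real abs_exp_cancel by (simp add: mult_ac)
qed

subsection \<open>The damped regime\<close>

text \<open>An energy estimate. For \<open>b \<le> a\<^sup>2\<close> put \<open>m = b / a\<close>. The functional
  \<open>|V|\<^sup>2 + b |U|\<^sup>2 + (m / 2) \<langle>V, U\<rangle>\<close> is equivalent to the energy \<open>|V|\<^sup>2 + b |U|\<^sup>2\<close>, and the mixed term
  makes it dissipate \<open>|U|\<^sup>2\<close> too, so that it decays at a rate proportional to \<open>m\<close>. In contrast to
  the explicit solution, this is uniform near the double root \<open>a\<^sup>2 = 4 b\<close>.\<close>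

lemma overdamped_energy:
  assumes UV: "solves_ode a b U V" and b: "b > 0" and a: "a > 0" and ba: "b \<le> a\<^sup>2" and t: "t \<ge> 0"
  shows "(cmod (V t))\<^sup>2 + b * (cmod (U t))\<^sup>2 \<le> 2 * ((cmod (V 0))\<^sup>2 + b * (cmod (U 0))\<^sup>2) * exp (- (b / a) * t / 5)"
proof -
  define m where "m = b / a"
  have m: "m > 0" "m \<le> a" "m * a = b" using a b ba by (auto simp: m_def field_simps power2_eq_square)
  have m2: "m\<^sup>2 \<le> b"
  proof -
    have "m\<^sup>2 = m * m" by (simp add: power2_eq_square)
    also have "\<dots> \<le> m * a" using m by (intro mult_left_mono) auto
    finally show ?thesis using m by simp
  qed
  define E0 where "E0 t = (cmod (V t))\<^sup>2 + b * (cmod (U t))\<^sup>2" for t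
  define E where "E t = V t \<bullet> V t + b * (U t \<bullet> U t) + m / 2 * (V t \<bullet> U t)" for t
  define W where "W t = - (complex_of_real a * V t + complex_of_real b * U t)" for t
  define E' where "E' t = 2 * (V t \<bullet> W t) + b * (2 * (U t \<bullet> V t)) + m / 2 * (V t \<bullet> V t + W t \<bullet> U t)" for t
  have W_eq: "W t = - (a *\<^sub>R V t + b *\<^sub>R U t)" for t by (simp add: W_def scaleR_conv_of_real)
  have cs: "\<bar>V t \<bullet> U t\<bar> \<le> cmod (V t) * cmod (U t)" for t by (rule Cauchy_Schwarz_ineq2)
  have equiv: "\<bar>m / 2 * (V t \<bullet> U t)\<bar> \<le> E0 t / 4" for t
  proof -
    have "\<bar>m / 2 * (V t \<bullet> U t)\<bar> \<le> m / 2 * (cmod (V t) * cmod (U t))"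
      using cs[of t] m by (simp add: abs_mult)
    also have "\<dots> = (2 * cmod (V t) * (m * cmod (U t))) / 4" by simp
    finally have *: "\<bar>m / 2 * (V t \<bullet> U t)\<bar> \<le> (2 * cmod (V t) * (m * cmod (U t))) / 4" .
    have "0 \<le> (cmod (V t) - m * cmod (U t))\<^sup>2" by simp
    moreover have "m\<^sup>2 * (cmod (U t))\<^sup>2 \<le> b * (cmod (U t))\<^sup>2" using m2 by (intro mult_right_mono) auto
    ultimately have "2 * cmod (V t) * (m * cmod (U t)) \<le> E0 t"
      unfolding E0_def power2_diff power_mult_distrib by argo
    then show ?thesis using * by argo
  qed
  have E_eq: "E t = E0 t + m / 2 * (V t \<bullet> U t)" for t
    by (simp add: E_def E0_def power2_norm_eq_inner)
  have E_bounds: "E t \<le> 5/4 * E0 t" "3/4 * E0 t \<le> E t" for t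
    using equiv[of t] unfolding E_eq by auto
  have decay: "E' t + m / 5 * E t \<le> 0" for t
  proof -
    define x u q where "x = cmod (V t)" and "u = cmod (U t)" and "q = V t \<bullet> U t"
    have q: "\<bar>q\<bar> \<le> x * u" using cs[of t] by (simp add: x_def u_def q_def)
    have "E' t + m / 5 * E t = - (2 * a - m / 2 - m / 5) * x\<^sup>2 - (m / 2 - m / 5) * b * u\<^sup>2 + m / 2 * (m / 5 - a) * q"
      unfolding E'_def E_def W_eq x_def u_def q_def power2_norm_eq_inner
      by (simp add: inner_simps inner_commute algebra_simps)
    also have "m / 2 * (m / 5 - a) * q \<le> m / 2 * a * (x * u)"
    proof -
      have "\<bar>(m / 5 - a) * q\<bar> \<le> a * (x * u)"
        unfolding abs_mult using q m by (intro mult_mono) auto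
      then have "m / 2 * ((m / 5 - a) * q) \<le> m / 2 * (a * (x * u))" using m by (intro mult_left_mono) auto
      then show ?thesis by (simp add: mult.assoc)
    qed
    also have "m / 2 * a * (x * u) \<le> a * x\<^sup>2 + m * b / 16 * u\<^sup>2"
    proof -
      have "0 \<le> a * (x - m / 4 * u)\<^sup>2" using a by simp
      also have "\<dots> = a * x\<^sup>2 - m / 2 * a * (x * u) + m * (m * a) / 16 * u\<^sup>2"
        by (simp add: power2_eq_square algebra_simps)
      finally show ?thesis unfolding m(3) by argo
    qed
    finally have "E' t + m / 5 * E t
        \<le> - (a - m / 2 - m / 5) * x\<^sup>2 - (m / 2 - m / 5 - m / 16) * b * u\<^sup>2"
      by (simp add: algebra_simps)
    moreover have "0 \<le> (a - m / 2 - m / 5) * x\<^sup>2" "0 \<le> (m / 2 - m / 5 - m / 16) * b * u\<^sup>2"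
      using m b by auto
    ultimately show ?thesis by linarith
  qed
  define F where "F t = exp (m / 5 * t) * E t" for t
  have dE: "(E has_vector_derivative E' t) (at t within {0..})" if "t \<ge> 0" for t
  proof -
    have dU: "(U has_vector_derivative V t) (at t within {0..})"
      and dV: "(V has_vector_derivative W t) (at t within {0..})"
      using UV that unfolding solves_ode_def W_def by auto
    note ip = bounded_bilinear.has_vector_derivative[OF bounded_bilinear_inner]
    have "(E has_vector_derivative (V t \<bullet> W t + W t \<bullet> V t) + b * (U t \<bullet> V t + V t \<bullet> U t) + m / 2 * (V t \<bullet> V t + W t \<bullet> U t)) (at t within {0..})"
      unfolding E_def
      by (intro has_vector_derivative_add has_vector_derivative_mult_right ip dU dV)
    then show ?thesis by (simp add: E'_def inner_commute)
  qed
  have dF: "(F has_vector_derivative exp (m / 5 * t) * (E' t + m / 5 * E t)) (at t within {0..})" if "t \<ge> 0" for t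
  proof -
    have "((\<lambda>t. exp (m / 5 * t)) has_vector_derivative exp (m / 5 * t) * (m / 5)) (at t within {0..})"
      unfolding has_real_derivative_iff_has_vector_derivative[symmetric]
      by (auto intro!: derivative_eq_intros)
    from has_vector_derivative_mult[OF this dE[OF that]] show ?thesis
      unfolding F_def by (simp add: algebra_simps)
  qed
  have "F t \<le> F 0"
  proof (rule DERIV_nonpos_imp_decreasing_open[where f=F and a=0 and b=t])
    show "0 \<le> t" by (rule t)
    fix x assume x: "0 < x" "x < t"
    have "(F has_vector_derivative exp (m / 5 * x) * (E' x + m / 5 * E x)) (at x within {0<..})"
      using dF[of x] x by (auto intro: has_vector_derivative_within_subset)
    then have "(F has_real_derivative exp (m / 5 * x) * (E' x + m / 5 * E x)) (at x)"
      using x unfolding has_real_derivative_iff_has_vector_derivative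
      by (subst (asm) at_within_open) auto
    moreover have "exp (m / 5 * x) * (E' x + m / 5 * E x) \<le> 0"
      using decay[of x] by (simp add: mult_nonneg_nonpos)
    ultimately show "\<exists>y. (F has_real_derivative y) (at x) \<and> y \<le> 0" by blast
  next
    show "continuous_on {0..t} F"
    proof (rule continuous_on_vector_derivative)
      fix x assume "x \<in> {0..t}"
      then show "(F has_vector_derivative exp (m / 5 * x) * (E' x + m / 5 * E x)) (at x within {0..t})"
        by (intro has_vector_derivative_within_subset[OF dF]) auto
    qed
  qed
  then have "exp (m / 5 * t) * E t \<le> E 0" by (simp add: F_def)
  then have "E t \<le> E 0 * exp (- (m / 5 * t))" by (simp add: exp_minus field_simps)
  also have "\<dots> \<le> (5/4 * E0 0) * exp (- (m / 5 * t))" by (intro mult_right_mono E_bounds) auto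
  finally have "E0 t \<le> 4/3 * (5/4 * E0 0 * exp (- (m / 5 * t)))" using E_bounds(2)[of t] by simp
  also have "\<dots> \<le> 2 * E0 0 * exp (- (m / 5 * t))"
    using b unfolding E0_def by simp
  finally show ?thesis unfolding E0_def m_def by (simp add: algebra_simps)
qed

section \<open>Weighted integrals\<close>

text \<open>Take the power \<open>q = p / g\<close> of the inequality \<open>y \<le> exp y\<close> at \<open>y = k r\<^sup>g / q\<close>.\<close>

lemma powr_times_exp_bounded:
  fixes p k g :: real
  assumes "p \<ge> 0" "k > 0" "g > 0"
  obtains C where "C > 0" "\<And>r. r \<ge> 0 \<Longrightarrow> r powr p * exp (- k * r powr g) \<le> C"
proof (cases "p = 0")
  case True
  show thesis
  proof (rule that[of 1])
    fix r :: real assume "r \<ge> 0"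
    have "exp (- k * r powr g) \<le> 1" using assms by simp
    moreover have "r powr p \<le> 1" using True by simp
    ultimately show "r powr p * exp (- k * r powr g) \<le> 1" by (simp add: mult_le_one)
  qed simp
next
  case False
  with assms have p: "p > 0" by simp
  define q where "q = p / g"
  have q: "q > 0" using p assms by (simp add: q_def)
  show thesis
  proof (rule that[of "(q / k) powr q"])
    show "(q / k) powr q > 0" using q assms by simp
    fix r :: real assume r: "r \<ge> 0"
    define y where "y = k * r powr g / q"
    have y: "y \<ge> 0" using q assms by (simp add: y_def)
    have "y \<le> exp y" using exp_ge_add_one_self[of y] by linarith
    then have "y powr q \<le> exp y powr q" using y q by (intro powr_mono2) auto
    also have "\<dots> = exp (k * r powr g)" using q by (simp add: powr_def y_def)
    finally have "(q / k) powr q * y powr q \<le> (q / k) powr q * exp (k * r powr g)"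
      by (rule mult_left_mono) simp
    moreover have "(q / k) powr q * y powr q = (r powr g) powr q"
      using q assms y by (subst powr_mult[symmetric]) (auto simp: y_def)
    moreover have "(r powr g) powr q = r powr p"
      using assms by (simp add: powr_powr q_def)
    ultimately show "r powr p * exp (- k * r powr g) \<le> (q / k) powr q"
      by (simp add: exp_minus field_simps)
  qed
qed

text \<open>Euler's integral for \<open>\<Gamma>(1 - \<beta>)\<close> on the positive half-line, and its reflection.\<close>

lemma integrable_powr_exp_real:
  fixes \<beta> :: real
  assumes "\<beta> < 1"
  shows "integrable lborel (\<lambda>x::real. \<bar>x\<bar> powr (- \<beta>) * exp (- \<bar>x\<bar>))"
proof -
  let ?f = "\<lambda>x::real. \<bar>x\<bar> powr (- \<beta>) * exp (- \<bar>x\<bar>)"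
  have "((\<lambda>t. t powr ((1 - \<beta>) - 1) / exp t) has_integral Gamma (1 - \<beta>)) {0..}"
    by (rule Gamma_integral_real) (use assms in simp)
  then have "(\<lambda>t. t powr ((1 - \<beta>) - 1) / exp t) absolutely_integrable_on {0..}"
    by (intro nonnegative_absolutely_integrable_1) (auto simp: integrable_on_def)
  then have "set_integrable lebesgue {0..} ?f"
    unfolding set_integrable_def
    by (rule Bochner_Integration.integrable_cong[THEN iffD1, rotated -1])
       (auto simp: indicator_def exp_minus divide_inverse)
  then have i: "integrable lebesgue (\<lambda>x. indicator {0..} x * ?f x)"
    by (simp add: set_integrable_def)
  have m: "(\<lambda>x::real. indicator {0..} x * ?f x) \<in> borel_measurable lborel" by measurable
  have i1: "integrable lborel (\<lambda>x. indicator {0..} x * ?f x)"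
    using i integrable_completion[OF m] by simp
  have i2: "integrable lborel (\<lambda>x. indicator {0..} (0 + (- 1) * x) * ?f (0 + (- 1) * x))"
    by (rule lborel_integrable_real_affine[OF i1]) simp
  show ?thesis
    by (rule Bochner_Integration.integrable_bound[OF Bochner_Integration.integrable_add[OF i1 i2]])
       (auto simp: indicator_def)
qed

text \<open>The singularity \<open>|x|\<^sup>p\<close> at the origin is dominated by a product of singularities in the
  coordinates, since \<open>|x| \<ge> |x\<^sub>i|\<close>, and the decay at infinity by a product of exponentials, since
  \<open>\<Sum> |x\<^sub>i| \<le> n |x|\<close> and \<open>q > 1\<close>.\<close>

lemma integrable_powr_exp:
  fixes p c q :: real
  assumes p: "p > - real DIM('a::euclidean_space)" and c: "c > 0" and q: "q > 1"
  shows "integrable lborel (\<lambda>x::'a. norm x powr p * exp (- c * norm x powr q))"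
proof -
  define n where "n = real DIM('a)"
  have n: "n > 0" by (simp add: n_def)
  define \<beta> where "\<beta> = max 0 (- p / n)"
  have \<beta>: "0 \<le> \<beta>" "\<beta> < 1" "p + n * \<beta> \<ge> 0"
    using p n by (auto simp: \<beta>_def n_def[symmetric] field_simps max_def)
  obtain C where C: "C > 0" "\<And>r. r \<ge> 0 \<Longrightarrow> r powr (p + n * \<beta>) * exp (- (c/2) * r powr q) \<le> C"
    using powr_times_exp_bounded[of "p + n * \<beta>" "c/2" q] \<beta> c q by auto
  \<comment> \<open>\<open>n r \<le> (c/2) r\<^sup>q\<close> as soon as \<open>r \<ge> R\<close>\<close>
  define R where "R = (2 * n / c) powr (1 / (q - 1))"
  have R: "n * r \<le> c / 2 * r powr q + n * R" if r: "r \<ge> 0" for r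
  proof (cases "r \<le> R")
    case True
    then have "n * r \<le> n * R" using n by simp
    then show ?thesis using c by (simp add: add_increasing)
  next
    case False
    have R0: "R > 0" unfolding R_def using n c by simp
    then have r: "r > 0" using False by simp
    have "2 * n / c = R powr (q - 1)" unfolding R_def using n c q by (simp add: powr_powr)
    also have "\<dots> \<le> r powr (q - 1)" using False R0 q by (intro powr_mono2) auto
    finally have "n \<le> c / 2 * r powr (q - 1)" using c by (simp add: field_simps)
    then have "n * r \<le> c / 2 * r powr (q - 1) * r" using r by (intro mult_right_mono) auto
    also have "\<dots> = c / 2 * r powr q" using r by (simp add: powr_diff)
    also have "\<dots> \<le> c / 2 * r powr q + n * R" using n R0 by simp
    finally show ?thesis .
  qed
  define h where "h x = \<bar>x\<bar> powr (- \<beta>) * exp (- \<bar>x\<bar>)" for x :: real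
  have "integrable lborel (\<lambda>x::'a. C * exp (n * R) * (\<Prod>b\<in>Basis. h (x \<bullet> b)))"
    unfolding h_def
    by (intro integrable_mult_right lborel_prod_integral(1) integrable_powr_exp_real \<beta>)
  then show ?thesis
  proof (rule Bochner_Integration.integrable_bound)
    \<comment> \<open>the bound fails on the coordinate hyperplanes, where the factors vanish by convention\<close>
    have "AE x in lborel. x \<bullet> b \<noteq> 0" if "b \<in> Basis" for b :: 'a
    proof -
      have "{x. x \<bullet> b = 0} \<in> null_sets lborel"
        using negligible_standard_hyperplane[OF that, of 0]
        by (simp add: negligible_iff_null_sets null_sets_completion_iff closed_hyperplane inner_commute)
      from AE_not_in[OF this] show ?thesis by simp
    qed
    then have "AE x::'a in lborel. \<forall>b\<in>Basis. x \<bullet> b \<noteq> 0"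
      by (subst AE_finite_all) auto
    then show "AE x::'a in lborel. norm (norm x powr p * exp (- c * norm x powr q))
        \<le> norm (C * exp (n * R) * (\<Prod>b\<in>Basis. h (x \<bullet> b)))"
    proof eventually_elim
      case (elim x)
      obtain b0 :: 'a where "b0 \<in> Basis" using nonempty_Basis by blast
      with elim have r: "norm x > 0" by auto
      have "norm x powr (- (n * \<beta>)) = (\<Prod>b\<in>(Basis::'a set). norm x powr (- \<beta>))"
        using r by (simp add: n_def powr_powr[symmetric] powr_realpow[symmetric]) (simp add: powr_powr mult.commute)
      also have "\<dots> \<le> (\<Prod>b\<in>Basis. \<bar>x \<bullet> b\<bar> powr (- \<beta>))"
        using elim \<beta> by (intro prod_mono conjI powr_mono2') (auto simp: Basis_le_norm)
      finally have sing: "norm x powr (- (n * \<beta>)) \<le> (\<Prod>b\<in>Basis. \<bar>x \<bullet> b\<bar> powr (- \<beta>))" .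
      have "(\<Sum>b\<in>Basis. \<bar>x \<bullet> b\<bar>) \<le> n * norm x"
        unfolding n_def by (rule sum_bounded_above) (rule Basis_le_norm)
      with R[of "norm x"] have "exp (- (c/2) * norm x powr q) \<le> exp (n * R + (\<Sum>b\<in>Basis. - \<bar>x \<bullet> b\<bar>))"
        by (simp add: sum_negf)
      also have "\<dots> = exp (n * R) * (\<Prod>b\<in>Basis. exp (- \<bar>x \<bullet> b\<bar>))"
        by (simp add: exp_add exp_sum)
      finally have decay: "exp (- (c/2) * norm x powr q) \<le> exp (n * R) * (\<Prod>b\<in>Basis. exp (- \<bar>x \<bullet> b\<bar>))" .
      have "norm x powr p * exp (- c * norm x powr q)
          = (norm x powr (p + n * \<beta>) * exp (- (c/2) * norm x powr q)) * (norm x powr (- (n * \<beta>)) * exp (- (c/2) * norm x powr q))"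
      proof -
        have "norm x powr p = norm x powr (p + n * \<beta>) * norm x powr (- (n * \<beta>))"
          by (simp flip: powr_add)
        moreover have "exp (- c * norm x powr q) = exp (- (c/2) * norm x powr q) * exp (- (c/2) * norm x powr q)"
          by (simp flip: exp_add)
        ultimately show ?thesis by simp
      qed
      also have "\<dots> \<le> C * ((\<Prod>b\<in>Basis. \<bar>x \<bullet> b\<bar> powr (- \<beta>)) * (exp (n * R) * (\<Prod>b\<in>Basis. exp (- \<bar>x \<bullet> b\<bar>))))"
        using C(1) by (intro mult_mono C(2) sing decay) (auto intro!: prod_nonneg)
      also have "\<dots> = C * exp (n * R) * (\<Prod>b\<in>Basis. h (x \<bullet> b))"
        by (simp add: h_def prod.distrib)
      finally have "norm x powr p * exp (- c * norm x powr q) \<le> C * exp (n * R) * (\<Prod>b\<in>Basis. h (x \<bullet> b))" .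
      then show ?case by simp
    qed
  qed measurable
qed

subsection \<open>Scaling\<close>

lemma L2_norm_lborel:
  fixes f :: "'a::euclidean_space \<Rightarrow> complex"
  assumes [measurable]: "f \<in> borel_measurable borel"
  shows "(L2_norm f)\<^sup>2 = (\<integral>x. (cmod (f x))\<^sup>2 \<partial>lborel)"
  unfolding L2_norm_power2 by (rule integral_completion) measurable

lemma L2_I_lborel:
  fixes f :: "'a::euclidean_space \<Rightarrow> complex"
  assumes f: "f \<in> borel_measurable borel" and g: "integrable lborel g"
    and le: "\<And>x. (cmod (f x))\<^sup>2 \<le> g x"
  shows "f \<in> L2"
proof (rule L2_I_integrable)
  show "f \<in> borel_measurable lebesgue" using f by (intro measurable_completion) simp
  have "g \<in> borel_measurable lborel" using g by (rule borel_measurable_integrable)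
  from integrable_completion[OF this] g show "integrable lebesgue g" by simp
qed (use le in auto)

lemma L2_norm_scale:
  fixes f :: "'a::euclidean_space \<Rightarrow> complex"
  assumes [measurable]: "f \<in> borel_measurable borel" and "l > 0"
  shows "(L2_norm f)\<^sup>2 = l ^ DIM('a) * (L2_norm (\<lambda>x. f (l *\<^sub>R x)))\<^sup>2"
  using integral_lborel_scale[OF assms(2), of "\<lambda>x. (cmod (f x))\<^sup>2" 0]
  by (subst (1 2) L2_norm_lborel) auto

lemma scaled_L2_norm:
  fixes f :: "'a::euclidean_space \<Rightarrow> complex" and \<alpha> k t :: real
  assumes m[measurable]: "f \<in> borel_measurable borel" and t: "t > 0"
  shows "L2_norm f = t powr (- \<alpha> - k * DIM('a) / 2) *
    sqrt (\<integral>\<eta>. (t powr \<alpha> * cmod (f ((t powr (- k)) *\<^sub>R \<eta>)))\<^sup>2 \<partial>lborel)"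
proof -
  define J where "J = (\<integral>\<eta>. (t powr \<alpha> * cmod (f ((t powr (- k)) *\<^sub>R \<eta>)))\<^sup>2 \<partial>lborel)"
  have "J = (t powr \<alpha>)\<^sup>2 * (L2_norm (\<lambda>\<eta>. f ((t powr (- k)) *\<^sub>R \<eta>)))\<^sup>2"
    unfolding J_def by (subst L2_norm_lborel) (auto simp: power_mult_distrib)
  moreover have "(L2_norm f)\<^sup>2 = (t powr (- k)) ^ DIM('a) * (L2_norm (\<lambda>\<eta>. f ((t powr (- k)) *\<^sub>R \<eta>)))\<^sup>2"
    using t by (intro L2_norm_scale m) simp
  moreover have "(t powr (- k)) ^ DIM('a) = t powr (- k * DIM('a))"
    using t by (simp add: powr_powr flip: powr_realpow)
  moreover have "(t powr \<alpha>)\<^sup>2 = t powr (2 * \<alpha>)"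
    using t by (simp add: power2_eq_square flip: powr_add)
  ultimately have "(L2_norm f)\<^sup>2 = t powr (- k * DIM('a)) * (t powr (- (2 * \<alpha>)) * J)"
    using t by (simp add: mult.assoc[symmetric] flip: powr_add)
  also have "\<dots> = (t powr (- \<alpha> - k * DIM('a) / 2))\<^sup>2 * J"
  proof -
    have "- k * DIM('a) + - (2 * \<alpha>) = (- \<alpha> - k * DIM('a) / 2) + (- \<alpha> - k * DIM('a) / 2)" by simp
    then have "t powr (- k * DIM('a)) * t powr (- (2 * \<alpha>)) = (t powr (- \<alpha> - k * DIM('a) / 2))\<^sup>2"
      unfolding power2_eq_square powr_add[symmetric] by (rule arg_cong)
    then show ?thesis by (simp only: mult.assoc[symmetric])
  qed
  finally have "sqrt ((L2_norm f)\<^sup>2) = sqrt ((t powr (- \<alpha> - k * DIM('a) / 2))\<^sup>2 * J)" by simp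
  then have "L2_norm f = t powr (- \<alpha> - k * DIM('a) / 2) * sqrt J" using t by (simp add: real_sqrt_mult)
  then show ?thesis unfolding J_def .
qed

text \<open>The substitution \<open>\<xi> = t\<^sup>-\<^sup>k \<eta>\<close> produces the factor \<open>t\<^bsup>- k n / 2\<^esup>\<close>; the rest is dominated convergence.\<close>

lemma scaled_L2_norm_smallo:
  fixes \<Phi> :: "real \<Rightarrow> 'a::euclidean_space \<Rightarrow> complex"
  assumes m[measurable]: "\<And>t. \<Phi> t \<in> borel_measurable borel"
    and h: "integrable lborel h"
    and bound: "\<And>t \<eta>. t \<ge> 1 \<Longrightarrow> \<eta> \<noteq> 0 \<Longrightarrow> (t powr \<alpha> * cmod (\<Phi> t ((t powr (- k)) *\<^sub>R \<eta>)))\<^sup>2 \<le> h \<eta>"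
    and lim: "\<And>\<eta>. \<eta> \<noteq> 0 \<Longrightarrow> ((\<lambda>t. t powr \<alpha> * cmod (\<Phi> t ((t powr (- k)) *\<^sub>R \<eta>))) \<longlongrightarrow> 0) at_top"
  shows "(\<lambda>t. L2_norm (\<Phi> t)) \<in> o(\<lambda>t. t powr (- \<alpha> - k * DIM('a) / 2))"
proof -
  define J where "J t = (\<integral>\<eta>. (t powr \<alpha> * cmod (\<Phi> t ((t powr (- k)) *\<^sub>R \<eta>)))\<^sup>2 \<partial>lborel)" for t
  have ae0: "AE \<eta>::'a in lborel. \<eta> \<noteq> 0" by (rule AE_lborel_singleton)
  have "(J \<longlongrightarrow> integral\<^sup>L (lborel :: 'a measure) (\<lambda>\<eta>. 0)) at_top"
    unfolding J_def
  proof (rule integral_dominated_convergence_at_top[OF _ _ h])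
    show "AE \<eta> in lborel. ((\<lambda>t. (t powr \<alpha> * cmod (\<Phi> t (t powr - k *\<^sub>R \<eta>)))\<^sup>2) \<longlongrightarrow> 0) at_top"
      using ae0
    proof eventually_elim
      case (elim \<eta>)
      from tendsto_power[OF lim[OF this], of 2] show ?case by simp
    qed
    show "\<forall>\<^sub>F t in at_top. AE \<eta> in lborel. norm ((t powr \<alpha> * cmod (\<Phi> t (t powr - k *\<^sub>R \<eta>)))\<^sup>2) \<le> h \<eta>"
      using eventually_ge_at_top[of 1]
    proof eventually_elim
      case (elim t)
      show ?case using ae0 by eventually_elim (use bound[OF elim] in simp)
    qed
  qed measurable
  then have J: "(J \<longlongrightarrow> 0) at_top" by simp
  have L: "L2_norm (\<Phi> t) = t powr (- \<alpha> - k * DIM('a) / 2) * sqrt (J t)" if "t > 0" for t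
    unfolding J_def by (rule scaled_L2_norm[OF m that])
  show ?thesis
  proof (rule smalloI_tendsto)
    have "((\<lambda>t. sqrt (J t)) \<longlongrightarrow> 0) at_top" using tendsto_real_sqrt[OF J] by simp
    then show "((\<lambda>t. L2_norm (\<Phi> t) / t powr (- \<alpha> - k * DIM('a) / 2)) \<longlongrightarrow> 0) at_top"
    proof (rule Lim_transform_eventually)
      show "\<forall>\<^sub>F t in at_top. sqrt (J t) = L2_norm (\<Phi> t) / t powr (- \<alpha> - k * DIM('a) / 2)"
        using eventually_gt_at_top[of 0] by eventually_elim (simp add: L)
    qed
    show "\<forall>\<^sub>F t::real in at_top. t powr (- \<alpha> - k * DIM('a) / 2) \<noteq> 0"
      using eventually_gt_at_top[of 0] by eventually_elim simp
  qed
qed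

section \<open>The solution on the frequency side\<close>

locale damped_wave =
  fixes \<sigma> \<delta> :: real
  assumes sigma: "\<sigma> \<ge> 1" and delta: "\<sigma> / 2 < \<delta>" "\<delta> < \<sigma>"
begin

text \<open>For small \<open>r\<close> the characteristic roots are \<open>- r\<^bsup>2\<delta>\<^esup> / 2 \<plusminus> i omega r\<close>.\<close>

definition omega :: "real \<Rightarrow> real" where
  "omega r = sqrt (r powr (2 * \<sigma>) - (r powr (2 * \<delta>))\<^sup>2 / 4)"

text \<open>The solution with data \<open>v0\<close>, \<open>v1\<close> in the oscillating regime, and below its time derivative.\<close>

definition lowU :: "complex \<Rightarrow> complex \<Rightarrow> real \<Rightarrow> real \<Rightarrow> complex" where
  "lowU v0 v1 r t = complex_of_real (exp (- (r powr (2 * \<delta>)) * t / 2)) *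
     (v0 * complex_of_real (cos (omega r * t))
      + (v1 + complex_of_real (r powr (2 * \<delta>) / 2) * v0) * complex_of_real (sin (omega r * t) / omega r))"

definition lowV :: "complex \<Rightarrow> complex \<Rightarrow> real \<Rightarrow> real \<Rightarrow> complex" where
  "lowV v0 v1 r t = complex_of_real (exp (- (r powr (2 * \<delta>)) * t / 2)) *
     (v1 * complex_of_real (cos (omega r * t))
      - (complex_of_real (r powr (2 * \<delta>) / 2) * v1 + complex_of_real (r powr (2 * \<sigma>)) * v0)
        * complex_of_real (sin (omega r * t) / omega r))"

lemma omega_eq:
  assumes "r > 0"
  shows "omega r = r powr \<sigma> * sqrt (1 - r powr (4 * \<delta> - 2 * \<sigma>) / 4)"
proof -
  have "r powr (2 * \<sigma>) - (r powr (2 * \<delta>))\<^sup>2 / 4 = (r powr \<sigma>)\<^sup>2 * (1 - r powr (4 * \<delta> - 2 * \<sigma>) / 4)"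
  proof -
    have "r powr (2 * \<sigma>) = (r powr \<sigma>)\<^sup>2"
      using assms by (simp add: power2_eq_square flip: powr_add)
    moreover have "(r powr (2 * \<delta>))\<^sup>2 = r powr (2 * \<sigma>) * r powr (4 * \<delta> - 2 * \<sigma>)"
      using assms by (simp add: power2_eq_square flip: powr_add)
    ultimately show ?thesis by (simp add: algebra_simps)
  qed
  then show ?thesis unfolding omega_def by (simp add: real_sqrt_mult)
qed

text \<open>Here \<open>r\<^bsup>4\<delta>\<^esup> \<le> r\<^bsup>2\<sigma>\<^esup>\<close>, because \<open>r \<le> 1\<close> and \<open>2 \<delta> > \<sigma>\<close>.\<close>

lemma omega_facts:
  assumes "0 < r" "r \<le> 1"
  shows "r powr (2 * \<sigma>) = (r powr (2 * \<delta>))\<^sup>2 / 4 + (omega r)\<^sup>2" "omega r > 0"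
    "3 * r powr (2 * \<sigma>) \<le> 4 * (omega r)\<^sup>2"
proof -
  have "(r powr (2 * \<delta>))\<^sup>2 = r powr (4 * \<delta>)" using assms by (simp add: power2_eq_square flip: powr_add)
  also have "\<dots> \<le> r powr (2 * \<sigma>)" using assms delta by (intro powr_mono') auto
  finally have le: "(r powr (2 * \<delta>))\<^sup>2 \<le> r powr (2 * \<sigma>)" .
  have pos: "r powr (2 * \<sigma>) > 0" using assms by simp
  have sq: "(omega r)\<^sup>2 = r powr (2 * \<sigma>) - (r powr (2 * \<delta>))\<^sup>2 / 4"
    unfolding omega_def by (rule real_sqrt_pow2) (use le pos in linarith)
  then show "r powr (2 * \<sigma>) = (r powr (2 * \<delta>))\<^sup>2 / 4 + (omega r)\<^sup>2" by simp
  show "3 * r powr (2 * \<sigma>) \<le> 4 * (omega r)\<^sup>2" using le sq by simp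
  show "omega r > 0" unfolding omega_def real_sqrt_gt_0_iff using le pos by linarith
qed

lemma sqrt_powr: "r > 0 \<Longrightarrow> sqrt (r powr (2 * \<sigma>)) = r powr \<sigma>"
  by (simp add: powr_half_sqrt[symmetric] powr_powr)

lemma low_solution:
  assumes "solves_ode (r powr (2 * \<delta>)) (r powr (2 * \<sigma>)) U V" "0 < r" "r \<le> 1" "t \<ge> 0"
  shows "U t = lowU (U 0) (V 0) r t" "V t = lowV (U 0) (V 0) r t"
  unfolding lowU_def lowV_def
  using underdamped_solution[OF assms(1) omega_facts(1,2)[OF assms(2,3)] assms(4)] by simp_all

lemma low_bounds:
  fixes v0 v1 :: complex
  assumes "0 < r" "r \<le> 1"
  shows "cmod (lowU v0 v1 r t) \<le> 2 * exp (- (r powr (2 * \<delta>)) * t / 2) * (cmod v0 + cmod v1 / r powr \<sigma>)"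
    "cmod (lowV v0 v1 r t) \<le> 2 * exp (- (r powr (2 * \<delta>)) * t / 2) * (cmod v1 + r powr \<sigma> * cmod v0)"
  using underdamped_bounds(1)[OF omega_facts[OF assms], of t v0 v1]
    underdamped_bounds(2)[OF omega_facts[OF assms], of t v1 v0]
  unfolding lowU_def lowV_def sqrt_powr[OF assms(1)] by (simp_all add: mult.commute)

text \<open>At high frequencies the energy decays like \<open>exp (- r\<^bsup>2(\<sigma> - \<delta>)\<^esup> t / 5)\<close>. Since \<open>\<delta> < \<sigma>\<close>, one half of the
  exponent absorbs every power of \<open>r\<close> once \<open>t\<close> is bounded away from 0, and the other half decays
  exponentially in \<open>t\<close>.\<close>

lemma high_bound:
  assumes "s \<ge> 0" "t0 > 0"
  obtains C where "C > 0"
    "\<And>U V r t. solves_ode (r powr (2 * \<delta>)) (r powr (2 * \<sigma>)) U V \<Longrightarrow> r \<ge> 1 \<Longrightarrow> t \<ge> t0 \<Longrightarrow>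
      r powr s * cmod (U t) \<le> C * exp (- t / 20) * (cmod (U 0) + cmod (V 0)) \<and>
      r powr s * cmod (V t) \<le> C * exp (- t / 20) * (cmod (U 0) + cmod (V 0))"
proof -
  define g where "g = 2 * \<sigma> - 2 * \<delta>"
  have g: "g > 0" using delta by (simp add: g_def)
  obtain C where C: "C > 0" "\<And>r. r \<ge> 0 \<Longrightarrow> r powr (s + \<sigma>) * exp (- (t0 / 20) * r powr g) \<le> C"
    using powr_times_exp_bounded[of "s + \<sigma>" "t0 / 20" g] assms sigma g by auto
  show thesis
  proof (rule that[of "2 * C"])
    show "2 * C > 0" using C by simp
    fix U V :: "real \<Rightarrow> complex" and r t :: real
    assume ode: "solves_ode (r powr (2 * \<delta>)) (r powr (2 * \<sigma>)) U V" and r: "r \<ge> 1" and t: "t \<ge> t0"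
    define b where "b = r powr (2 * \<sigma>)"
    define D where "D = cmod (U 0) + cmod (V 0)"
    have b1: "b \<ge> 1" unfolding b_def using r sigma by (intro ge_one_powr_ge_zero) auto
    have ba: "b \<le> (r powr (2 * \<delta>))\<^sup>2"
    proof -
      have "b \<le> r powr (4 * \<delta>)" unfolding b_def using r delta by (intro powr_mono) auto
      also have "\<dots> = (r powr (2 * \<delta>))\<^sup>2" using r by (simp add: power2_eq_square flip: powr_add)
      finally show ?thesis .
    qed
    have m: "b / r powr (2 * \<delta>) = r powr g" using r by (simp add: b_def g_def powr_diff)
    have rg: "r powr g \<ge> 1" using r g by (intro ge_one_powr_ge_zero) auto
    define X where "X = 2 * r powr \<sigma> * D * exp (- (r powr g) * t / 10)"
    have D: "D \<ge> 0" by (simp add: D_def)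
    have E: "(cmod (V t))\<^sup>2 + b * (cmod (U t))\<^sup>2 \<le> X\<^sup>2"
    proof -
      have "(cmod (V t))\<^sup>2 + b * (cmod (U t))\<^sup>2
          \<le> 2 * ((cmod (V 0))\<^sup>2 + b * (cmod (U 0))\<^sup>2) * exp (- (r powr g) * t / 5)"
        using overdamped_energy[OF ode, of t] b1 ba r t assms m unfolding b_def by simp
      also have "(cmod (V 0))\<^sup>2 + b * (cmod (U 0))\<^sup>2 \<le> b * D\<^sup>2"
      proof -
        have "(cmod (V 0))\<^sup>2 \<le> b * (cmod (V 0))\<^sup>2" using mult_right_mono[OF b1, of "(cmod (V 0))\<^sup>2"] by simp
        then have "(cmod (V 0))\<^sup>2 + b * (cmod (U 0))\<^sup>2 \<le> b * ((cmod (V 0))\<^sup>2 + (cmod (U 0))\<^sup>2)"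
          by (simp add: distrib_left)
        also have "\<dots> \<le> b * D\<^sup>2"
          using b1 by (intro mult_left_mono) (auto simp: D_def power2_sum)
        finally show ?thesis .
      qed
      also have "2 * (b * D\<^sup>2) * exp (- (r powr g) * t / 5) \<le> 4 * (b * D\<^sup>2) * exp (- (r powr g) * t / 5)"
        using b1 by (intro mult_right_mono) auto
      also have "\<dots> = X\<^sup>2"
      proof -
        have "b = r powr \<sigma> * r powr \<sigma>" using r by (simp add: b_def flip: powr_add)
        moreover have "exp (- (r powr g) * t / 5) = exp (- (r powr g) * t / 10) * exp (- (r powr g) * t / 10)"
          by (simp flip: exp_add)
        ultimately show ?thesis by (simp add: X_def power2_eq_square)
      qed
      finally show ?thesis by simp
    qed
    have X: "X \<ge> 0" using D by (simp add: X_def)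
    have VX: "cmod (V t) \<le> X"
    proof (rule power2_le_imp_le[OF _ X])
      have "0 \<le> b * (cmod (U t))\<^sup>2" using b1 by simp
      with E show "(cmod (V t))\<^sup>2 \<le> X\<^sup>2" by linarith
    qed
    have UX: "cmod (U t) \<le> X"
    proof (rule power2_le_imp_le[OF _ X])
      have "(cmod (U t))\<^sup>2 \<le> b * (cmod (U t))\<^sup>2" using mult_right_mono[OF b1, of "(cmod (U t))\<^sup>2"] by simp
      moreover have "0 \<le> (cmod (V t))\<^sup>2" by simp
      ultimately show "(cmod (U t))\<^sup>2 \<le> X\<^sup>2" using E by linarith
    qed
    have "r powr s * X \<le> 2 * C * exp (- t / 20) * D"
    proof -
      have "exp (- (r powr g) * t / 10) = exp (- (r powr g) * t / 20) * exp (- (r powr g) * t / 20)"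
        by (simp flip: exp_add)
      also have "\<dots> \<le> exp (- (t0 / 20) * r powr g) * exp (- t / 20)"
      proof (intro mult_mono)
        have "t0 * r powr g \<le> t * r powr g" using t by (intro mult_right_mono) auto
        then show "exp (- (r powr g) * t / 20) \<le> exp (- (t0 / 20) * r powr g)" by (simp add: mult.commute)
        have "1 * t \<le> r powr g * t" using rg t assms by (intro mult_right_mono) auto
        then show "exp (- (r powr g) * t / 20) \<le> exp (- t / 20)" by simp
      qed auto
      finally have "r powr (s + \<sigma>) * exp (- (r powr g) * t / 10)
          \<le> r powr (s + \<sigma>) * (exp (- (t0 / 20) * r powr g) * exp (- t / 20))"
        by (rule mult_left_mono) simp
      also have "\<dots> \<le> C * exp (- t / 20)"
        using mult_right_mono[OF C(2)[of r], of "exp (- t / 20)"] r by (simp add: mult.assoc)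
      finally have "(2 * D) * (r powr (s + \<sigma>) * exp (- (r powr g) * t / 10)) \<le> (2 * D) * (C * exp (- t / 20))"
        using D by (intro mult_left_mono) auto
      then show ?thesis by (simp add: X_def powr_add mult_ac)
    qed
    with mult_left_mono[OF UX, of "r powr s"] mult_left_mono[OF VX, of "r powr s"]
    show "r powr s * cmod (U t) \<le> 2 * C * exp (- t / 20) * (cmod (U 0) + cmod (V 0)) \<and>
      r powr s * cmod (V t) \<le> 2 * C * exp (- t / 20) * (cmod (U 0) + cmod (V 0))"
      unfolding D_def[symmetric] by auto
  qed
qed

subsection \<open>Limits along the parabolic scaling\<close>

text \<open>The length of \<open>\<xi> = t\<^bsup>-1/(2\<delta>)\<^esup> \<eta>\<close> for \<open>|\<eta>| = \<rho>\<close>.\<close>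

definition radius :: "real \<Rightarrow> real \<Rightarrow> real" where
  "radius \<rho> t = t powr (- (1 / (2 * \<delta>))) * \<rho>"

context
  fixes \<rho> :: real
  assumes \<rho>: "\<rho> > 0"
begin

abbreviation "rad \<equiv> radius \<rho>"

lemma delta_pos: "\<delta> > 0" using sigma delta by linarith

lemma rad_pos: "t > 0 \<Longrightarrow> rad t > 0"
  using \<rho> by (simp add: radius_def)

lemma rad_tendsto: "(rad \<longlongrightarrow> 0) at_top"
proof -
  have "((\<lambda>t::real. t powr (- (1 / (2 * \<delta>)))) \<longlongrightarrow> 0) at_top"
    using delta_pos by (intro tendsto_neg_powr filterlim_ident) auto
  from tendsto_mult_left_zero[OF this, of \<rho>] show ?thesis unfolding radius_def[abs_def] .
qed

lemma rad_le_1: "\<forall>\<^sub>F t in at_top. 0 < rad t \<and> rad t \<le> 1"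
proof -
  have "\<forall>\<^sub>F t in at_top. rad t < 1" by (rule order_tendstoD(2)[OF rad_tendsto]) simp
  with eventually_gt_at_top[of 0] show ?thesis
    by eventually_elim (auto intro: rad_pos)
qed

lemma rad_powr_tendsto: assumes "e > 0" shows "((\<lambda>t. rad t powr e) \<longlongrightarrow> 0) at_top"
proof -
  have "((\<lambda>t. rad t powr e) \<longlongrightarrow> 0 powr e) at_top"
    by (rule tendsto_powr'[OF rad_tendsto tendsto_const])
      (use assms rad_le_1 in \<open>auto elim!: eventually_mono\<close>)
  then show ?thesis using assms by simp
qed

lemma rad_damping: assumes "t > 0" shows "rad t powr (2 * \<delta>) * t = \<rho> powr (2 * \<delta>)"
proof -
  have "rad t powr (2 * \<delta>) = t powr (- 1) * \<rho> powr (2 * \<delta>)"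
    unfolding radius_def using assms \<rho> delta_pos by (simp add: powr_mult powr_powr)
  then show ?thesis using assms by (simp add: powr_minus)
qed

lemma frequency_ratio: "((\<lambda>t. rad t powr \<sigma> / omega (rad t)) \<longlongrightarrow> 1) at_top"
proof -
  have "((\<lambda>t. 1 / sqrt (1 - rad t powr (4 * \<delta> - 2 * \<sigma>) / 4)) \<longlongrightarrow> 1 / sqrt (1 - 0 / 4)) at_top"
    using delta by (intro tendsto_intros rad_powr_tendsto) auto
  moreover have "\<forall>\<^sub>F t in at_top. 1 / sqrt (1 - rad t powr (4 * \<delta> - 2 * \<sigma>) / 4) = rad t powr \<sigma> / omega (rad t)"
    using rad_le_1 by eventually_elim (simp add: omega_eq)
  ultimately show ?thesis by (auto intro: Lim_transform_eventually)
qed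

text \<open>The phases \<open>t \<omega>\<close> and \<open>t r\<^sup>\<sigma>\<close> differ by \<open>O(t r\<^bsup>4\<delta> - \<sigma>\<^esup>)\<close>, where \<open>t r\<^bsup>2\<delta>\<^esup>\<close> is constant.\<close>

lemma phase_difference: "((\<lambda>t. omega (rad t) * t - t * rad t powr \<sigma>) \<longlongrightarrow> 0) at_top"
proof (rule Lim_null_comparison)
  have "((\<lambda>t. \<rho> powr (2 * \<delta>) / 4 * rad t powr (2 * \<delta> - \<sigma>)) \<longlongrightarrow> \<rho> powr (2 * \<delta>) / 4 * 0) at_top"
    using delta by (intro tendsto_intros rad_powr_tendsto) auto
  then show "((\<lambda>t. \<rho> powr (2 * \<delta>) / 4 * rad t powr (2 * \<delta> - \<sigma>)) \<longlongrightarrow> 0) at_top" by simp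
  show "\<forall>\<^sub>F t in at_top. norm (omega (rad t) * t - t * rad t powr \<sigma>) \<le> \<rho> powr (2 * \<delta>) / 4 * rad t powr (2 * \<delta> - \<sigma>)"
    using rad_le_1 eventually_gt_at_top[of 0]
  proof eventually_elim
    case (elim t)
    define r where "r = rad t"
    define x where "x = r powr (4 * \<delta> - 2 * \<sigma>) / 4"
    have r: "0 < r" "r \<le> 1" using elim by (auto simp: r_def)
    have x: "0 \<le> x" "x \<le> 1"
      using r delta powr_le1[of "4 * \<delta> - 2 * \<sigma>" r] by (auto simp: x_def)
    have "sqrt (1 - x) \<le> 1" using x by simp
    moreover have "1 - x \<le> sqrt (1 - x)"
    proof (rule real_le_rsqrt)
      have "(1 - x)\<^sup>2 = (1 - x) * (1 - x)" by (simp add: power2_eq_square)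
      also have "\<dots> \<le> 1 * (1 - x)" using x by (intro mult_right_mono) auto
      finally show "(1 - x)\<^sup>2 \<le> 1 - x" by simp
    qed
    ultimately have d: "\<bar>sqrt (1 - x) - 1\<bar> \<le> x" by simp
    have "omega r * t - t * r powr \<sigma> = t * r powr \<sigma> * (sqrt (1 - x) - 1)"
      using omega_eq[OF r(1)] by (simp add: x_def algebra_simps)
    then have "norm (omega r * t - t * r powr \<sigma>) = t * r powr \<sigma> * \<bar>sqrt (1 - x) - 1\<bar>"
      using elim by (simp add: abs_mult)
    also have "\<dots> \<le> t * r powr \<sigma> * x" using d elim by (intro mult_left_mono) auto
    also have "\<dots> = (r powr (2 * \<delta>) * t) / 4 * r powr (2 * \<delta> - \<sigma>)"
    proof -
      have "r powr \<sigma> * r powr (4 * \<delta> - 2 * \<sigma>) = r powr (2 * \<delta>) * r powr (2 * \<delta> - \<sigma>)"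
        using r by (simp flip: powr_add)
      then show ?thesis by (simp add: x_def)
    qed
    finally show ?case using rad_damping elim unfolding r_def by simp
  qed
qed

lemma sin_phase: "((\<lambda>t. sin (omega (rad t) * t) - sin (t * rad t powr \<sigma>)) \<longlongrightarrow> 0) at_top"
proof (rule Lim_null_comparison[OF always_eventually[OF allI] tendsto_rabs_zero[OF phase_difference]])
  fix t
  have "\<bar>sin x - sin y\<bar> \<le> \<bar>x - y\<bar>" for x y :: real
  proof -
    have "\<bar>sin x - sin y\<bar> = 2 * \<bar>sin ((x - y) / 2)\<bar> * \<bar>cos ((x + y) / 2)\<bar>"
      unfolding sin_diff_sin by (simp add: abs_mult)
    also have "\<dots> \<le> 2 * \<bar>(x - y) / 2\<bar> * 1"
      by (intro mult_mono mult_left_mono abs_sin_x_le_abs_x) auto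
    finally show ?thesis by simp
  qed
  then show "norm (sin (omega (rad t) * t) - sin (t * rad t powr \<sigma>)) \<le> \<bar>omega (rad t) * t - t * rad t powr \<sigma>\<bar>"
    by simp
qed

lemma cos_phase: "((\<lambda>t. cos (omega (rad t) * t) - cos (t * rad t powr \<sigma>)) \<longlongrightarrow> 0) at_top"
proof (rule Lim_null_comparison[OF always_eventually[OF allI] tendsto_rabs_zero[OF phase_difference]])
  fix t
  have "\<bar>cos x - cos y\<bar> \<le> \<bar>x - y\<bar>" for x y :: real
  proof -
    have "\<bar>cos x - cos y\<bar> = 2 * \<bar>sin ((x + y) / 2)\<bar> * \<bar>sin ((y - x) / 2)\<bar>"
      unfolding cos_diff_cos by (simp add: abs_mult)
    also have "\<dots> \<le> 2 * 1 * \<bar>(y - x) / 2\<bar>"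
      by (intro mult_mono mult_left_mono abs_sin_x_le_abs_x) auto
    finally show ?thesis by simp
  qed
  then show "norm (cos (omega (rad t) * t) - cos (t * rad t powr \<sigma>)) \<le> \<bar>omega (rad t) * t - t * rad t powr \<sigma>\<bar>"
    by simp
qed

lemma tendsto_of_real_0: "((f :: real \<Rightarrow> real) \<longlongrightarrow> 0) F \<Longrightarrow> ((\<lambda>t. complex_of_real (f t)) \<longlongrightarrow> 0) F"
  using tendsto_of_real[of f 0 F] by simp

lemma null_times_bounded:
  fixes f g :: "real \<Rightarrow> complex"
  assumes "(f \<longlongrightarrow> 0) F" "\<And>t. cmod (g t) \<le> B"
  shows "((\<lambda>t. f t * g t) \<longlongrightarrow> 0) F"
  by (rule lim_null_mult_right_bounded[OF assms(1) always_eventually]) (use assms(2) in blast)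

text \<open>After multiplication by \<open>r\<^sup>\<sigma>\<close> the terms with \<open>v0\<close> carry a positive power of \<open>r\<close>; in the term with
  \<open>v1\<close> the frequency may be replaced by \<open>r\<^sup>\<sigma>\<close> both in the amplitude and in the phase.\<close>

lemma lowU_limit:
  fixes v0 v1 :: "real \<Rightarrow> complex" and P :: complex
  assumes v0: "\<And>t. cmod (v0 t) \<le> M" and v1: "(v1 \<longlongrightarrow> P) at_top"
  shows "((\<lambda>t. rad t powr \<sigma> * (lowU (v0 t) (v1 t) (rad t) t
    - P * (exp (- (1 / 2) * t * rad t powr (2 * \<delta>)) * (sin (t * rad t powr \<sigma>) / rad t powr \<sigma>)))) \<longlongrightarrow> 0) at_top"
proof -
  define E where "E = exp (- (\<rho> powr (2 * \<delta>)) / 2)"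
  define S where "S t = complex_of_real (sin (omega (rad t) * t))" for t
  define g where "g t = complex_of_real (rad t powr \<sigma> / omega (rad t))" for t
  have S1: "cmod (S t) \<le> 1" for t by (simp add: S_def)
  have g: "(g \<longlongrightarrow> 1) at_top"
    using tendsto_of_real[OF frequency_ratio, where 'a=complex] unfolding g_def by simp
  define R where "R t = complex_of_real (rad t powr \<sigma>) * (v0 t * cos (omega (rad t) * t))
      + complex_of_real (rad t powr (2 * \<delta>) / 2) * g t * (v0 t * S t)
      + (v1 t * g t - P) * S t + complex_of_real (sin (omega (rad t) * t) - sin (t * rad t powr \<sigma>)) * P" for t
  have v0S: "cmod (v0 t * S t) \<le> M" "cmod (v0 t * cos (omega (rad t) * t)) \<le> M" for t
    using mult_mono[OF v0[of t] S1[of t]] mult_mono[OF v0[of t] abs_cos_le_one[of "omega (rad t) * t"]]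
      order_trans[OF norm_ge_zero v0] by (auto simp: norm_mult)
  have "(R \<longlongrightarrow> 0 + 0 + 0 + 0) at_top"
    unfolding R_def
  proof (intro tendsto_add)
    show "((\<lambda>t. complex_of_real (rad t powr \<sigma>) * (v0 t * cos (omega (rad t) * t))) \<longlongrightarrow> 0) at_top"
      by (rule null_times_bounded[OF tendsto_of_real_0[OF rad_powr_tendsto] v0S(2)]) (use sigma in simp)
    have "((\<lambda>t. complex_of_real (rad t powr (2 * \<delta>) / 2) * g t) \<longlongrightarrow> complex_of_real (0 / 2) * 1) at_top"
      using delta_pos by (intro tendsto_intros rad_powr_tendsto g) auto
    then have "((\<lambda>t. complex_of_real (rad t powr (2 * \<delta>) / 2) * g t) \<longlongrightarrow> 0) at_top" by simp
    then show "((\<lambda>t. complex_of_real (rad t powr (2 * \<delta>) / 2) * g t * (v0 t * S t)) \<longlongrightarrow> 0) at_top"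
      by (rule null_times_bounded[OF _ v0S(1)])
    have "((\<lambda>t. v1 t * g t - P) \<longlongrightarrow> P * 1 - P) at_top" by (intro tendsto_intros v1 g)
    then have "((\<lambda>t. v1 t * g t - P) \<longlongrightarrow> 0) at_top" by simp
    then show "((\<lambda>t. (v1 t * g t - P) * S t) \<longlongrightarrow> 0) at_top" by (rule null_times_bounded[OF _ S1])
    show "((\<lambda>t. complex_of_real (sin (omega (rad t) * t) - sin (t * rad t powr \<sigma>)) * P) \<longlongrightarrow> 0) at_top"
      by (rule null_times_bounded[OF tendsto_of_real_0[OF sin_phase], where B="cmod P"]) simp
  qed
  then have "((\<lambda>t. complex_of_real E * R t) \<longlongrightarrow> complex_of_real E * 0) at_top"
    by (intro tendsto_intros) simp
  then have "((\<lambda>t. complex_of_real E * R t) \<longlongrightarrow> 0) at_top" by simp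
  then show ?thesis
  proof (rule Lim_transform_eventually)
    show "\<forall>\<^sub>F t in at_top. complex_of_real E * R t = rad t powr \<sigma> * (lowU (v0 t) (v1 t) (rad t) t
      - P * (exp (- (1 / 2) * t * rad t powr (2 * \<delta>)) * (sin (t * rad t powr \<sigma>) / rad t powr \<sigma>)))"
      using rad_le_1 eventually_gt_at_top[of 0]
    proof eventually_elim
      case (elim t)
      have E1: "exp (- (rad t powr (2 * \<delta>)) * t / 2) = E"
        unfolding E_def using rad_damping[of t] elim by simp
      have E2: "exp (- (1 / 2) * t * rad t powr (2 * \<delta>)) = E"
        unfolding E_def using rad_damping[of t] elim by (simp add: mult.commute)
      have o: "omega (rad t) \<noteq> 0" "rad t powr \<sigma> \<noteq> 0"
        using omega_facts(2)[of "rad t"] elim by auto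
      show ?case
        unfolding lowU_def E1 E2 R_def S_def g_def using o
        by (simp add: field_simps)
    qed
  qed
qed

text \<open>In the derivative the sine terms carry the factors \<open>r\<^bsup>2\<delta> - \<sigma>\<^esup>\<close> and \<open>r\<^sup>\<sigma>\<close>, which vanish as
  the rescaled frequency tends to zero; the cosine term alone survives.\<close>

lemma lowV_limit:
  fixes v0 v1 :: "real \<Rightarrow> complex" and P :: complex
  assumes v0: "\<And>t. cmod (v0 t) \<le> M" and v1: "(v1 \<longlongrightarrow> P) at_top" and v1b: "\<And>t. cmod (v1 t) \<le> M"
  shows "((\<lambda>t. lowV (v0 t) (v1 t) (rad t) t
    - P * (exp (- (1 / 2) * t * rad t powr (2 * \<delta>)) * cos (t * rad t powr \<sigma>))) \<longlongrightarrow> 0) at_top"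
proof -
  define E where "E = exp (- (\<rho> powr (2 * \<delta>)) / 2)"
  define S where "S t = complex_of_real (sin (omega (rad t) * t))" for t
  define Cc where "Cc t = complex_of_real (cos (omega (rad t) * t))" for t
  define g where "g t = complex_of_real (rad t powr \<sigma> / omega (rad t))" for t
  have S1: "cmod (S t) \<le> 1" "cmod (Cc t) \<le> 1" for t by (simp_all add: S_def Cc_def)
  have g: "(g \<longlongrightarrow> 1) at_top"
    using tendsto_of_real[OF frequency_ratio, where 'a=complex] unfolding g_def by simp
  define R where "R t = (v1 t - P) * Cc t + complex_of_real (cos (omega (rad t) * t) - cos (t * rad t powr \<sigma>)) * P
      - complex_of_real (rad t powr (2 * \<delta> - \<sigma>) / 2) * g t * (v1 t * S t)
      - complex_of_real (rad t powr \<sigma>) * g t * (v0 t * S t)" for t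
  have v0S: "cmod (v0 t * S t) \<le> M" "cmod (v1 t * S t) \<le> M" for t
    using mult_mono[OF v0[of t] S1(1)[of t]] mult_mono[OF v1b[of t] S1(1)[of t]]
      order_trans[OF norm_ge_zero v0] by (auto simp: norm_mult)
  have "(R \<longlongrightarrow> 0 + 0 - 0 - 0) at_top"
    unfolding R_def
  proof (intro tendsto_add tendsto_diff)
    have "((\<lambda>t. v1 t - P) \<longlongrightarrow> P - P) at_top" by (intro tendsto_intros v1)
    then have "((\<lambda>t. v1 t - P) \<longlongrightarrow> 0) at_top" by simp
    then show "((\<lambda>t. (v1 t - P) * Cc t) \<longlongrightarrow> 0) at_top" by (rule null_times_bounded[OF _ S1(2)])
    show "((\<lambda>t. complex_of_real (cos (omega (rad t) * t) - cos (t * rad t powr \<sigma>)) * P) \<longlongrightarrow> 0) at_top"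
      by (rule null_times_bounded[OF tendsto_of_real_0[OF cos_phase], where B="cmod P"]) simp
    have "((\<lambda>t. complex_of_real (rad t powr (2 * \<delta> - \<sigma>) / 2) * g t) \<longlongrightarrow> complex_of_real (0 / 2) * 1) at_top"
      using delta by (intro tendsto_intros rad_powr_tendsto g) auto
    then have "((\<lambda>t. complex_of_real (rad t powr (2 * \<delta> - \<sigma>) / 2) * g t) \<longlongrightarrow> 0) at_top" by simp
    then show "((\<lambda>t. complex_of_real (rad t powr (2 * \<delta> - \<sigma>) / 2) * g t * (v1 t * S t)) \<longlongrightarrow> 0) at_top"
      by (rule null_times_bounded[OF _ v0S(2)])
    have "((\<lambda>t. complex_of_real (rad t powr \<sigma>) * g t) \<longlongrightarrow> complex_of_real 0 * 1) at_top"
      using sigma by (intro tendsto_intros rad_powr_tendsto g) auto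
    then have "((\<lambda>t. complex_of_real (rad t powr \<sigma>) * g t) \<longlongrightarrow> 0) at_top" by simp
    then show "((\<lambda>t. complex_of_real (rad t powr \<sigma>) * g t * (v0 t * S t)) \<longlongrightarrow> 0) at_top"
      by (rule null_times_bounded[OF _ v0S(1)])
  qed
  then have "((\<lambda>t. complex_of_real E * R t) \<longlongrightarrow> complex_of_real E * 0) at_top"
    by (intro tendsto_intros) simp
  then have "((\<lambda>t. complex_of_real E * R t) \<longlongrightarrow> 0) at_top" by simp
  then show ?thesis
  proof (rule Lim_transform_eventually)
    show "\<forall>\<^sub>F t in at_top. complex_of_real E * R t = lowV (v0 t) (v1 t) (rad t) t
      - P * (exp (- (1 / 2) * t * rad t powr (2 * \<delta>)) * cos (t * rad t powr \<sigma>))"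
      using rad_le_1 eventually_gt_at_top[of 0]
    proof eventually_elim
      case (elim t)
      have E1: "exp (- (rad t powr (2 * \<delta>)) * t / 2) = E"
        unfolding E_def using rad_damping[of t] elim by simp
      have E2: "exp (- (1 / 2) * t * rad t powr (2 * \<delta>)) = E"
        unfolding E_def using rad_damping[of t] elim by (simp add: mult.commute)
      have o: "omega (rad t) \<noteq> 0" using omega_facts(2)[of "rad t"] elim by auto
      have p: "rad t powr (2 * \<delta>) = rad t powr (2 * \<delta> - \<sigma>) * rad t powr \<sigma>"
        "rad t powr (2 * \<sigma>) = rad t powr \<sigma> * rad t powr \<sigma>"
        using elim by (simp_all flip: powr_add)
      show ?case
        unfolding lowV_def E1 E2 unfolding R_def S_def Cc_def g_def p using o
        by (simp add: field_simps)
    qed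
  qed
qed

end

end

section \<open>Oscillating multipliers\<close>

lemma nn_integral_lborel_scale:
  fixes f :: "'a::euclidean_space \<Rightarrow> ennreal"
  assumes "c > 0" and [measurable]: "f \<in> borel_measurable borel"
  shows "(\<integral>\<^sup>+x. f x \<partial>lborel) = ennreal (c ^ DIM('a)) * (\<integral>\<^sup>+x. f (c *\<^sub>R x) \<partial>lborel)"
  using assms(1)
  by (subst lborel_affine[of c 0]) (simp_all add: nn_integral_density nn_integral_distr nn_integral_cmult)

lemma nn_integral_cos_square:
  assumes "M \<ge> 2"
  shows "ennreal (1/4) \<le> (\<integral>\<^sup>+\<tau>. ennreal ((cos (M * (1 + \<tau>) + \<phi>))\<^sup>2) * indicator {0..1} \<tau> \<partial>lborel)"
proof -
  define F where "F \<tau> = \<tau> / 2 + sin (2 * (M * (1 + \<tau>) + \<phi>)) / (4 * M)" for \<tau>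
  have "(\<integral>\<^sup>+\<tau>. ennreal ((cos (M * (1 + \<tau>) + \<phi>))\<^sup>2) * indicator {0..1} \<tau> \<partial>lborel) = ennreal (F 1 - F 0)"
  proof (rule nn_integral_FTC_Icc)
    fix \<tau> :: real
    have "(F has_real_derivative 1 / 2 + cos (2 * (M * (1 + \<tau>) + \<phi>)) * (2 * M) / (4 * M)) (at \<tau>)"
      unfolding F_def using assms by (auto intro!: derivative_eq_intros)
    moreover have "1 / 2 + cos (2 * (M * (1 + \<tau>) + \<phi>)) * (2 * M) / (4 * M) = (cos (M * (1 + \<tau>) + \<phi>))\<^sup>2"
      unfolding cos_double_cos using assms by (simp add: field_simps)
    ultimately show "(F has_real_derivative (cos (M * (1 + \<tau>) + \<phi>))\<^sup>2) (at \<tau>)" by simp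
  qed auto
  moreover have "1 / 4 \<le> F 1 - F 0"
  proof -
    define x y where "x = sin (2 * (M * (1 + 1) + \<phi>))" and "y = sin (2 * (M * (1 + 0) + \<phi>))"
    have "- 1 \<le> x" "y \<le> 1" by (auto simp: x_def y_def)
    then have "- 2 \<le> x - y" by simp
    then have "- 2 / (4 * M) \<le> (x - y) / (4 * M)" using assms by (intro divide_right_mono) auto
    moreover have "2 / (4 * M) \<le> 1 / 4" using assms by (simp add: field_simps)
    ultimately have "- 1 / 4 \<le> (x - y) / (4 * M)" by simp
    moreover have "F 1 - F 0 = 1 / 2 + (x - y) / (4 * M)"
      by (simp add: F_def x_def y_def diff_divide_distrib)
    ultimately show ?thesis by linarith
  qed
  ultimately show ?thesis by (simp add: ennreal_leI)
qed

text \<open>On a shell the mean of \<open>cos\<^sup>2 (T |\<eta>|\<^sup>\<sigma> + \<phi>)\<close> stays away from 0 as \<open>T \<rightarrow> \<infinity>\<close>. Dilating a ball inside the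
  shell by the factors \<open>(1 + \<tau>)\<^bsup>1/\<sigma>\<^esup>\<close>, \<open>0 \<le> \<tau> \<le> 1\<close>, stays in the shell and replaces \<open>T\<close> by \<open>T (1 + \<tau>)\<close>, so
  the mean over \<open>\<tau>\<close> of these integrals is a lower bound, and by Fubini's theorem it is governed by
  the means of \<open>cos\<^sup>2\<close> over long intervals.\<close>

lemma oscillation_lower_bound:
  fixes \<sigma> \<phi> :: real
  assumes \<sigma>: "\<sigma> \<ge> 1"
  obtains c where "c > 0"
    "\<And>T. T \<ge> 2 \<Longrightarrow> ennreal c \<le> (\<integral>\<^sup>+\<eta>. ennreal (indicator {1..4} (norm (\<eta>::'a::euclidean_space)) *
        (cos (T * norm \<eta> powr \<sigma> + \<phi>))\<^sup>2) \<partial>lborel)"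
proof -
  obtain b :: 'a where b: "b \<in> Basis" using nonempty_Basis by blast
  define B where "B = ball ((3/2) *\<^sub>R b) (1/2)"
  have nb: "norm ((3/2) *\<^sub>R b) = 3/2" using b by simp
  have B: "1 \<le> norm \<eta> \<and> norm \<eta> \<le> 2" if "\<eta> \<in> B" for \<eta>
  proof -
    have "norm ((3/2) *\<^sub>R b - \<eta>) < 1/2" using that by (simp add: B_def dist_norm)
    then show ?thesis
      using nb norm_triangle_ineq2[of "(3/2) *\<^sub>R b" \<eta>] norm_triangle_ineq2[of \<eta> "(3/2) *\<^sub>R b"]
        norm_minus_commute[of \<eta> "(3/2) *\<^sub>R b"] by linarith
  qed
  have [measurable]: "B \<in> sets borel" unfolding B_def by simp
  define v where "v = measure lborel B"
  have v: "v > 0" unfolding v_def B_def by (rule content_ball_pos) simp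
  have ev: "emeasure lborel B = ennreal v"
    unfolding v_def B_def
    by (rule emeasure_eq_ennreal_measure)
       (rule less_imp_neq[OF emeasure_lborel_ball_finite[unfolded infinity_ennreal_def]])
  show thesis
  proof (rule that[of "1/4 * v"])
    show "1/4 * v > 0" using v by simp
    fix T :: real assume T: "T \<ge> 2"
    define f where "f \<eta> = ennreal (indicator {1..4} (norm \<eta>) * (cos (T * norm \<eta> powr \<sigma> + \<phi>))\<^sup>2)" for \<eta> :: 'a
    have [measurable]: "f \<in> borel_measurable borel" unfolding f_def by measurable
    define A where "A = (\<integral>\<^sup>+\<eta>. f \<eta> \<partial>lborel)"
    define g where "g \<tau> \<eta> = indicator B \<eta> * ennreal ((cos (T * norm \<eta> powr \<sigma> * (1 + \<tau>) + \<phi>))\<^sup>2)" for \<tau> and \<eta> :: 'a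
    have gle: "(\<integral>\<^sup>+\<eta>. g \<tau> \<eta> \<partial>lborel) \<le> A" if \<tau>: "\<tau> \<in> {0..1}" for \<tau>
    proof -
      define l where "l = (1 + \<tau>) powr (1 / \<sigma>)"
      have ls: "l powr \<sigma> = 1 + \<tau>" using \<tau> \<sigma> by (simp add: l_def powr_powr)
      have l1: "l \<ge> 1" unfolding l_def using \<tau> \<sigma> by (intro ge_one_powr_ge_zero) auto
      have "l \<le> (1 + \<tau>) powr 1" unfolding l_def using \<tau> \<sigma> by (intro powr_mono) auto
      then have l2: "l \<le> 2" using \<tau> by simp
      have "g \<tau> \<eta> \<le> f (l *\<^sub>R \<eta>)" for \<eta>
      proof (cases "\<eta> \<in> B")
        case True
        then have n: "1 \<le> norm \<eta>" "norm \<eta> \<le> 2" using B by auto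
        have "1 * 1 \<le> l * norm \<eta>" "l * norm \<eta> \<le> 2 * 2" using n l1 l2 by (intro mult_mono; simp)+
        moreover have "(l * norm \<eta>) powr \<sigma> = norm \<eta> powr \<sigma> * (1 + \<tau>)"
          using l1 ls by (simp add: powr_mult mult.commute)
        ultimately show ?thesis using True l1 by (simp add: g_def f_def mult.assoc)
      qed (simp add: g_def)
      then have "(\<integral>\<^sup>+\<eta>. g \<tau> \<eta> \<partial>lborel) \<le> (\<integral>\<^sup>+\<eta>. f (l *\<^sub>R \<eta>) \<partial>lborel)" by (rule nn_integral_mono)
      also have "\<dots> = 1 * \<dots>" by simp
      also have "\<dots> \<le> ennreal (l ^ DIM('a)) * (\<integral>\<^sup>+\<eta>. f (l *\<^sub>R \<eta>) \<partial>lborel)"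
        using l1 by (intro mult_right_mono) (auto simp flip: ennreal_1 intro!: ennreal_leI)
      also have "\<dots> = A" unfolding A_def using l1 by (intro nn_integral_lborel_scale[symmetric]) auto
      finally show ?thesis .
    qed
    have [measurable]: "(\<lambda>(\<tau>, \<eta>). g \<tau> \<eta>) \<in> borel_measurable (lborel \<Otimes>\<^sub>M lborel)"
      unfolding g_def by measurable
    have "ennreal (1/4 * v) = (\<integral>\<^sup>+\<eta>. ennreal (1/4) * indicator B \<eta> \<partial>lborel)"
      using v by (subst nn_integral_cmult_indicator) (auto simp: ev ennreal_mult[symmetric])
    also have "\<dots> \<le> (\<integral>\<^sup>+\<eta>. (\<integral>\<^sup>+\<tau>. g \<tau> \<eta> * indicator {0..1} \<tau> \<partial>lborel) \<partial>lborel)"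
    proof (rule nn_integral_mono)
      fix \<eta> :: 'a
      show "ennreal (1/4) * indicator B \<eta> \<le> (\<integral>\<^sup>+\<tau>. g \<tau> \<eta> * indicator {0..1} \<tau> \<partial>lborel)"
      proof (cases "\<eta> \<in> B")
        case True
        then have "1 \<le> norm \<eta> powr \<sigma>" using B[of \<eta>] \<sigma> by (intro ge_one_powr_ge_zero) auto
        then have "2 * 1 \<le> T * norm \<eta> powr \<sigma>" using T by (intro mult_mono) auto
        then have "ennreal (1/4) \<le> (\<integral>\<^sup>+\<tau>. ennreal ((cos (T * norm \<eta> powr \<sigma> * (1 + \<tau>) + \<phi>))\<^sup>2) * indicator {0..1} \<tau> \<partial>lborel)"
          by (intro nn_integral_cos_square) simp
        then show ?thesis using True by (simp add: g_def)
      qed simp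
    qed
    also have "\<dots> = (\<integral>\<^sup>+\<tau>. (\<integral>\<^sup>+\<eta>. g \<tau> \<eta> * indicator {0..1} \<tau> \<partial>lborel) \<partial>lborel)"
      by (rule lborel_pair.Fubini') measurable
    also have "\<dots> \<le> (\<integral>\<^sup>+\<tau>. A * indicator {0..1} (\<tau>::real) \<partial>lborel)"
    proof (rule nn_integral_mono)
      fix \<tau> :: real
      show "(\<integral>\<^sup>+\<eta>. g \<tau> \<eta> * indicator {0..1} \<tau> \<partial>lborel) \<le> A * indicator {0..1} \<tau>"
        using gle[of \<tau>] by (auto simp: indicator_def)
    qed
    also have "\<dots> = A" by (subst nn_integral_cmult_indicator) auto
    finally show "ennreal (1/4 * v) \<le> (\<integral>\<^sup>+\<eta>. ennreal (indicator {1..4} (norm (\<eta>::'a)) *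
        (cos (T * norm \<eta> powr \<sigma> + \<phi>))\<^sup>2) \<partial>lborel)"
      unfolding A_def f_def .
  qed
qed

context damped_wave begin

text \<open>The two profiles, weighted by a power of \<open>|\<xi>|\<close>: the phase \<open>\<phi> = - \<pi>/2\<close> turns the cosine into a sine.\<close>

definition profile :: "real \<Rightarrow> real \<Rightarrow> real \<Rightarrow> 'a::euclidean_space \<Rightarrow> complex" where
  "profile \<kappa> \<phi> t \<xi> = complex_of_real (norm \<xi> powr \<kappa> * exp (- (1 / 2) * t * norm \<xi> powr (2 * \<delta>))
     * cos (t * norm \<xi> powr \<sigma> + \<phi>))"

lemma profile_measurable [measurable]: "profile \<kappa> \<phi> t \<in> borel_measurable borel"
  unfolding profile_def by measurable

lemma profile_L2:
  assumes "2 * \<kappa> > - real DIM('a)" "t > 0"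
  shows "(profile \<kappa> \<phi> t :: 'a::euclidean_space \<Rightarrow> complex) \<in> L2"
proof (rule L2_I_lborel)
  show "integrable lborel (\<lambda>\<xi>::'a. norm \<xi> powr (2 * \<kappa>) * exp (- t * norm \<xi> powr (2 * \<delta>)))"
    using assms sigma delta by (intro integrable_powr_exp) auto
  fix \<xi> :: 'a
  have "(cmod (profile \<kappa> \<phi> t \<xi>))\<^sup>2
      = norm \<xi> powr (2 * \<kappa>) * exp (- t * norm \<xi> powr (2 * \<delta>)) * (cos (t * norm \<xi> powr \<sigma> + \<phi>))\<^sup>2"
  proof -
    have "(norm \<xi> powr \<kappa>)\<^sup>2 = norm \<xi> powr (2 * \<kappa>)"
      by (simp add: power2_eq_square flip: powr_add)
    moreover have "(exp (- (1 / 2) * t * norm \<xi> powr (2 * \<delta>)))\<^sup>2 = exp (- t * norm \<xi> powr (2 * \<delta>))"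
      by (simp add: power2_eq_square flip: exp_add)
    ultimately show ?thesis unfolding profile_def norm_of_real power2_abs power_mult_distrib by simp
  qed
  also have "\<dots> \<le> norm \<xi> powr (2 * \<kappa>) * exp (- t * norm \<xi> powr (2 * \<delta>)) * 1"
    by (intro mult_left_mono) (auto simp: abs_square_le_1)
  finally show "(cmod (profile \<kappa> \<phi> t \<xi>))\<^sup>2 \<le> norm \<xi> powr (2 * \<kappa>) * exp (- t * norm \<xi> powr (2 * \<delta>))" by simp
qed simp

text \<open>Scaling turns the squared norm into the integral of \<open>|\<eta>|\<^bsup>2\<kappa>\<^esup> exp (- |\<eta>|\<^bsup>2\<delta>\<^esup>)\<close> against
  \<open>cos\<^sup>2 (T |\<eta>|\<^sup>\<sigma> + \<phi>)\<close> with \<open>T = t\<^bsup>1 - \<sigma>/(2\<delta>)\<^esup>\<close>, and \<open>T \<rightarrow> \<infinity>\<close> because \<open>2 \<delta> > \<sigma>\<close>.\<close>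

lemma profile_norm_bounds:
  assumes \<kappa>: "2 * \<kappa> > - real DIM('a)"
  obtains c C where "c > 0" "C > 0"
    "\<forall>\<^sub>F t in at_top. c * t powr (- (\<kappa> / (2 * \<delta>)) - real DIM('a) / (4 * \<delta>))
        \<le> L2_norm (profile \<kappa> \<phi> t :: 'a::euclidean_space \<Rightarrow> complex) \<and>
      L2_norm (profile \<kappa> \<phi> t :: 'a \<Rightarrow> complex) \<le> C * t powr (- (\<kappa> / (2 * \<delta>)) - real DIM('a) / (4 * \<delta>))"
proof -
  define k where "k = 1 / (2 * \<delta>)"
  have d: "\<delta> > 0" using sigma delta by linarith
  define w where "w \<eta> = norm \<eta> powr (2 * \<kappa>) * exp (- 1 * norm \<eta> powr (2 * \<delta>))" for \<eta> :: 'a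
  have w: "integrable lborel w"
    unfolding w_def using \<kappa> sigma delta by (intro integrable_powr_exp) auto
  have w0: "w \<eta> \<ge> 0" for \<eta> by (simp add: w_def)
  have [measurable]: "w \<in> borel_measurable borel" unfolding w_def by measurable
  define J where "J t = (\<integral>\<eta>. w \<eta> * (cos (t powr (1 - k * \<sigma>) * norm \<eta> powr \<sigma> + \<phi>))\<^sup>2 \<partial>(lborel :: 'a measure))" for t
  have L: "L2_norm (profile \<kappa> \<phi> t :: 'a \<Rightarrow> complex) = t powr (- (\<kappa> / (2 * \<delta>)) - real DIM('a) / (4 * \<delta>)) * sqrt (J t)"
    if t: "t > 0" for t
  proof -
    have "(t powr (k * \<kappa>) * cmod (profile \<kappa> \<phi> t ((t powr (- k)) *\<^sub>R \<eta>)))\<^sup>2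
        = w \<eta> * (cos (t powr (1 - k * \<sigma>) * norm \<eta> powr \<sigma> + \<phi>))\<^sup>2" for \<eta> :: 'a
    proof -
      have n: "norm ((t powr (- k)) *\<^sub>R \<eta>) = t powr (- k) * norm \<eta>" by simp
      have p: "(t powr (- k) * norm \<eta>) powr e = t powr (- k * e) * norm \<eta> powr e" for e
        by (simp add: powr_mult powr_powr)
      have 1: "t * (t powr (- k) * norm \<eta>) powr (2 * \<delta>) = norm \<eta> powr (2 * \<delta>)"
        unfolding p using t d by (simp add: k_def powr_minus)
      have 2: "t * (t powr (- k) * norm \<eta>) powr \<sigma> = t powr (1 - k * \<sigma>) * norm \<eta> powr \<sigma>"
        unfolding p using t by (simp add: powr_diff powr_minus field_simps)
      have 3: "t powr (k * \<kappa>) * (t powr (- k) * norm \<eta>) powr \<kappa> = norm \<eta> powr \<kappa>"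
        unfolding p using t by (simp add: mult.assoc[symmetric] flip: powr_add)
      have e: "- (1/2) * t * (t powr (- k) * norm \<eta>) powr (2 * \<delta>) = - (1/2) * norm \<eta> powr (2 * \<delta>)"
        using 1 by (simp add: mult.assoc)
      have "t powr (k * \<kappa>) * cmod (profile \<kappa> \<phi> t ((t powr (- k)) *\<^sub>R \<eta>))
        = norm \<eta> powr \<kappa> * exp (- (1/2) * norm \<eta> powr (2 * \<delta>)) * \<bar>cos (t powr (1 - k * \<sigma>) * norm \<eta> powr \<sigma> + \<phi>)\<bar>"
        unfolding profile_def n e 2 norm_of_real abs_mult 3[symmetric] by simp
      moreover have "(norm \<eta> powr \<kappa>)\<^sup>2 = norm \<eta> powr (2 * \<kappa>)"
        by (simp add: power2_eq_square flip: powr_add)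
      moreover have "(exp (- (1 / 2) * norm \<eta> powr (2 * \<delta>)))\<^sup>2 = exp (- 1 * norm \<eta> powr (2 * \<delta>))"
        by (simp add: power2_eq_square flip: exp_add)
      ultimately show ?thesis by (simp only: power_mult_distrib power2_abs w_def)
    qed
    moreover have "L2_norm (profile \<kappa> \<phi> t :: 'a \<Rightarrow> complex) = t powr (- (k * \<kappa>) - k * DIM('a) / 2) *
        sqrt (\<integral>\<eta>. (t powr (k * \<kappa>) * cmod (profile \<kappa> \<phi> t ((t powr (- k)) *\<^sub>R (\<eta> :: 'a))))\<^sup>2 \<partial>lborel)"
      by (rule scaled_L2_norm[OF profile_measurable t])
    ultimately have "L2_norm (profile \<kappa> \<phi> t :: 'a \<Rightarrow> complex) = t powr (- (k * \<kappa>) - k * DIM('a) / 2) * sqrt (J t)"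
      unfolding J_def by simp
    then show ?thesis by (simp add: k_def)
  qed
  obtain c0 where c0: "c0 > 0"
    "\<And>T. T \<ge> 2 \<Longrightarrow> ennreal c0 \<le> (\<integral>\<^sup>+\<eta>. ennreal (indicator {1..4} (norm (\<eta>::'a)) * (cos (T * norm \<eta> powr \<sigma> + \<phi>))\<^sup>2) \<partial>lborel)"
    using oscillation_lower_bound[OF sigma] by blast
  define c1 where "c1 = 4 powr (- \<bar>2 * \<kappa>\<bar>) * exp (- (4 powr (2 * \<delta>)))"
  have c1: "c1 > 0" by (simp add: c1_def)
  have wc: "c1 * indicator {1..4} (norm \<eta>) \<le> w \<eta>" for \<eta>
  proof (cases "norm \<eta> \<in> {1..4}")
    case True
    then have n: "1 \<le> norm \<eta>" "norm \<eta> \<le> 4" by auto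
    have "4 powr (- \<bar>2 * \<kappa>\<bar>) \<le> norm \<eta> powr (- \<bar>2 * \<kappa>\<bar>)"
      using n by (intro powr_mono2') auto
    also have "\<dots> \<le> norm \<eta> powr (2 * \<kappa>)" using n by (intro powr_mono) auto
    finally have "4 powr (- \<bar>2 * \<kappa>\<bar>) \<le> norm \<eta> powr (2 * \<kappa>)" .
    moreover have "norm \<eta> powr (2 * \<delta>) \<le> 4 powr (2 * \<delta>)" using n d by (intro powr_mono2) auto
    ultimately show ?thesis using True unfolding c1_def w_def by (simp add: mult_mono)
  qed (simp add: w0)
  have Jint: "integrable lborel (\<lambda>\<eta>::'a. w \<eta> * (cos (t powr (1 - k * \<sigma>) * norm \<eta> powr \<sigma> + \<phi>))\<^sup>2)" for t
    by (rule Bochner_Integration.integrable_bound[OF w])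
      (use w0 in \<open>auto simp: abs_mult abs_square_le_1 intro!: mult_left_le\<close>)
  have Jupper: "J t \<le> integral\<^sup>L lborel w" for t
    unfolding J_def using w0
    by (intro integral_mono Jint w) (auto simp: abs_square_le_1 intro!: mult_left_le)
  have Jlower: "c1 * c0 \<le> J t" if T: "t powr (1 - k * \<sigma>) \<ge> 2" for t
  proof -
    have "ennreal (c1 * c0) = ennreal c1 * ennreal c0" using c0 c1 by (simp add: ennreal_mult)
    also have "\<dots> \<le> ennreal c1 * (\<integral>\<^sup>+\<eta>. ennreal (indicator {1..4} (norm (\<eta>::'a)) * (cos (t powr (1 - k * \<sigma>) * norm \<eta> powr \<sigma> + \<phi>))\<^sup>2) \<partial>lborel)"
      by (intro mult_left_mono c0(2) T) simp
    also have "\<dots> = (\<integral>\<^sup>+\<eta>. ennreal c1 * ennreal (indicator {1..4} (norm (\<eta>::'a)) * (cos (t powr (1 - k * \<sigma>) * norm \<eta> powr \<sigma> + \<phi>))\<^sup>2) \<partial>lborel)"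
      by (rule nn_integral_cmult[symmetric]) measurable
    also have "\<dots> \<le> (\<integral>\<^sup>+\<eta>. ennreal (w \<eta> * (cos (t powr (1 - k * \<sigma>) * norm \<eta> powr \<sigma> + \<phi>))\<^sup>2) \<partial>lborel)"
    proof (rule nn_integral_mono)
      fix \<eta> :: 'a
      show "ennreal c1 * ennreal (indicator {1..4} (norm \<eta>) * (cos (t powr (1 - k * \<sigma>) * norm \<eta> powr \<sigma> + \<phi>))\<^sup>2)
          \<le> ennreal (w \<eta> * (cos (t powr (1 - k * \<sigma>) * norm \<eta> powr \<sigma> + \<phi>))\<^sup>2)"
        using c1 mult_right_mono[OF wc[of \<eta>], of "(cos (t powr (1 - k * \<sigma>) * norm \<eta> powr \<sigma> + \<phi>))\<^sup>2"]
        by (subst ennreal_mult[symmetric]) (auto intro!: ennreal_leI simp: mult.assoc)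
    qed
    also have "\<dots> = ennreal (J t)"
      unfolding J_def by (rule nn_integral_eq_integral[OF Jint]) (simp add: w0)
    finally show ?thesis
      using ennreal_le_iff[of "J t" "c1 * c0"] unfolding J_def by (simp add: w0)
  qed
  define c C where "c = sqrt (c1 * c0)" and "C = sqrt (integral\<^sup>L lborel w + 1)"
  have iw: "integral\<^sup>L lborel w \<ge> 0" by (simp add: w0)
  show thesis
  proof (rule that[of c C])
    show "c > 0" "C > 0" using c0 c1 iw by (auto simp: c_def C_def)
    have e: "1 - k * \<sigma> > 0" unfolding k_def using delta d by (simp add: field_simps)
    have "\<forall>\<^sub>F t in at_top. t powr (1 - k * \<sigma>) \<ge> 2"
      using eventually_ge_at_top[of "2 powr (1 / (1 - k * \<sigma>))"]
    proof eventually_elim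
      case (elim t)
      have "(2::real) = (2 powr (1 / (1 - k * \<sigma>))) powr (1 - k * \<sigma>)" using e by (simp add: powr_powr)
      also have "\<dots> \<le> t powr (1 - k * \<sigma>)" using elim e by (intro powr_mono2) auto
      finally show ?case .
    qed
    with eventually_gt_at_top[of 0]
    show "\<forall>\<^sub>F t in at_top. c * t powr (- (\<kappa> / (2 * \<delta>)) - real DIM('a) / (4 * \<delta>))
        \<le> L2_norm (profile \<kappa> \<phi> t :: 'a::euclidean_space \<Rightarrow> complex) \<and>
      L2_norm (profile \<kappa> \<phi> t :: 'a \<Rightarrow> complex) \<le> C * t powr (- (\<kappa> / (2 * \<delta>)) - real DIM('a) / (4 * \<delta>))"
    proof eventually_elim
      case (elim t)
      have "c \<le> sqrt (J t)" unfolding c_def using Jlower[OF elim(2)] by simp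
      moreover have "sqrt (J t) \<le> C" unfolding C_def using Jupper[of t] by simp
      ultimately show ?case
        unfolding L[OF elim(1)]
        by (auto intro!: mult_left_mono simp: mult.commute[of _ "t powr _"])
    qed
  qed
qed

end

section \<open>Multipliers and time derivatives\<close>

lemma weight_times_L2:
  fixes g :: "'a::euclidean_space \<Rightarrow> complex"
  assumes "h \<in> borel_measurable borel" "g \<in> borel_measurable lebesgue"
  shows "(\<lambda>\<xi>. complex_of_real (h \<xi>) * g \<xi>) \<in> borel_measurable lebesgue"
proof -
  have "(\<lambda>\<xi>. complex_of_real (h \<xi>)) \<in> borel_measurable lebesgue"
    by (rule measurable_completion) (use assms(1) in simp)
  then show ?thesis using assms(2) by (rule borel_measurable_times)
qed

lemma L2_cmod: "f \<in> L2 \<Longrightarrow> (\<lambda>x. complex_of_real (cmod (f x))) \<in> L2"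
  by (rule L2_I_dominated[where C=1 and g=f]) (auto dest!: L2_measurable)

lemma bessel_weight_le:
  fixes r s :: real
  assumes "r \<ge> 0" "s \<ge> 0"
  shows "(1 + r\<^sup>2) powr (s / 2) \<le> 2 powr (s / 2) * (1 + r powr s)"
proof (cases "r \<le> 1")
  case True
  then have "r\<^sup>2 \<le> 1" using assms(1) by (intro power_le_one)
  then have "(1 + r\<^sup>2) powr (s / 2) \<le> 2 powr (s / 2)" using assms by (intro powr_mono2) auto
  also have "\<dots> \<le> 2 powr (s / 2) * (1 + r powr s)" by (simp add: algebra_simps)
  finally show ?thesis .
next
  case False
  then have r: "r > 1" by simp
  then have "1 \<le> r\<^sup>2" by (simp add: one_le_power)
  then have "(1 + r\<^sup>2) powr (s / 2) \<le> (2 * r\<^sup>2) powr (s / 2)" using assms by (intro powr_mono2) auto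
  also have "\<dots> = 2 powr (s / 2) * r powr s"
  proof -
    have "r\<^sup>2 = r powr 2" using r by simp
    then have "(r\<^sup>2) powr (s / 2) = r powr (2 * (s / 2))" by (simp only: powr_powr)
    then show ?thesis using r by (simp add: powr_mult)
  qed
  also have "\<dots> \<le> 2 powr (s / 2) * (1 + r powr s)" by (simp add: algebra_simps)
  finally show ?thesis .
qed

lemma sobolev_I:
  fixes w :: "'a::euclidean_space \<Rightarrow> complex"
  assumes wg: "has_fourier w g" and s: "s \<ge> 0"
    and sg: "(\<lambda>\<xi>. complex_of_real (norm \<xi> powr s) * g \<xi>) \<in> L2"
  shows "w \<in> sobolev s"
proof -
  note L2 = has_fourier_L2[OF wg]
  have ae: "AE \<xi> in lebesgue. fourier w \<xi> = g \<xi>" by (rule fourier_AE_eq[OF wg])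
  have fm: "fourier w \<in> borel_measurable lebesgue"
    using has_fourier_L2(2)[OF has_fourier_fourier[OF L2(1)]] by (rule L2_measurable)
  define h where "h \<xi> = complex_of_real (cmod (g \<xi>)) + complex_of_real (cmod (complex_of_real (norm \<xi> powr s) * g \<xi>))" for \<xi>
  have h: "h \<in> L2" unfolding h_def by (intro L2_add L2_cmod L2 sg)
  have "(\<lambda>\<xi>. complex_of_real ((1 + (norm \<xi>)\<^sup>2) powr (s / 2)) * fourier w \<xi>) \<in> L2"
  proof (rule L2_I_dominated[OF _ h])
    show "(\<lambda>\<xi>. complex_of_real ((1 + (norm \<xi>)\<^sup>2) powr (s / 2)) * fourier w \<xi>) \<in> borel_measurable lebesgue"
      by (rule weight_times_L2[OF _ fm]) measurable
    show "AE \<xi> in lebesgue. cmod (complex_of_real ((1 + (norm \<xi>)\<^sup>2) powr (s / 2)) * fourier w \<xi>) \<le> 2 powr (s / 2) * cmod (h \<xi>)"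
      using ae
    proof eventually_elim
      case (elim \<xi>)
      have "h \<xi> = complex_of_real ((1 + norm \<xi> powr s) * cmod (g \<xi>))"
        by (simp add: h_def norm_mult algebra_simps)
      then have "cmod (h \<xi>) = (1 + norm \<xi> powr s) * cmod (g \<xi>)"
        by (simp only: norm_of_real) (simp add: abs_mult)
      moreover have "cmod (complex_of_real ((1 + (norm \<xi>)\<^sup>2) powr (s / 2)) * fourier w \<xi>)
          = (1 + (norm \<xi>)\<^sup>2) powr (s / 2) * cmod (g \<xi>)"
        using elim by (simp add: norm_mult)
      moreover have "\<dots> \<le> (2 powr (s / 2) * (1 + norm \<xi> powr s)) * cmod (g \<xi>)"
        by (intro mult_right_mono bessel_weight_le s) auto
      ultimately show ?case by (simp add: mult.assoc)
    qed
  qed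
  then show ?thesis unfolding sobolev_def using L2 by simp
qed

lemma abs_D_has_fourier:
  fixes w :: "'a::euclidean_space \<Rightarrow> complex"
  assumes wg: "has_fourier w g" and sg: "(\<lambda>\<xi>. complex_of_real (norm \<xi> powr s) * g \<xi>) \<in> L2"
  shows "has_fourier (abs_D s w) (\<lambda>\<xi>. complex_of_real (norm \<xi> powr s) * g \<xi>)"
proof -
  note L2 = has_fourier_L2[OF wg]
  have ae: "AE \<xi> in lebesgue. complex_of_real (norm \<xi> powr s) * g \<xi> = complex_of_real (norm \<xi> powr s) * fourier w \<xi>"
    using fourier_AE_eq[OF wg] by eventually_elim simp
  have "fourier w \<in> borel_measurable lebesgue"
    using has_fourier_L2(2)[OF has_fourier_fourier[OF L2(1)]] by (rule L2_measurable)
  then have m: "(\<lambda>\<xi>. complex_of_real (norm \<xi> powr s) * fourier w \<xi>) \<in> borel_measurable lebesgue"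
    by (rule weight_times_L2[rotated]) measurable
  have hf: "has_fourier (abs_D s w) (\<lambda>\<xi>. complex_of_real (norm \<xi> powr s) * fourier w \<xi>)"
    unfolding abs_D_def by (rule has_fourier_inv_fourier[OF L2_cong_AE[OF sg m ae]])
  show ?thesis
    by (rule has_fourier_cong_AE[OF hf L2_measurable[OF has_fourier_L2(1)[OF hf]] _ L2_measurable[OF sg]])
       (use ae in auto)
qed

text \<open>The transform multiplies distances by a constant, so difference quotients converge on both sides at
  the same time.\<close>

lemma has_L2_time_derivative_I:
  fixes f G :: "real \<Rightarrow> 'a::euclidean_space \<Rightarrow> complex"
  assumes fG: "\<And>\<tau>. \<tau> > 0 \<Longrightarrow> has_fourier (f \<tau>) (G \<tau>)" and t: "t > 0" and vg: "has_fourier v g"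
    and lim: "((\<lambda>h. L2_norm (\<lambda>\<xi>. (G (t + h) \<xi> - G t \<xi>) / complex_of_real h - g \<xi>)) \<longlongrightarrow> 0) (at 0)"
  shows "has_L2_time_derivative f v t"
  unfolding has_L2_time_derivative_def tendsto_L2_def
proof (intro conjI has_fourier_L2(1)[OF vg])
  let ?c = "plancherel_const TYPE('a)"
  have "\<forall>\<^sub>F h in at (0::real). dist h 0 < t"
    using t by (auto simp: eventually_at)
  then have ev: "\<forall>\<^sub>F h in at 0. has_fourier (\<lambda>x. (f (t + h) x - f t x) / complex_of_real h)
      (\<lambda>\<xi>. (G (t + h) \<xi> - G t \<xi>) / complex_of_real h)"
  proof eventually_elim
    case (elim h)
    then have "t + h > 0" by (auto simp: dist_real_def)
    from has_fourier_cmult[OF has_fourier_diff[OF fG[OF this] fG[OF t]], of "1 / complex_of_real h"]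
    show ?case by simp
  qed
  then show "\<forall>\<^sub>F h in at 0. (\<lambda>x. (f (t + h) x - f t x) / complex_of_real h) \<in> L2"
    by eventually_elim (rule has_fourier_L2(1))
  have "((\<lambda>h. (1 / ?c) * L2_norm (\<lambda>\<xi>. (G (t + h) \<xi> - G t \<xi>) / complex_of_real h - g \<xi>)) \<longlongrightarrow> (1 / ?c) * 0) (at 0)"
    by (intro tendsto_intros lim)
  then have "((\<lambda>h. (1 / ?c) * L2_norm (\<lambda>\<xi>. (G (t + h) \<xi> - G t \<xi>) / complex_of_real h - g \<xi>)) \<longlongrightarrow> 0) (at 0)"
    by simp
  then show "((\<lambda>h. L2_norm (\<lambda>x. (f (t + h) x - f t x) / complex_of_real h - v x)) \<longlongrightarrow> 0) (at 0)"
  proof (rule Lim_transform_eventually)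
    show "\<forall>\<^sub>F h in at 0. (1 / ?c) * L2_norm (\<lambda>\<xi>. (G (t + h) \<xi> - G t \<xi>) / complex_of_real h - g \<xi>)
        = L2_norm (\<lambda>x. (f (t + h) x - f t x) / complex_of_real h - v x)"
      using ev
    proof eventually_elim
      case (elim h)
      show ?case using has_fourier_norm_diff[OF elim vg] plancherel_const_pos[where 'a='a]
        by (simp add: less_imp_neq[symmetric])
    qed
  qed
qed

lemma time_deriv_has_fourier:
  fixes f :: "real \<Rightarrow> 'a::euclidean_space \<Rightarrow> complex"
  assumes v: "has_L2_time_derivative f v t" and vg: "has_fourier v g"
  shows "has_fourier (time_deriv f t) g"
proof -
  let ?q = "\<lambda>h x. (f (t + h) x - f t x) / complex_of_real h"
  define d where "d = time_deriv f t"
  have d: "has_L2_time_derivative f d t"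
    unfolding d_def time_deriv_def using v by (rule someI[where P="\<lambda>v. has_L2_time_derivative f v t"])
  have L2: "v \<in> L2" "d \<in> L2" and ev: "\<forall>\<^sub>F h in at 0. ?q h \<in> L2"
    and lv: "((\<lambda>h. L2_norm (\<lambda>x. ?q h x - v x)) \<longlongrightarrow> 0) (at 0)"
    and ld: "((\<lambda>h. L2_norm (\<lambda>x. ?q h x - d x)) \<longlongrightarrow> 0) (at 0)"
    using v d unfolding has_L2_time_derivative_def tendsto_L2_def by auto
  have "L2_norm (\<lambda>x. v x - d x) \<le> 0"
  proof (rule tendsto_lowerbound)
    show "((\<lambda>h. L2_norm (\<lambda>x. ?q h x - v x) + L2_norm (\<lambda>x. ?q h x - d x)) \<longlongrightarrow> 0) (at 0)"
      using tendsto_add[OF lv ld] by simp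
    show "\<forall>\<^sub>F h in at 0. L2_norm (\<lambda>x. v x - d x) \<le> L2_norm (\<lambda>x. ?q h x - v x) + L2_norm (\<lambda>x. ?q h x - d x)"
      using ev
    proof eventually_elim
      case (elim h)
      from L2_norm_triangle_diff[OF L2(1) elim L2(2)] L2_norm_minus_commute[of v "?q h"]
      show ?case by simp
    qed
  qed simp
  then have "L2_norm (\<lambda>x. v x - d x) = 0" by (simp add: antisym)
  then have "AE x in lebesgue. v x = d x" using L2_norm_eq_0_iff[OF L2_diff[OF L2]] by simp
  then show ?thesis
    unfolding d_def[symmetric]
    by (rule has_fourier_cong_AE[OF vg L2_measurable[OF L2(2)] _ L2_measurable[OF has_fourier_L2(2)[OF vg]]]) auto
qed

section \<open>Sobolev solutions on the frequency side\<close>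

lemma vector_derivative_sequence:
  fixes f :: "real \<Rightarrow> complex"
  assumes f: "(f has_vector_derivative v) (at t within S)"
    and X: "X \<longlonglongrightarrow> 0" "\<And>i. X i \<noteq> 0" "\<And>i. t + X i \<in> S"
  shows "(\<lambda>i. (f (t + X i) - f t) / complex_of_real (X i)) \<longlonglongrightarrow> v"
proof -
  have "((\<lambda>y. norm ((f y - f t) - (y - t) *\<^sub>R v) / norm (y - t)) \<longlongrightarrow> 0) (at t within S)"
    using f unfolding has_vector_derivative_def has_derivative_iff_norm by simp
  moreover have "(\<lambda>i. t + X i) \<longlonglongrightarrow> t" using tendsto_add[OF tendsto_const X(1), of t] by simp
  ultimately have "(\<lambda>i. norm ((f (t + X i) - f t) - X i *\<^sub>R v) / norm (X i)) \<longlonglongrightarrow> 0"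
    using X(2,3) unfolding tendsto_at_iff_sequentially comp_def
    by (auto dest!: spec[of _ "\<lambda>i. t + X i"])
  moreover have "norm ((f (t + X i) - f t) - X i *\<^sub>R v) / norm (X i)
      = norm ((f (t + X i) - f t) / complex_of_real (X i) - v)" for i
  proof -
    have "(f (t + X i) - f t) / complex_of_real (X i) - v = ((f (t + X i) - f t) - X i *\<^sub>R v) / complex_of_real (X i)"
      using X(2)[of i] by (simp add: diff_divide_distrib scaleR_conv_of_real)
    then show ?thesis by (simp add: norm_divide)
  qed
  ultimately have "(\<lambda>i. norm ((f (t + X i) - f t) / complex_of_real (X i) - v)) \<longlonglongrightarrow> 0" by simp
  then have "(\<lambda>i. (f (t + X i) - f t) / complex_of_real (X i) - v) \<longlonglongrightarrow> 0"
    by (rule tendsto_norm_zero_cancel)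
  then show ?thesis by (rule Lim_null[THEN iffD2])
qed

text \<open>The derivative \<open>V\<close> is recovered from \<open>U\<close> as a limit of difference quotients, which makes it measurable
  in \<open>\<xi>\<close>. The initial values are Fourier integrals since the data are integrable.\<close>

lemma sobolev_solution_frequency:
  fixes u0 u1 :: "'a::euclidean_space \<Rightarrow> complex"
  assumes sol: "sobolev_solution \<sigma> \<delta> u0 u1 u"
    and u0: "u0 \<in> L1" "u0 \<in> L2" and u1: "u1 \<in> L1" "u1 \<in> L2"
  obtains U V where "\<And>t. t \<ge> 0 \<Longrightarrow> has_fourier (u t) (U t)"
    "\<And>t. t \<ge> 0 \<Longrightarrow> V t \<in> borel_measurable lebesgue"
    "AE \<xi> in lebesgue. \<xi> \<noteq> 0 \<and> solves_ode (norm \<xi> powr (2 * \<delta>)) (norm \<xi> powr (2 * \<sigma>)) (\<lambda>t. U t \<xi>) (\<lambda>t. V t \<xi>)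
       \<and> U 0 \<xi> = fourier_integral u0 \<xi> \<and> V 0 \<xi> = fourier_integral u1 \<xi>"
proof -
  obtain U where U: "\<And>t. t \<ge> 0 \<Longrightarrow> has_fourier (u t) (U t)"
    and ode: "AE \<xi> in lebesgue. \<exists>V W.
          (\<forall>t\<ge>0. ((\<lambda>\<tau>. U \<tau> \<xi>) has_vector_derivative V t) (at t within {0..}) \<and>
                 (V has_vector_derivative W t) (at t within {0..}) \<and>
                 W t + complex_of_real (norm \<xi> powr (2 * \<delta>)) * V t
                     + complex_of_real (norm \<xi> powr (2 * \<sigma>)) * U t \<xi> = 0) \<and>
          U 0 \<xi> = fourier u0 \<xi> \<and> V 0 = fourier u1 \<xi>"
    using sol unfolding sobolev_solution_def by blast
  define h where "h k = 1 / real (Suc k)" for k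
  have h: "h \<longlonglongrightarrow> 0" "\<And>k. h k \<noteq> 0" "\<And>k. h k \<ge> 0"
    unfolding h_def using LIMSEQ_inverse_real_of_nat by (auto simp: inverse_eq_divide)
  define V where "V t \<xi> = lim (\<lambda>k. (U (t + h k) \<xi> - U t \<xi>) / complex_of_real (h k))" for t \<xi>
  have Um: "U t \<in> borel_measurable lebesgue" if "t \<ge> 0" for t
    using L2_measurable[OF has_fourier_L2(2)[OF U[OF that]]] .
  have Vm: "V t \<in> borel_measurable lebesgue" if "t \<ge> 0" for t
  proof -
    have [measurable]: "U t \<in> borel_measurable lebesgue" "\<And>k. U (t + h k) \<in> borel_measurable lebesgue"
      using that h(3) by (auto intro!: Um)
    show ?thesis unfolding V_def by measurable
  qed
  have "AE \<xi> in lebesgue. \<xi> \<noteq> (0::'a)" by (intro AE_completion AE_lborel_singleton)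
  with ode fourier_AE_eq_fourier_integral[OF u0] fourier_AE_eq_fourier_integral[OF u1]
  have "AE \<xi> in lebesgue. \<xi> \<noteq> 0 \<and> solves_ode (norm \<xi> powr (2 * \<delta>)) (norm \<xi> powr (2 * \<sigma>)) (\<lambda>t. U t \<xi>) (\<lambda>t. V t \<xi>)
       \<and> U 0 \<xi> = fourier_integral u0 \<xi> \<and> V 0 \<xi> = fourier_integral u1 \<xi>"
  proof eventually_elim
    case (elim \<xi>)
    then obtain V' W where V': "\<And>t. t \<ge> 0 \<Longrightarrow> ((\<lambda>\<tau>. U \<tau> \<xi>) has_vector_derivative V' t) (at t within {0..})"
      and W: "\<And>t. t \<ge> 0 \<Longrightarrow> (V' has_vector_derivative W t) (at t within {0..})"
      and eq: "\<And>t. t \<ge> 0 \<Longrightarrow> W t + complex_of_real (norm \<xi> powr (2 * \<delta>)) * V' t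
                     + complex_of_real (norm \<xi> powr (2 * \<sigma>)) * U t \<xi> = 0"
      and init: "U 0 \<xi> = fourier u0 \<xi>" "V' 0 = fourier u1 \<xi>" by blast
    have VV': "V t \<xi> = V' t" if "t \<ge> 0" for t
      unfolding V_def using that h(3)
      by (intro limI vector_derivative_sequence[OF V'[OF that] h(1,2)]) auto
    have "((\<lambda>t. V t \<xi>) has_vector_derivative W t) (at t within {0..})" if "t \<ge> 0" for t
      by (rule has_vector_derivative_transform[OF _ _ W[OF that]]) (use that VV' in auto)
    moreover have "W t = - (complex_of_real (norm \<xi> powr (2 * \<delta>)) * V t \<xi> + complex_of_real (norm \<xi> powr (2 * \<sigma>)) * U t \<xi>)"
      if "t \<ge> 0" for t
      unfolding VV'[OF that] by (rule eq_neg_iff_add_eq_0[THEN iffD2]) (use eq[OF that] in \<open>simp add: add.assoc\<close>)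
    ultimately have "solves_ode (norm \<xi> powr (2 * \<delta>)) (norm \<xi> powr (2 * \<sigma>)) (\<lambda>t. U t \<xi>) (\<lambda>t. V t \<xi>)"
      unfolding solves_ode_def using V' VV' by auto
    then show ?case using elim init VV'[of 0] by simp
  qed
  from that[OF U Vm this] show thesis by blast
qed

section \<open>Asymptotic profiles\<close>

lemma exp_smallo_powr:
  fixes b \<beta> :: real assumes "b > 0"
  shows "(\<lambda>t::real. exp (- b * t)) \<in> o(\<lambda>t. t powr \<beta>)"
proof -
  obtain C where C: "C > 0" "\<And>t. t \<ge> 0 \<Longrightarrow> t powr (\<bar>\<beta>\<bar> + 1) * exp (- b * t powr 1) \<le> C"
    using powr_times_exp_bounded[of "\<bar>\<beta>\<bar> + 1" b 1] assms by auto
  show ?thesis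
  proof (rule smalloI_tendsto)
    show "((\<lambda>t. exp (- b * t) / t powr \<beta>) \<longlongrightarrow> 0) at_top"
    proof (rule Lim_null_comparison)
      have "((\<lambda>t::real. C * inverse t) \<longlongrightarrow> C * 0) at_top"
        by (intro tendsto_intros tendsto_inverse_0_at_top filterlim_ident)
      then show "((\<lambda>t::real. C * inverse t) \<longlongrightarrow> 0) at_top" by simp
      show "\<forall>\<^sub>F t in at_top. norm (exp (- b * t) / t powr \<beta>) \<le> C * inverse t"
        using eventually_ge_at_top[of 1]
      proof eventually_elim
        case (elim t)
        have "t powr (- \<beta>) \<le> t powr \<bar>\<beta>\<bar>" using elim by (intro powr_mono) auto
        then have "t powr (- \<beta>) * t * exp (- b * t) \<le> t powr \<bar>\<beta>\<bar> * t * exp (- b * t)"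
          using elim by (intro mult_right_mono) auto
        also have "\<dots> = t powr (\<bar>\<beta>\<bar> + 1) * exp (- b * t powr 1)" using elim by (simp add: powr_add)
        also have "\<dots> \<le> C" using elim by (intro C) simp
        finally have "exp (- b * t) * t powr (- \<beta>) * t \<le> C" by (simp add: mult_ac)
        then show ?case using elim by (simp add: powr_minus field_simps)
      qed
    qed
    show "\<forall>\<^sub>F t::real in at_top. t powr \<beta> \<noteq> 0"
      using eventually_gt_at_top[of 0] by eventually_elim simp
  qed
qed

text \<open>Away from a part \<open>\<Phi>\<close> with small norm, exponential decay suffices.\<close>

lemma L2_norm_smallo_split:
  fixes Z \<Phi> :: "real \<Rightarrow> 'a::euclidean_space \<Rightarrow> complex"
  assumes \<Phi>: "(\<lambda>t. L2_norm (\<Phi> t)) \<in> o(\<lambda>t. t powr \<beta>)"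
    and \<Phi>m: "\<And>t. \<Phi> t \<in> borel_measurable borel"
    and Z: "\<And>t. t > 0 \<Longrightarrow> Z t \<in> L2" and D: "D \<in> L2" and b: "b > 0"
    and diff: "\<And>t. t \<ge> 1 \<Longrightarrow> AE \<xi> in lebesgue. cmod (Z t \<xi> - \<Phi> t \<xi>) \<le> C * exp (- b * t) * cmod (D \<xi>)"
  shows "(\<lambda>t. L2_norm (Z t)) \<in> o(\<lambda>t. t powr \<beta>)"
proof -
  have "(\<lambda>t. L2_norm (\<Phi> t) + \<bar>C\<bar> * L2_norm D * exp (- b * t)) \<in> o(\<lambda>t. t powr \<beta>)"
  proof (intro sum_in_smallo \<Phi>)
    show "(\<lambda>t. \<bar>C\<bar> * L2_norm D * exp (- b * t)) \<in> o(\<lambda>t. t powr \<beta>)"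
      using exp_smallo_powr[OF b, of \<beta>] by (cases "\<bar>C\<bar> * L2_norm D = 0") simp_all
  qed
  moreover have "(\<lambda>t. L2_norm (Z t)) \<in> O(\<lambda>t. L2_norm (\<Phi> t) + \<bar>C\<bar> * L2_norm D * exp (- b * t))"
  proof (rule bigoI[of _ 1])
    show "\<forall>\<^sub>F t in at_top. norm (L2_norm (Z t)) \<le> 1 * norm (L2_norm (\<Phi> t) + \<bar>C\<bar> * L2_norm D * exp (- b * t))"
      using eventually_ge_at_top[of 1]
    proof eventually_elim
      case (elim t)
      let ?R = "\<lambda>\<xi>. Z t \<xi> - \<Phi> t \<xi>"
      have Zt: "Z t \<in> L2" using elim by (intro Z) simp
      have "\<Phi> t \<in> borel_measurable lebesgue" by (rule measurable_completion) (simp add: \<Phi>m)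
      then have Rm: "?R \<in> borel_measurable lebesgue" using L2_measurable[OF Zt] by (intro borel_measurable_diff)
      have R: "?R \<in> L2" by (rule L2_I_dominated[OF Rm D diff[OF elim]])
      from L2_diff[OF Zt R] have \<Phi>t: "\<Phi> t \<in> L2" by simp
      have "L2_norm ?R \<le> L2_norm (\<lambda>\<xi>. complex_of_real (C * exp (- b * t)) * D \<xi>)"
      proof (rule L2_norm_mono[OF Rm L2_cmult[OF D]])
        show "AE \<xi> in lebesgue. cmod (?R \<xi>) \<le> cmod (complex_of_real (C * exp (- b * t)) * D \<xi>)"
          using diff[OF elim]
        proof eventually_elim
          case (elim \<xi>)
          also have "C * exp (- b * t) * cmod (D \<xi>) \<le> \<bar>C\<bar> * exp (- b * t) * cmod (D \<xi>)"
            by (intro mult_right_mono) auto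
          finally show ?case by (simp add: norm_mult abs_mult)
        qed
      qed
      also have "\<dots> = \<bar>C\<bar> * L2_norm D * exp (- b * t)"
        unfolding L2_norm_cmult norm_of_real by (simp add: abs_mult)
      finally have "L2_norm ?R \<le> \<bar>C\<bar> * L2_norm D * exp (- b * t)" .
      moreover have "L2_norm (Z t) \<le> L2_norm (\<Phi> t) + L2_norm ?R"
        using L2_norm_triangle[OF \<Phi>t R] by simp
      ultimately show ?case by simp
    qed
  qed
  ultimately show ?thesis by (rule landau_o.big_small_trans[rotated])
qed

text \<open>The term of smaller order is eventually at most half of the lower bound for \<open>p S\<close>.\<close>

lemma two_sided_of_smallo:
  fixes N S D g :: "real \<Rightarrow> real"
  assumes N: "\<And>t. t > 0 \<Longrightarrow> \<bar>N t - p * S t\<bar> \<le> D t" and p: "p > 0" and D: "D \<in> o(g)"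
    and S: "c > 0" "C > 0" "\<forall>\<^sub>F t in at_top. c * g t \<le> S t \<and> S t \<le> C * g t" and g: "\<And>t. g t \<ge> 0"
  shows "\<exists>C1>0. \<exists>C2>0. \<forall>\<^sub>F t in at_top. C1 * g t \<le> N t \<and> N t \<le> C2 * g t"
proof (intro exI conjI)
  show "p * c / 2 > 0" "p * C + p * c / 2 > 0" using p S by (auto intro: add_pos_pos)
  have "\<forall>\<^sub>F t in at_top. norm (D t) \<le> p * c / 2 * norm (g t)"
    using landau_o.smallD[OF D, of "p * c / 2"] p S by simp
  with S(3) eventually_gt_at_top[of 0]
  show "\<forall>\<^sub>F t in at_top. p * c / 2 * g t \<le> N t \<and> N t \<le> (p * C + p * c / 2) * g t"
  proof eventually_elim
    case (elim t)
    define X Y Z where "X = p * (c * g t)" and "Y = p * S t" and "Z = p * (C * g t)"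
    have "\<bar>N t - Y\<bar> \<le> X / 2" using N[of t] elim g[of t] by (simp add: X_def Y_def)
    moreover have "X \<le> Y" "Y \<le> Z"
      unfolding X_def Y_def Z_def using elim p by (auto intro: mult_left_mono)
    ultimately have "X / 2 \<le> N t \<and> N t \<le> Z + X / 2" by linarith
    then show ?case by (simp add: X_def Z_def algebra_simps)
  qed
qed

text \<open>The mean value inequality for \<open>w U\<close>.\<close>

lemma solves_ode_lipschitz:
  assumes ode: "solves_ode a b U V" and "t1 \<ge> 0" "w \<ge> 0"
    and B: "\<And>\<tau>. \<tau> \<ge> t1 \<Longrightarrow> w * cmod (V \<tau>) \<le> B" and xy: "x \<ge> t1" "y \<ge> t1"
  shows "w * cmod (U x - U y) \<le> B * \<bar>x - y\<bar>"
proof -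
  have "norm (w *\<^sub>R U x - w *\<^sub>R U y) \<le> B * norm (x - y)"
  proof (rule differentiable_bound[where S="{t1..}" and f'="\<lambda>\<tau> h. h *\<^sub>R (w *\<^sub>R V \<tau>)"])
    fix \<tau> assume \<tau>: "\<tau> \<in> {t1..}"
    have "(U has_vector_derivative V \<tau>) (at \<tau> within {t1..})"
      by (rule has_vector_derivative_within_subset[of U "V \<tau>" \<tau> "{0..}"])
         (use ode \<tau> assms(2) in \<open>auto simp: solves_ode_def\<close>)
    then have "((\<lambda>\<tau>. w *\<^sub>R U \<tau>) has_vector_derivative w *\<^sub>R V \<tau>) (at \<tau> within {t1..})"
      by (rule bounded_linear.has_vector_derivative[OF bounded_linear_scaleR_right])
    then show "((\<lambda>\<tau>. w *\<^sub>R U \<tau>) has_derivative (\<lambda>h. h *\<^sub>R (w *\<^sub>R V \<tau>))) (at \<tau> within {t1..})"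
      by (simp add: has_vector_derivative_def)
    have "B \<ge> 0" using order_trans[OF _ B[of \<tau>], of 0] \<tau> assms(3) by simp
    then show "onorm (\<lambda>h. h *\<^sub>R (w *\<^sub>R V \<tau>)) \<le> B"
    proof (rule onorm_bound)
      fix h :: real
      have "\<bar>h\<bar> * (w * cmod (V \<tau>)) \<le> \<bar>h\<bar> * B" using B[of \<tau>] \<tau> by (intro mult_left_mono) auto
      then show "norm (h *\<^sub>R (w *\<^sub>R V \<tau>)) \<le> B * norm h" using assms(3) by (simp add: abs_mult mult_ac)
    qed
  qed (use xy in auto)
  then show ?thesis using assms(3) by (simp flip: scaleR_right_diff_distrib)
qed

text \<open>A solution together with its transform \<open>U\<close> and the time derivative \<open>V\<close> of \<open>U\<close>.\<close>

locale damped_wave_solution = damped_wave \<sigma> \<delta> for \<sigma> \<delta> :: real +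
  fixes s :: real and u0 u1 :: "'a::euclidean_space \<Rightarrow> complex"
    and u U V :: "real \<Rightarrow> 'a \<Rightarrow> complex"
  assumes s: "s \<ge> 0" and dim: "real DIM('a) > 2 * \<sigma>"
    and u0: "u0 \<in> L1" "u0 \<in> L2" and u1: "u1 \<in> L1" "u1 \<in> L2"
    and U: "\<And>t. t \<ge> 0 \<Longrightarrow> has_fourier (u t) (U t)"
    and Vm: "\<And>t. t \<ge> 0 \<Longrightarrow> V t \<in> borel_measurable lebesgue"
    and freq: "AE \<xi> in lebesgue. \<xi> \<noteq> 0 \<and>
       solves_ode (norm \<xi> powr (2 * \<delta>)) (norm \<xi> powr (2 * \<sigma>)) (\<lambda>t. U t \<xi>) (\<lambda>t. V t \<xi>)
       \<and> U 0 \<xi> = fourier_integral u0 \<xi> \<and> V 0 \<xi> = fourier_integral u1 \<xi>"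
begin

abbreviation "F0 \<equiv> fourier_integral u0"
abbreviation "F1 \<equiv> fourier_integral u1"

definition "P = (\<integral>x. u1 x \<partial>lebesgue)"

definition "mass = (\<integral>x. cmod (u0 x) \<partial>lebesgue) + (\<integral>x. cmod (u1 x) \<partial>lebesgue)"

lemma F_bounds: "cmod (F0 \<xi>) \<le> mass" "cmod (F1 \<xi>) \<le> mass"
proof -
  have "0 \<le> (\<integral>x. cmod (u0 x) \<partial>lebesgue)" "0 \<le> (\<integral>x. cmod (u1 x) \<partial>lebesgue)" by simp_all
  then show "cmod (F0 \<xi>) \<le> mass" "cmod (F1 \<xi>) \<le> mass"
    using fourier_integral_bound[of u0 \<xi>] fourier_integral_bound[of u1 \<xi>] unfolding mass_def by linarith+
qed

lemma F_measurable [measurable]: "F0 \<in> borel_measurable borel" "F1 \<in> borel_measurable borel"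
  using fourier_integral_borel u0 u1 by auto

definition "data \<xi> = complex_of_real (cmod (F0 \<xi>)) + complex_of_real (cmod (F1 \<xi>))"

lemma data_L2: "data \<in> L2"
  unfolding data_def[abs_def] by (intro L2_add L2_cmod plancherel_L1_L2(1) u0 u1)

lemma cmod_data: "cmod (data \<xi>) = cmod (F0 \<xi>) + cmod (F1 \<xi>)"
  unfolding data_def of_real_add[symmetric] norm_of_real by simp

definition "wt \<xi> = complex_of_real (norm (\<xi> :: 'a) powr s)"

lemma wt_measurable [measurable]: "wt \<in> borel_measurable borel"
  unfolding wt_def[abs_def] by measurable

lemma wt_mult_measurable: "g \<in> borel_measurable lebesgue \<Longrightarrow> (\<lambda>\<xi>. wt \<xi> * g \<xi>) \<in> borel_measurable lebesgue"
  unfolding wt_def by (rule weight_times_L2[rotated]) simp_all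

lemma cmod_wt: "cmod (wt \<xi>) = norm \<xi> powr s"
  by (simp add: wt_def)

text \<open>The bounds that serve, in this order, as majorant for the difference quotients, for membership in
  the Sobolev space, and for the decay of the high frequencies.\<close>

definition "sol_bound C t0 \<xi> \<longleftrightarrow> (\<forall>t\<ge>t0. cmod (wt \<xi> * V t \<xi>) \<le> C * cmod (data \<xi>)
       \<and> cmod (wt \<xi> * U t \<xi>) \<le> cmod (U t \<xi>) + C * cmod (data \<xi>)
       \<and> (norm \<xi> > 1 \<longrightarrow> cmod (wt \<xi> * U t \<xi>) \<le> C * exp (- (1/20) * t) * cmod (data \<xi>)
            \<and> cmod (wt \<xi> * V t \<xi>) \<le> C * exp (- (1/20) * t) * cmod (data \<xi>)))"

text \<open>Below frequency 1 this is read off from the explicit solution, above it from \<open>high_bound\<close>.\<close>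

lemma solution_bounds:
  assumes t0: "t0 > 0"
  obtains C where "C > 0" "AE \<xi> in lebesgue. sol_bound C t0 \<xi>"
proof -
  obtain C where C: "C > 0"
    "\<And>U V r t. solves_ode (r powr (2 * \<delta>)) (r powr (2 * \<sigma>)) U V \<Longrightarrow> r \<ge> 1 \<Longrightarrow> t \<ge> t0 \<Longrightarrow>
      r powr s * cmod (U t) \<le> C * exp (- t / 20) * (cmod (U 0) + cmod (V 0)) \<and>
      r powr s * cmod (V t) \<le> C * exp (- t / 20) * (cmod (U 0) + cmod (V 0))"
    using high_bound[OF s t0] by blast
  show thesis
  proof (rule that[of "C + 2"])
    show "C + 2 > 0" using C by simp
    show "AE \<xi> in lebesgue. sol_bound (C + 2) t0 \<xi>"
      using freq
    proof eventually_elim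
      case (elim \<xi>)
      define r where "r = norm \<xi>"
      have r: "r > 0" using elim by (simp add: r_def)
      have ode: "solves_ode (r powr (2 * \<delta>)) (r powr (2 * \<sigma>)) (\<lambda>t. U t \<xi>) (\<lambda>t. V t \<xi>)"
        and init: "U 0 \<xi> = F0 \<xi>" "V 0 \<xi> = F1 \<xi>" using elim by (auto simp: r_def)
      have d0: "cmod (data \<xi>) \<ge> 0" by simp
      show ?case
        unfolding sol_bound_def
      proof (intro allI impI)
        fix t assume t: "t \<ge> t0"
        have e1: "exp (- (1/20) * t) \<le> 1" using t t0 by simp
        show "cmod (wt \<xi> * V t \<xi>) \<le> (C + 2) * cmod (data \<xi>)
          \<and> cmod (wt \<xi> * U t \<xi>) \<le> cmod (U t \<xi>) + (C + 2) * cmod (data \<xi>)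
          \<and> (norm \<xi> > 1 \<longrightarrow> cmod (wt \<xi> * U t \<xi>) \<le> (C + 2) * exp (- (1/20) * t) * cmod (data \<xi>)
              \<and> cmod (wt \<xi> * V t \<xi>) \<le> (C + 2) * exp (- (1/20) * t) * cmod (data \<xi>))"
        proof (cases "r > 1")
          case True
          have h: "cmod (wt \<xi> * U t \<xi>) \<le> C * exp (- (1/20) * t) * cmod (data \<xi>)"
            "cmod (wt \<xi> * V t \<xi>) \<le> C * exp (- (1/20) * t) * cmod (data \<xi>)"
            using C(2)[OF ode _ t] True unfolding norm_mult cmod_wt cmod_data r_def[symmetric] init by simp_all
          have "C * exp (- (1/20) * t) * cmod (data \<xi>) \<le> (C + 2) * exp (- (1/20) * t) * cmod (data \<xi>)"
            by (intro mult_right_mono) auto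
          moreover have "(C + 2) * exp (- (1/20) * t) * cmod (data \<xi>) \<le> (C + 2) * cmod (data \<xi>)"
            using mult_right_mono[OF mult_left_mono[OF e1, of "C + 2"], of "cmod (data \<xi>)"] C(1) by simp
          moreover have "0 \<le> cmod (U t \<xi>)" by simp
          ultimately show ?thesis using h by (intro conjI impI) linarith+
        next
          case False
          then have r1: "r \<le> 1" by simp
          have t': "t \<ge> 0" using t t0 by simp
          have w1: "cmod (wt \<xi>) \<le> 1" unfolding cmod_wt r_def[symmetric] using r r1 s by (intro powr_le1) auto
          have "cmod (V t \<xi>) \<le> 2 * exp (- (r powr (2 * \<delta>)) * t / 2) * (cmod (F1 \<xi>) + r powr \<sigma> * cmod (F0 \<xi>))"
            using low_solution(2)[OF ode r r1 t'] low_bounds(2)[OF r r1, of "F0 \<xi>" "F1 \<xi>" t] init by simp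
          also have "\<dots> \<le> 2 * 1 * (cmod (F1 \<xi>) + 1 * cmod (F0 \<xi>))"
            using r r1 sigma t' by (intro mult_mono add_mono mult_right_mono powr_le1) auto
          finally have "cmod (V t \<xi>) \<le> 2 * cmod (data \<xi>)" by (simp add: cmod_data)
          then have "cmod (wt \<xi> * V t \<xi>) \<le> 1 * (2 * cmod (data \<xi>))"
            unfolding norm_mult using w1 by (intro mult_mono) auto
          moreover have "cmod (wt \<xi> * U t \<xi>) \<le> 1 * cmod (U t \<xi>)"
            unfolding norm_mult using w1 by (intro mult_mono) auto
          moreover have "2 * cmod (data \<xi>) \<le> (C + 2) * cmod (data \<xi>)" using C(1) by (intro mult_right_mono) auto
          moreover have "0 \<le> (C + 2) * cmod (data \<xi>)" using C(1) by simp
          ultimately show ?thesis using False unfolding r_def by (intro conjI impI) linarith+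
        qed
      qed
    qed
  qed
qed

lemma wt_U_L2: assumes t: "t > 0" shows "(\<lambda>\<xi>. wt \<xi> * U t \<xi>) \<in> L2"
proof -
  have Ut: "U t \<in> L2" using t by (intro has_fourier_L2(2)[OF U]) simp
  obtain C where C: "C > 0" "AE \<xi> in lebesgue. sol_bound C t \<xi>"
    using solution_bounds[OF t] by blast
  define D where "D \<xi> = complex_of_real (cmod (U t \<xi>)) + complex_of_real C * complex_of_real (cmod (data \<xi>))" for \<xi>
  have D: "D \<in> L2" unfolding D_def by (intro L2_add L2_cmod L2_cmult Ut data_L2)
  have cD: "cmod (D \<xi>) = cmod (U t \<xi>) + C * cmod (data \<xi>)" for \<xi>
    unfolding D_def of_real_mult[symmetric] of_real_add[symmetric] norm_of_real using C(1) by simp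
  show ?thesis
    by (rule L2_I_dominated[OF wt_mult_measurable[OF L2_measurable[OF Ut]] D, where C=1])
       (use C(2) in \<open>auto elim!: eventually_mono simp: cD sol_bound_def\<close>)
qed

lemma wt_V_L2: assumes t: "t > 0" shows "(\<lambda>\<xi>. wt \<xi> * V t \<xi>) \<in> L2"
proof -
  obtain C where C: "AE \<xi> in lebesgue. sol_bound C t \<xi>"
    using solution_bounds[OF t] by blast
  show ?thesis
    by (rule L2_I_dominated[OF wt_mult_measurable[OF Vm] data_L2, where C=C])
       (use t C in \<open>auto elim!: eventually_mono simp: sol_bound_def\<close>)
qed

text \<open>For \<open>|h| < t / 2\<close> the difference quotients are bounded by the supremum of the derivative after time
  \<open>t / 2\<close>, hence by a multiple of the data.\<close>

lemma wt_U_derivative: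
  assumes t: "t > 0"
  shows "((\<lambda>h. L2_norm (\<lambda>\<xi>. (wt \<xi> * U (t + h) \<xi> - wt \<xi> * U t \<xi>) / complex_of_real h - wt \<xi> * V t \<xi>)) \<longlongrightarrow> 0) (at 0)"
  unfolding tendsto_at_iff_sequentially comp_def
proof (intro allI impI)
  fix X :: "nat \<Rightarrow> real" assume X0: "\<forall>i. X i \<in> UNIV - {0}" and X: "X \<longlonglongrightarrow> 0"
  have "\<forall>\<^sub>F i in sequentially. dist (X i) 0 < t / 2" using tendstoD[OF X, of "t / 2"] t by simp
  then obtain N where N: "\<And>i. i \<ge> N \<Longrightarrow> \<bar>X i\<bar> < t / 2" by (auto simp: eventually_sequentially)
  define Y where "Y i = X (i + N)" for i
  have Y0: "Y i \<noteq> 0" for i using X0 by (simp add: Y_def)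
  have Yt: "\<bar>Y i\<bar> < t / 2" for i using N by (simp add: Y_def)
  have Y: "Y \<longlonglongrightarrow> 0" unfolding Y_def by (rule LIMSEQ_ignore_initial_segment[OF X])
  have tY: "t + Y i \<ge> t / 2" for i using Yt[of i] by linarith
  have tY0: "t + Y i \<ge> 0" for i using tY[of i] t by linarith
  obtain C where C: "AE \<xi> in lebesgue. sol_bound C (t / 2) \<xi>"
    using solution_bounds[of "t / 2"] t by auto
  have "(\<lambda>i. L2_norm (\<lambda>\<xi>. (wt \<xi> * U (t + Y i) \<xi> - wt \<xi> * U t \<xi>) / complex_of_real (Y i) - wt \<xi> * V t \<xi>)) \<longlonglongrightarrow> 0"
  proof (rule L2_dominated_convergence)
    have Um: "(\<lambda>\<xi>. wt \<xi> * U \<tau> \<xi>) \<in> borel_measurable lebesgue" if "\<tau> \<ge> 0" for \<tau>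
      by (rule wt_mult_measurable[OF L2_measurable[OF has_fourier_L2(2)[OF U[OF that]]]])
    show "(\<lambda>\<xi>. (wt \<xi> * U (t + Y i) \<xi> - wt \<xi> * U t \<xi>) / complex_of_real (Y i)) \<in> borel_measurable lebesgue" for i
      using tY[of i] t by (intro borel_measurable_divide borel_measurable_diff Um) auto
    show "(\<lambda>\<xi>. wt \<xi> * V t \<xi>) \<in> borel_measurable lebesgue" using t by (intro wt_mult_measurable Vm) simp
    show "integrable lebesgue (\<lambda>\<xi>. (2 * C)\<^sup>2 * (cmod (data \<xi>))\<^sup>2)" using L2_integrable[OF data_L2] by simp
    show "AE \<xi> in lebesgue. (\<lambda>i. (wt \<xi> * U (t + Y i) \<xi> - wt \<xi> * U t \<xi>) / complex_of_real (Y i)) \<longlonglongrightarrow> wt \<xi> * V t \<xi>"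
      using freq
    proof eventually_elim
      case (elim \<xi>)
      then have "((\<lambda>t. U t \<xi>) has_vector_derivative V t \<xi>) (at t within {0..})"
        using t unfolding solves_ode_def by simp
      then have "(\<lambda>i. (U (t + Y i) \<xi> - U t \<xi>) / complex_of_real (Y i)) \<longlonglongrightarrow> V t \<xi>"
        by (rule vector_derivative_sequence[OF _ Y Y0]) (simp add: tY0)
      from tendsto_mult[OF tendsto_const[of "wt \<xi>"] this] show ?case
        by (simp add: right_diff_distrib)
    qed
    show "AE \<xi> in lebesgue. (cmod ((wt \<xi> * U (t + Y i) \<xi> - wt \<xi> * U t \<xi>) / complex_of_real (Y i) - wt \<xi> * V t \<xi>))\<^sup>2
        \<le> (2 * C)\<^sup>2 * (cmod (data \<xi>))\<^sup>2" for i
      using freq C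
    proof eventually_elim
      case (elim \<xi>)
      let ?B = "C * cmod (data \<xi>)"
      have "cmod (wt \<xi>) * cmod (U (t + Y i) \<xi> - U t \<xi>) \<le> ?B * \<bar>(t + Y i) - t\<bar>"
      proof (rule solves_ode_lipschitz)
        show "solves_ode (norm \<xi> powr (2 * \<delta>)) (norm \<xi> powr (2 * \<sigma>)) (\<lambda>t. U t \<xi>) (\<lambda>t. V t \<xi>)" using elim by simp
        show "cmod (wt \<xi>) * cmod (V \<tau> \<xi>) \<le> ?B" if "\<tau> \<ge> t / 2" for \<tau>
          using elim that by (simp add: sol_bound_def flip: norm_mult)
      qed (use t tY in auto)
      then have "cmod ((wt \<xi> * U (t + Y i) \<xi> - wt \<xi> * U t \<xi>) / complex_of_real (Y i)) \<le> ?B"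
        unfolding right_diff_distrib[symmetric] norm_divide norm_mult norm_of_real
        using Y0[of i] by (simp add: divide_le_eq)
      moreover have "cmod (wt \<xi> * V t \<xi>) \<le> ?B" using elim t by (simp add: sol_bound_def)
      ultimately have "cmod ((wt \<xi> * U (t + Y i) \<xi> - wt \<xi> * U t \<xi>) / complex_of_real (Y i) - wt \<xi> * V t \<xi>) \<le> 2 * C * cmod (data \<xi>)"
        using norm_triangle_ineq4[of "(wt \<xi> * U (t + Y i) \<xi> - wt \<xi> * U t \<xi>) / complex_of_real (Y i)" "wt \<xi> * V t \<xi>"]
        by linarith
      then have "(cmod ((wt \<xi> * U (t + Y i) \<xi> - wt \<xi> * U t \<xi>) / complex_of_real (Y i) - wt \<xi> * V t \<xi>))\<^sup>2 \<le> (2 * C * cmod (data \<xi>))\<^sup>2"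
        by (intro power_mono) auto
      then show ?case by (simp only: power_mult_distrib)
    qed
  qed
  then show "(\<lambda>i. L2_norm (\<lambda>\<xi>. (wt \<xi> * U (t + X i) \<xi> - wt \<xi> * U t \<xi>) / complex_of_real (X i) - wt \<xi> * V t \<xi>)) \<longlonglongrightarrow> 0"
    unfolding Y_def by (rule LIMSEQ_offset)
qed

end

context damped_wave begin

definition sin_symbol :: "real \<Rightarrow> 'a::euclidean_space \<Rightarrow> complex" where
  "sin_symbol t \<xi> = complex_of_real
     (exp (- (1 / 2) * t * norm \<xi> powr (2 * \<delta>)) * (sin (t * norm \<xi> powr \<sigma>) / norm \<xi> powr \<sigma>))"

definition cos_symbol :: "real \<Rightarrow> 'a::euclidean_space \<Rightarrow> complex" where
  "cos_symbol t \<xi> = complex_of_real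
     (exp (- (1 / 2) * t * norm \<xi> powr (2 * \<delta>)) * cos (t * norm \<xi> powr \<sigma>))"

lemma symbol_measurable [measurable]:
  "sin_symbol t \<in> borel_measurable borel" "cos_symbol t \<in> borel_measurable borel"
  unfolding sin_symbol_def[abs_def] cos_symbol_def[abs_def] by measurable

lemma weighted_sin_symbol:
  "complex_of_real (norm \<xi> powr s) * sin_symbol t \<xi> = profile (s - \<sigma>) (- (pi / 2)) t \<xi>"
proof (cases "\<xi> = 0")
  case False
  then have "norm \<xi> powr (s - \<sigma>) = norm \<xi> powr s / norm \<xi> powr \<sigma>" by (simp add: powr_diff)
  moreover have "cos (x + - (pi / 2)) = sin x" for x by (simp add: cos_diff)
  ultimately show ?thesis unfolding sin_symbol_def profile_def by simp
qed (simp add: sin_symbol_def profile_def)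

lemma weighted_cos_symbol:
  "complex_of_real (norm \<xi> powr s) * cos_symbol t \<xi> = profile s 0 t \<xi>"
  unfolding cos_symbol_def profile_def by simp

lemma sin_symbol_L2:
  assumes "real DIM('a) > 2 * \<sigma>" "t > 0"
  shows "(sin_symbol t :: 'a::euclidean_space \<Rightarrow> complex) \<in> L2"
proof -
  have "sin_symbol t \<xi> = profile (- \<sigma>) (- (pi / 2)) t \<xi>" for \<xi> :: 'a
    using weighted_sin_symbol[of \<xi> 0 t] by (cases "\<xi> = 0") (simp_all add: sin_symbol_def profile_def)
  then have "(sin_symbol t :: 'a \<Rightarrow> complex) = profile (- \<sigma>) (- (pi / 2)) t" ..
  with profile_L2[where 'a='a, of "- \<sigma>" t] assms show ?thesis by simp
qed

lemma cos_symbol_L2: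
  assumes "t > 0"
  shows "(cos_symbol t :: 'a::euclidean_space \<Rightarrow> complex) \<in> L2"
proof (rule L2_cong_AE[OF profile_L2[where \<kappa>=0 and \<phi>=0]])
  show "cos_symbol t \<in> borel_measurable (lebesgue :: 'a measure)" by (rule measurable_completion) simp
  have "AE \<xi> in lebesgue. \<xi> \<noteq> (0::'a)" by (intro AE_completion AE_lborel_singleton)
  then show "AE \<xi>::'a in lebesgue. profile 0 0 t \<xi> = cos_symbol t \<xi>"
    by eventually_elim (simp add: cos_symbol_def profile_def)
qed (use assms in auto)

end

context damped_wave_solution begin

abbreviation "scaled t \<eta> \<equiv> (t powr (- (1 / (2 * \<delta>)))) *\<^sub>R (\<eta> :: 'a)"

lemma norm_scaled: "norm (scaled t \<eta>) = radius (norm \<eta>) t"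
  by (simp add: radius_def)

lemma radius_powr:
  assumes t: "t > 0"
  shows "t powr (1 / (2 * \<delta>) * e) * radius rho t powr e = rho powr e"
proof -
  have "radius rho t powr e = t powr (- (1 / (2 * \<delta>)) * e) * rho powr e"
    unfolding radius_def by (simp add: powr_mult powr_powr)
  then show ?thesis using t by (simp add: mult.assoc[symmetric] flip: powr_add)
qed

lemma scaled_tendsto:
  assumes "\<eta> \<noteq> 0"
  shows "((\<lambda>t. scaled t \<eta>) \<longlongrightarrow> 0) at_top"
proof (rule tendsto_norm_zero_cancel)
  show "((\<lambda>t. norm (scaled t \<eta>)) \<longlongrightarrow> 0) at_top"
    unfolding norm_scaled using assms by (intro rad_tendsto) simp
qed

lemma dims: "2 * (s - \<sigma>) > - real DIM('a)" "2 * s > - real DIM('a)"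
proof -
  show "2 * (s - \<sigma>) > - real DIM('a)" using dim s by simp
  have "0 < real DIM('a)" by simp
  then show "2 * s > - real DIM('a)" using s by linarith
qed

text \<open>The scaled weight \<open>t\<^bsup>k(s - \<theta>)\<^esup> |\<xi>|\<^sup>s\<close> at \<open>\<xi> = t\<^sup>-\<^sup>k \<eta>\<close> is \<open>|\<eta>|\<^bsup>s - \<theta>\<^esup> |\<xi>|\<^sup>\<theta>\<close>, and \<open>t |\<xi>|\<^bsup>2\<delta>\<^esup> = |\<eta>|\<^bsup>2\<delta>\<^esup>\<close>. Thus bounds
  and limits for \<open>|\<xi>|\<^sup>\<theta> L\<close> are what the scaling argument needs; \<open>\<theta> = \<sigma>\<close> will serve for the solution
  and \<open>\<theta> = 0\<close> for its time derivative.\<close>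

lemma scaled_part_smallo:
  fixes L :: "real \<Rightarrow> 'a \<Rightarrow> complex" and \<theta> K :: real
  assumes m [measurable]: "\<And>t. L t \<in> borel_measurable borel"
    and \<theta>: "2 * (s - \<theta>) > - real DIM('a)"
    and bound: "\<And>t \<xi>. t \<ge> 1 \<Longrightarrow> \<xi> \<noteq> 0 \<Longrightarrow>
      norm \<xi> powr \<theta> * cmod (L t \<xi>) \<le> K * exp (- (norm \<xi> powr (2 * \<delta>)) * t / 2)"
    and lim: "\<And>\<eta>. \<eta> \<noteq> 0 \<Longrightarrow>
      ((\<lambda>t. complex_of_real (norm (scaled t \<eta>) powr \<theta>) * L t (scaled t \<eta>)) \<longlongrightarrow> 0) at_top"
  shows "(\<lambda>t. L2_norm (\<lambda>\<xi>. wt \<xi> * L t \<xi>))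
     \<in> o(\<lambda>t. t powr (- (1 / (2 * \<delta>) * (s - \<theta>)) - 1 / (2 * \<delta>) * DIM('a) / 2))"
proof (rule scaled_L2_norm_smallo)
  show "(\<lambda>\<xi>. wt \<xi> * L t \<xi>) \<in> borel_measurable borel" for t by measurable
  show "integrable lborel (\<lambda>\<eta>::'a. K\<^sup>2 * (norm \<eta> powr (2 * (s - \<theta>)) * exp (- 1 * norm \<eta> powr (2 * \<delta>))))"
    using \<theta> sigma delta by (intro integrable_mult_right integrable_powr_exp) auto
  fix \<eta> :: 'a assume \<eta>: "\<eta> \<noteq> 0"
  define rho where "rho = norm \<eta>"
  have rho: "rho > 0" using \<eta> by (simp add: rho_def)
  have eq: "t powr (1 / (2 * \<delta>) * (s - \<theta>)) * cmod (wt (scaled t \<eta>) * L t (scaled t \<eta>))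
      = rho powr (s - \<theta>) * (norm (scaled t \<eta>) powr \<theta> * cmod (L t (scaled t \<eta>)))" if t: "t > 0" for t
  proof -
    have "radius rho t powr s = radius rho t powr (s - \<theta>) * radius rho t powr \<theta>" by (simp flip: powr_add)
    then have *: "t powr (1 / (2 * \<delta>) * (s - \<theta>)) * radius rho t powr s = rho powr (s - \<theta>) * radius rho t powr \<theta>"
      using radius_powr[OF t, of "s - \<theta>" rho] by (simp add: mult.assoc[symmetric])
    show ?thesis
      unfolding norm_mult cmod_wt norm_scaled rho_def[symmetric] by (simp only: mult.assoc[symmetric] *)
  qed
  show "(t powr (1 / (2 * \<delta>) * (s - \<theta>)) * cmod (wt (scaled t \<eta>) * L t (scaled t \<eta>)))\<^sup>2
      \<le> K\<^sup>2 * (norm \<eta> powr (2 * (s - \<theta>)) * exp (- 1 * norm \<eta> powr (2 * \<delta>)))" if t1: "t \<ge> 1" for t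
  proof -
    have t: "t > 0" using t1 by simp
    define y where "y = norm (scaled t \<eta>) powr \<theta> * cmod (L t (scaled t \<eta>))"
    have "scaled t \<eta> \<noteq> 0" using \<eta> t by simp
    from bound[OF t1 this] have y: "0 \<le> y" "y \<le> K * exp (- (rho powr (2 * \<delta>)) / 2)"
      using rad_damping[OF rho t] unfolding y_def norm_scaled rho_def[symmetric] by simp_all
    have "(t powr (1 / (2 * \<delta>) * (s - \<theta>)) * cmod (wt (scaled t \<eta>) * L t (scaled t \<eta>)))\<^sup>2
        = rho powr (2 * (s - \<theta>)) * y\<^sup>2"
      unfolding eq[OF t] y_def[symmetric] power_mult_distrib by (simp add: power2_eq_square flip: powr_add)
    also have "\<dots> \<le> rho powr (2 * (s - \<theta>)) * (K * exp (- (rho powr (2 * \<delta>)) / 2))\<^sup>2"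
      using y by (intro mult_left_mono power_mono) auto
    also have "(K * exp (- (rho powr (2 * \<delta>)) / 2))\<^sup>2 = K\<^sup>2 * exp (- 1 * rho powr (2 * \<delta>))"
      by (simp add: power_mult_distrib power2_eq_square flip: exp_add)
    finally show ?thesis by (simp add: rho_def mult_ac)
  qed
  show "((\<lambda>t. t powr (1 / (2 * \<delta>) * (s - \<theta>)) * cmod (wt (scaled t \<eta>) * L t (scaled t \<eta>))) \<longlongrightarrow> 0) at_top"
  proof (rule Lim_transform_eventually)
    show "((\<lambda>t. rho powr (s - \<theta>) * cmod (complex_of_real (norm (scaled t \<eta>) powr \<theta>) * L t (scaled t \<eta>))) \<longlongrightarrow> 0) at_top"
      by (rule tendsto_mult_right_zero[OF tendsto_norm_zero[OF lim[OF \<eta>]]])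
    show "\<forall>\<^sub>F t in at_top. rho powr (s - \<theta>) * cmod (complex_of_real (norm (scaled t \<eta>) powr \<theta>) * L t (scaled t \<eta>))
        = t powr (1 / (2 * \<delta>) * (s - \<theta>)) * cmod (wt (scaled t \<eta>) * L t (scaled t \<eta>))"
      using eventually_gt_at_top[of 0]
    proof eventually_elim
      case (elim t)
      show ?case unfolding eq[OF elim] norm_mult[of "complex_of_real _"] norm_of_real by simp
    qed
  qed
qed

text \<open>The distance to the profile, with the solution cut off at frequency 1; and the same for the time
  derivative.\<close>

definition errU :: "real \<Rightarrow> 'a \<Rightarrow> complex" where
  "errU t \<xi> = (if norm \<xi> \<le> 1 then lowU (F0 \<xi>) (F1 \<xi>) (norm \<xi>) t else 0) - P * sin_symbol t \<xi>"

definition errV :: "real \<Rightarrow> 'a \<Rightarrow> complex" where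
  "errV t \<xi> = (if norm \<xi> \<le> 1 then lowV (F0 \<xi>) (F1 \<xi>) (norm \<xi>) t else 0) - P * cos_symbol t \<xi>"

lemma err_measurable [measurable]: "errU t \<in> borel_measurable borel" "errV t \<in> borel_measurable borel"
  unfolding errU_def[abs_def] errV_def[abs_def] lowU_def lowV_def omega_def by measurable

lemma mass_nonneg: "0 \<le> mass"
  using order_trans[OF norm_ge_zero F_bounds(1)] .

lemma err_bounds:
  assumes "\<xi> \<noteq> 0"
  shows "norm \<xi> powr \<sigma> * cmod (errU t \<xi>) \<le> (4 * mass + cmod P) * exp (- (norm \<xi> powr (2 * \<delta>)) * t / 2)"
    and "norm \<xi> powr 0 * cmod (errV t \<xi>) \<le> (4 * mass + cmod P) * exp (- (norm \<xi> powr (2 * \<delta>)) * t / 2)"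
proof -
  define r where "r = norm \<xi>"
  define E where "E = exp (- (r powr (2 * \<delta>)) * t / 2)"
  have r: "r > 0" using assms by (simp add: r_def)
  have E: "E > 0" by (simp add: E_def)
  have E': "exp (- (1 / 2) * t * r powr (2 * \<delta>)) = E" by (simp add: E_def mult.commute)
  have low: "r powr \<sigma> * cmod (lowU (F0 \<xi>) (F1 \<xi>) r t) \<le> 4 * mass * E"
    "cmod (lowV (F0 \<xi>) (F1 \<xi>) r t) \<le> 4 * mass * E" if r1: "r \<le> 1"
  proof -
    have F: "r powr \<sigma> * cmod (F0 \<xi>) + cmod (F1 \<xi>) \<le> 1 * mass + mass"
      using F_bounds[of \<xi>] r r1 sigma mass_nonneg by (intro add_mono mult_mono powr_le1) auto
    have "r powr \<sigma> * cmod (lowU (F0 \<xi>) (F1 \<xi>) r t) \<le> r powr \<sigma> * (2 * E * (cmod (F0 \<xi>) + cmod (F1 \<xi>) / r powr \<sigma>))"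
      using low_bounds(1)[OF r r1] unfolding E_def by (rule mult_left_mono) simp
    also have "\<dots> = 2 * E * (r powr \<sigma> * cmod (F0 \<xi>) + cmod (F1 \<xi>))" using r by (simp add: field_simps)
    also have "\<dots> \<le> 2 * E * (1 * mass + mass)" using E F by (intro mult_left_mono) auto
    finally show "r powr \<sigma> * cmod (lowU (F0 \<xi>) (F1 \<xi>) r t) \<le> 4 * mass * E" by (simp add: mult_ac)
    have "cmod (lowV (F0 \<xi>) (F1 \<xi>) r t) \<le> 2 * E * (cmod (F1 \<xi>) + r powr \<sigma> * cmod (F0 \<xi>))"
      using low_bounds(2)[OF r r1] unfolding E_def .
    also have "\<dots> \<le> 2 * E * (1 * mass + mass)" using E F by (intro mult_left_mono) auto
    finally show "cmod (lowV (F0 \<xi>) (F1 \<xi>) r t) \<le> 4 * mass * E" by (simp add: mult_ac)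
  qed
  have "cmod (sin_symbol t \<xi>) = E * (\<bar>sin (t * r powr \<sigma>)\<bar> / r powr \<sigma>)"
    unfolding sin_symbol_def r_def[symmetric] E' norm_of_real using E by (simp add: abs_mult)
  then have "r powr \<sigma> * cmod (P * sin_symbol t \<xi>) = cmod P * E * \<bar>sin (t * r powr \<sigma>)\<bar>"
    using r by (simp add: norm_mult)
  also have "\<dots> \<le> cmod P * E * 1" using E by (intro mult_left_mono) auto
  finally have S: "r powr \<sigma> * cmod (P * sin_symbol t \<xi>) \<le> cmod P * E" by simp
  have "cmod (cos_symbol t \<xi>) = E * \<bar>cos (t * r powr \<sigma>)\<bar>"
    unfolding cos_symbol_def r_def[symmetric] E' norm_of_real using E by (simp add: abs_mult)
  then have "cmod (P * cos_symbol t \<xi>) = cmod P * E * \<bar>cos (t * r powr \<sigma>)\<bar>"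
    by (simp add: norm_mult)
  also have "\<dots> \<le> cmod P * E * 1" using E by (intro mult_left_mono) auto
  finally have Cc: "cmod (P * cos_symbol t \<xi>) \<le> cmod P * E" by simp
  have pos: "0 \<le> 4 * mass * E" using E mass_nonneg by simp
  have "r powr \<sigma> * cmod (errU t \<xi>) \<le> r powr \<sigma> * cmod (if r \<le> 1 then lowU (F0 \<xi>) (F1 \<xi>) r t else 0)
      + r powr \<sigma> * cmod (P * sin_symbol t \<xi>)"
    unfolding errU_def r_def[symmetric] distrib_left[symmetric] by (intro mult_left_mono norm_triangle_ineq4) simp
  moreover have "r powr \<sigma> * cmod (if r \<le> 1 then lowU (F0 \<xi>) (F1 \<xi>) r t else 0) \<le> 4 * mass * E"
    using low(1) pos by auto
  ultimately show "norm \<xi> powr \<sigma> * cmod (errU t \<xi>) \<le> (4 * mass + cmod P) * exp (- (norm \<xi> powr (2 * \<delta>)) * t / 2)"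
    unfolding r_def[symmetric] E_def[symmetric] distrib_right using S by linarith
  have "cmod (errV t \<xi>) \<le> cmod (if r \<le> 1 then lowV (F0 \<xi>) (F1 \<xi>) r t else 0) + cmod (P * cos_symbol t \<xi>)"
    unfolding errV_def r_def[symmetric] by (rule norm_triangle_ineq4)
  moreover have "cmod (if r \<le> 1 then lowV (F0 \<xi>) (F1 \<xi>) r t else 0) \<le> 4 * mass * E"
    using low(2) pos by auto
  ultimately have "cmod (errV t \<xi>) \<le> (4 * mass + cmod P) * E"
    unfolding distrib_right using Cc by linarith
  then show "norm \<xi> powr 0 * cmod (errV t \<xi>) \<le> (4 * mass + cmod P) * exp (- (norm \<xi> powr (2 * \<delta>)) * t / 2)"
    unfolding r_def[symmetric] E_def[symmetric] using r by simp
qed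

lemma err_limits:
  assumes \<eta>: "\<eta> \<noteq> 0"
  shows "((\<lambda>t. complex_of_real (norm (scaled t \<eta>) powr \<sigma>) * errU t (scaled t \<eta>)) \<longlongrightarrow> 0) at_top"
    and "((\<lambda>t. complex_of_real (norm (scaled t \<eta>) powr 0) * errV t (scaled t \<eta>)) \<longlongrightarrow> 0) at_top"
proof -
  define rho where "rho = norm \<eta>"
  have rho: "rho > 0" using \<eta> by (simp add: rho_def)
  have n: "norm (scaled t \<eta>) = radius rho t" for t unfolding rho_def by (rule norm_scaled)
  have F1: "((\<lambda>t. F1 (scaled t \<eta>)) \<longlongrightarrow> P) at_top"
    unfolding P_def by (rule fourier_integral_tendsto_at_0[OF u1(1) scaled_tendsto[OF \<eta>]])
  show "((\<lambda>t. complex_of_real (norm (scaled t \<eta>) powr \<sigma>) * errU t (scaled t \<eta>)) \<longlongrightarrow> 0) at_top"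
  proof (rule Lim_transform_eventually[OF lowU_limit[where ?v0.0="\<lambda>t. F0 (scaled t \<eta>)", OF rho F_bounds(1) F1]])
    show "\<forall>\<^sub>F t in at_top. complex_of_real (radius rho t powr \<sigma>) * (lowU (F0 (scaled t \<eta>)) (F1 (scaled t \<eta>)) (radius rho t) t
        - P * (exp (- (1 / 2) * t * radius rho t powr (2 * \<delta>)) * (sin (t * radius rho t powr \<sigma>) / radius rho t powr \<sigma>)))
      = complex_of_real (norm (scaled t \<eta>) powr \<sigma>) * errU t (scaled t \<eta>)"
      using rad_le_1[OF rho] by eventually_elim (unfold errU_def sin_symbol_def n, simp)
  qed
  show "((\<lambda>t. complex_of_real (norm (scaled t \<eta>) powr 0) * errV t (scaled t \<eta>)) \<longlongrightarrow> 0) at_top"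
  proof (rule Lim_transform_eventually[OF lowV_limit[where ?v0.0="\<lambda>t. F0 (scaled t \<eta>)", OF rho F_bounds(1) F1 F_bounds(2)]])
    show "\<forall>\<^sub>F t in at_top. lowV (F0 (scaled t \<eta>)) (F1 (scaled t \<eta>)) (radius rho t) t
        - P * (exp (- (1 / 2) * t * radius rho t powr (2 * \<delta>)) * cos (t * radius rho t powr \<sigma>))
      = complex_of_real (norm (scaled t \<eta>) powr 0) * errV t (scaled t \<eta>)"
      using rad_le_1[OF rho] by eventually_elim (unfold errV_def cos_symbol_def n, simp)
  qed
qed

lemma wt_sin_symbol: "(\<lambda>\<xi>. wt \<xi> * sin_symbol t \<xi>) = profile (s - \<sigma>) (- (pi / 2)) t"
  and wt_cos_symbol: "(\<lambda>\<xi>. wt \<xi> * cos_symbol t \<xi>) = profile s 0 t"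
  unfolding wt_def by (simp_all add: weighted_sin_symbol weighted_cos_symbol)

lemma wt_symbols_L2: assumes "t > 0"
  shows "(\<lambda>\<xi>. wt \<xi> * sin_symbol t \<xi>) \<in> L2" "(\<lambda>\<xi>. wt \<xi> * cos_symbol t \<xi>) \<in> L2"
  unfolding wt_sin_symbol wt_cos_symbol
  by (rule profile_L2[OF dims(1) assms], rule profile_L2[OF dims(2) assms])

lemma frequency_asymptotics:
  "(\<lambda>t. L2_norm (\<lambda>\<xi>. wt \<xi> * U t \<xi> - P * (wt \<xi> * sin_symbol t \<xi>)))
     \<in> o(\<lambda>t. t powr (- (1 / (2 * \<delta>) * (s - \<sigma>)) - 1 / (2 * \<delta>) * DIM('a) / 2))" (is ?U)
  "(\<lambda>t. L2_norm (\<lambda>\<xi>. wt \<xi> * V t \<xi> - P * (wt \<xi> * cos_symbol t \<xi>)))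
     \<in> o(\<lambda>t. t powr (- (1 / (2 * \<delta>) * s) - 1 / (2 * \<delta>) * DIM('a) / 2))" (is ?V)
proof -
  obtain C where C: "C > 0" "AE \<xi> in lebesgue. sol_bound C 1 \<xi>"
    using solution_bounds[of 1] by auto
  have high: "cmod (wt \<xi> * U t \<xi> - P * (wt \<xi> * sin_symbol t \<xi>) - wt \<xi> * errU t \<xi>) \<le> C * exp (- (1/20) * t) * cmod (data \<xi>)"
    "cmod (wt \<xi> * V t \<xi> - P * (wt \<xi> * cos_symbol t \<xi>) - wt \<xi> * errV t \<xi>) \<le> C * exp (- (1/20) * t) * cmod (data \<xi>)"
    if t: "t \<ge> 1" and b: "sol_bound C 1 \<xi>" and f: "\<xi> \<noteq> 0 \<and>
       solves_ode (norm \<xi> powr (2 * \<delta>)) (norm \<xi> powr (2 * \<sigma>)) (\<lambda>t. U t \<xi>) (\<lambda>t. V t \<xi>)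
       \<and> U 0 \<xi> = F0 \<xi> \<and> V 0 \<xi> = F1 \<xi>" for t \<xi>
  proof -
    let ?L = "if norm \<xi> \<le> 1 then lowU (F0 \<xi>) (F1 \<xi>) (norm \<xi>) t else 0"
    let ?M = "if norm \<xi> \<le> 1 then lowV (F0 \<xi>) (F1 \<xi>) (norm \<xi>) t else 0"
    have e: "wt \<xi> * U t \<xi> - P * (wt \<xi> * sin_symbol t \<xi>) - wt \<xi> * errU t \<xi> = wt \<xi> * (U t \<xi> - ?L)"
      "wt \<xi> * V t \<xi> - P * (wt \<xi> * cos_symbol t \<xi>) - wt \<xi> * errV t \<xi> = wt \<xi> * (V t \<xi> - ?M)"
      unfolding errU_def errV_def by (simp_all add: algebra_simps)
    have "cmod (wt \<xi> * (U t \<xi> - ?L)) \<le> C * exp (- (1/20) * t) * cmod (data \<xi>) \<and>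
      cmod (wt \<xi> * (V t \<xi> - ?M)) \<le> C * exp (- (1/20) * t) * cmod (data \<xi>)"
    proof (cases "norm \<xi> \<le> 1")
      case True
      have "U t \<xi> = lowU (F0 \<xi>) (F1 \<xi>) (norm \<xi>) t" "V t \<xi> = lowV (F0 \<xi>) (F1 \<xi>) (norm \<xi>) t"
        using low_solution[of "norm \<xi>" "\<lambda>t. U t \<xi>" "\<lambda>t. V t \<xi>" t] f True t by auto
      then show ?thesis using True C(1) by simp
    next
      case False
      then show ?thesis using b t unfolding sol_bound_def by auto
    qed
    then show "cmod (wt \<xi> * U t \<xi> - P * (wt \<xi> * sin_symbol t \<xi>) - wt \<xi> * errU t \<xi>) \<le> C * exp (- (1/20) * t) * cmod (data \<xi>)"
      "cmod (wt \<xi> * V t \<xi> - P * (wt \<xi> * cos_symbol t \<xi>) - wt \<xi> * errV t \<xi>) \<le> C * exp (- (1/20) * t) * cmod (data \<xi>)"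
      unfolding e by auto
  qed
  show ?U
  proof (rule L2_norm_smallo_split[OF scaled_part_smallo[where L=errU, OF _ dims(1) err_bounds(1) err_limits(1)] _ _ data_L2, where b="1/20" and C=C])
    show "(\<lambda>\<xi>. wt \<xi> * U t \<xi> - P * (wt \<xi> * sin_symbol t \<xi>)) \<in> L2" if "t > 0" for t
      by (intro L2_diff L2_cmult wt_U_L2 wt_symbols_L2 that)
    show "AE \<xi> in lebesgue. cmod (wt \<xi> * U t \<xi> - P * (wt \<xi> * sin_symbol t \<xi>) - wt \<xi> * errU t \<xi>)
        \<le> C * exp (- (1/20) * t) * cmod (data \<xi>)" if "t \<ge> 1" for t
      using C(2) freq by eventually_elim (rule high(1)[OF that])
  qed auto
  have dims0: "2 * (s - 0) > - real DIM('a)" using dims(2) by simp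
  have "(\<lambda>t. L2_norm (\<lambda>\<xi>. wt \<xi> * V t \<xi> - P * (wt \<xi> * cos_symbol t \<xi>)))
     \<in> o(\<lambda>t. t powr (- (1 / (2 * \<delta>) * (s - 0)) - 1 / (2 * \<delta>) * DIM('a) / 2))"
  proof (rule L2_norm_smallo_split[OF scaled_part_smallo[where L=errV, OF _ dims0 err_bounds(2) err_limits(2)] _ _ data_L2, where b="1/20" and C=C])
    show "(\<lambda>\<xi>. wt \<xi> * V t \<xi> - P * (wt \<xi> * cos_symbol t \<xi>)) \<in> L2" if "t > 0" for t
      by (intro L2_diff L2_cmult wt_V_L2 wt_symbols_L2 that)
    show "AE \<xi> in lebesgue. cmod (wt \<xi> * V t \<xi> - P * (wt \<xi> * cos_symbol t \<xi>) - wt \<xi> * errV t \<xi>)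
        \<le> C * exp (- (1/20) * t) * cmod (data \<xi>)" if "t \<ge> 1" for t
      using C(2) freq by eventually_elim (rule high(2)[OF that])
  qed auto
  then show ?V by simp
qed

lemma sin_profile_fourier: "t > 0 \<Longrightarrow> has_fourier (sin_profile \<sigma> \<delta> t) (sin_symbol t :: 'a \<Rightarrow> complex)"
  unfolding sin_profile_def sin_symbol_def[symmetric]
  using has_fourier_inv_fourier[OF sin_symbol_L2[OF dim]] by (simp add: eta_contract_eq)

lemma cos_profile_fourier: "t > 0 \<Longrightarrow> has_fourier (cos_profile \<sigma> \<delta> t) (cos_symbol t :: 'a \<Rightarrow> complex)"
  unfolding cos_profile_def cos_symbol_def[symmetric]
  using has_fourier_inv_fourier[OF cos_symbol_L2[where 'a='a]] by (simp add: eta_contract_eq)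

lemma in_sobolev:
  assumes "t > 0"
  shows "u t \<in> sobolev s" "(sin_profile \<sigma> \<delta> t :: 'a \<Rightarrow> complex) \<in> sobolev s"
    "(cos_profile \<sigma> \<delta> t :: 'a \<Rightarrow> complex) \<in> sobolev s"
  using sobolev_I[OF U s wt_U_L2[unfolded wt_def]] sobolev_I[OF sin_profile_fourier s wt_symbols_L2(1)[unfolded wt_def]]
    sobolev_I[OF cos_profile_fourier s wt_symbols_L2(2)[unfolded wt_def]] assms by auto

lemma abs_D_u: "t > 0 \<Longrightarrow> has_fourier (abs_D s (u t)) (\<lambda>\<xi>. wt \<xi> * U t \<xi>)"
  using abs_D_has_fourier[OF U wt_U_L2[unfolded wt_def]] unfolding wt_def by simp

lemma time_derivative:
  assumes "t > 0"
  shows "\<exists>v. has_L2_time_derivative (\<lambda>\<tau>. abs_D s (u \<tau>)) v t"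
    "has_fourier (time_deriv (\<lambda>\<tau>. abs_D s (u \<tau>)) t) (\<lambda>\<xi>. wt \<xi> * V t \<xi>)"
proof -
  have v: "has_fourier (inv_fourier (\<lambda>\<xi>. wt \<xi> * V t \<xi>)) (\<lambda>\<xi>. wt \<xi> * V t \<xi>)"
    by (rule has_fourier_inv_fourier[OF wt_V_L2[OF assms]])
  have d: "has_L2_time_derivative (\<lambda>\<tau>. abs_D s (u \<tau>)) (inv_fourier (\<lambda>\<xi>. wt \<xi> * V t \<xi>)) t"
    by (rule has_L2_time_derivative_I[OF abs_D_u assms v wt_U_derivative[OF assms]])
  then show "\<exists>v. has_L2_time_derivative (\<lambda>\<tau>. abs_D s (u \<tau>)) v t" by blast
  show "has_fourier (time_deriv (\<lambda>\<tau>. abs_D s (u \<tau>)) t) (\<lambda>\<xi>. wt \<xi> * V t \<xi>)"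
    by (rule time_deriv_has_fourier[OF d v])
qed

lemma smallo_of_eventually_eq_scaled:
  fixes f g h :: "real \<Rightarrow> real"
  assumes "f \<in> o(h)" "\<And>t. t > 0 \<Longrightarrow> f t = c * g t" "c > 0"
  shows "g \<in> o(h)"
proof -
  have "(\<lambda>t. c * g t) \<in> o(h) \<longleftrightarrow> f \<in> o(h)"
  proof (rule landau_o.small.in_cong)
    show "\<forall>\<^sub>F t in at_top. c * g t = f t"
      using eventually_gt_at_top[of 0] by eventually_elim (simp add: assms(2))
  qed
  then show ?thesis using assms by simp
qed

lemma solution_asymptotics:
  "(\<lambda>t. L2_norm (abs_D s (\<lambda>x. u t x - P * sin_profile \<sigma> \<delta> t x)))
     \<in> o(\<lambda>t. t powr (- (1 / (2 * \<delta>) * (s - \<sigma>)) - 1 / (2 * \<delta>) * DIM('a) / 2))"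
  "(\<lambda>t. L2_norm (\<lambda>x. time_deriv (\<lambda>\<tau>. abs_D s (u \<tau>)) t x - P * abs_D s (cos_profile \<sigma> \<delta> t) x))
     \<in> o(\<lambda>t. t powr (- (1 / (2 * \<delta>) * s) - 1 / (2 * \<delta>) * DIM('a) / 2))"
proof -
  show "(\<lambda>t. L2_norm (abs_D s (\<lambda>x. u t x - P * sin_profile \<sigma> \<delta> t x)))
     \<in> o(\<lambda>t. t powr (- (1 / (2 * \<delta>) * (s - \<sigma>)) - 1 / (2 * \<delta>) * DIM('a) / 2))"
  proof (rule smallo_of_eventually_eq_scaled[OF frequency_asymptotics(1) _ plancherel_const_pos[where 'a='a]])
    fix t :: real assume t: "t > 0"
    have f: "has_fourier (\<lambda>x. u t x - P * sin_profile \<sigma> \<delta> t x) (\<lambda>\<xi>. U t \<xi> - P * sin_symbol t \<xi>)"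
      using t by (intro has_fourier_diff has_fourier_cmult U sin_profile_fourier) auto
    have eq: "(\<lambda>\<xi>. wt \<xi> * (U t \<xi> - P * sin_symbol t \<xi>)) = (\<lambda>\<xi>. wt \<xi> * U t \<xi> - P * (wt \<xi> * sin_symbol t \<xi>))"
      by (simp add: algebra_simps)
    have L2: "(\<lambda>\<xi>. wt \<xi> * (U t \<xi> - P * sin_symbol t \<xi>)) \<in> L2"
      unfolding eq by (intro L2_diff L2_cmult wt_U_L2 wt_symbols_L2 t)
    have "has_fourier (abs_D s (\<lambda>x. u t x - P * sin_profile \<sigma> \<delta> t x)) (\<lambda>\<xi>. wt \<xi> * (U t \<xi> - P * sin_symbol t \<xi>))"
      using abs_D_has_fourier[OF f L2[unfolded wt_def]] unfolding wt_def .
    from has_fourier_norm[OF this]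
    show "L2_norm (\<lambda>\<xi>. wt \<xi> * U t \<xi> - P * (wt \<xi> * sin_symbol t \<xi>))
        = plancherel_const TYPE('a) * L2_norm (abs_D s (\<lambda>x. u t x - P * sin_profile \<sigma> \<delta> t x))"
      unfolding eq .
  qed
  show "(\<lambda>t. L2_norm (\<lambda>x. time_deriv (\<lambda>\<tau>. abs_D s (u \<tau>)) t x - P * abs_D s (cos_profile \<sigma> \<delta> t) x))
     \<in> o(\<lambda>t. t powr (- (1 / (2 * \<delta>) * s) - 1 / (2 * \<delta>) * DIM('a) / 2))"
  proof (rule smallo_of_eventually_eq_scaled[OF frequency_asymptotics(2) _ plancherel_const_pos[where 'a='a]])
    fix t :: real assume t: "t > 0"
    have "has_fourier (abs_D s (cos_profile \<sigma> \<delta> t :: 'a \<Rightarrow> complex)) (\<lambda>\<xi>. wt \<xi> * cos_symbol t \<xi>)"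
      using abs_D_has_fourier[OF cos_profile_fourier[OF t] wt_symbols_L2(2)[OF t, unfolded wt_def]] unfolding wt_def .
    from has_fourier_norm[OF has_fourier_diff[OF time_derivative(2)[OF t] has_fourier_cmult[OF this, of P]]]
    show "L2_norm (\<lambda>\<xi>. wt \<xi> * V t \<xi> - P * (wt \<xi> * cos_symbol t \<xi>))
        = plancherel_const TYPE('a) * L2_norm (\<lambda>x. time_deriv (\<lambda>\<tau>. abs_D s (u \<tau>)) t x - P * abs_D s (cos_profile \<sigma> \<delta> t) x)" .
  qed
qed

text \<open>Since the difference to \<open>P\<close> times the profile is of smaller order, the solution inherits the
  two-sided bounds of the profile.\<close>

lemma two_sided_transfer:
  fixes f :: "real \<Rightarrow> 'a \<Rightarrow> complex"
  assumes P: "P \<noteq> 0"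
    and fW: "\<And>t. t > 0 \<Longrightarrow> has_fourier (f t) (W t)" and S: "\<And>t. t > 0 \<Longrightarrow> S t \<in> L2"
    and o: "(\<lambda>t. L2_norm (\<lambda>\<xi>. W t \<xi> - P * S t \<xi>)) \<in> o(\<lambda>t. t powr \<beta>)"
    and c: "c > 0" "C > 0" "\<forall>\<^sub>F t in at_top. c * t powr \<beta> \<le> L2_norm (S t) \<and> L2_norm (S t) \<le> C * t powr \<beta>"
  shows "\<exists>C1>0. \<exists>C2>0. \<forall>\<^sub>F t in at_top. C1 * t powr \<beta> \<le> L2_norm (f t) \<and> L2_norm (f t) \<le> C2 * t powr \<beta>"
proof (rule two_sided_of_smallo)
  let ?c = "plancherel_const TYPE('a)"
  show "cmod P / ?c > 0" using P by simp
  show "\<bar>L2_norm (f t) - cmod P / ?c * L2_norm (S t)\<bar> \<le> 1 / ?c * L2_norm (\<lambda>\<xi>. W t \<xi> - P * S t \<xi>)" if t: "t > 0" for t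
  proof -
    have "\<bar>L2_norm (W t) - L2_norm (\<lambda>\<xi>. P * S t \<xi>)\<bar> \<le> L2_norm (\<lambda>\<xi>. W t \<xi> - P * S t \<xi>)"
      by (rule L2_norm_diff_ge[OF has_fourier_L2(2)[OF fW[OF t]] L2_cmult[OF S[OF t]]])
    then have "\<bar>?c * L2_norm (f t) - cmod P * L2_norm (S t)\<bar> \<le> L2_norm (\<lambda>\<xi>. W t \<xi> - P * S t \<xi>)"
      unfolding has_fourier_norm[OF fW[OF t]] L2_norm_cmult .
    then have "\<bar>?c * L2_norm (f t) - cmod P * L2_norm (S t)\<bar> / ?c \<le> L2_norm (\<lambda>\<xi>. W t \<xi> - P * S t \<xi>) / ?c"
      by (rule divide_right_mono) (simp add: less_imp_le)
    also have "\<bar>?c * L2_norm (f t) - cmod P * L2_norm (S t)\<bar> / ?c = \<bar>(?c * L2_norm (f t) - cmod P * L2_norm (S t)) / ?c\<bar>"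
      by (simp add: abs_divide abs_of_pos[OF plancherel_const_pos])
    also have "(?c * L2_norm (f t) - cmod P * L2_norm (S t)) / ?c = L2_norm (f t) - cmod P / ?c * L2_norm (S t)"
      using plancherel_const_pos[where 'a='a] by (simp add: diff_divide_distrib less_imp_neq[symmetric])
    finally show ?thesis by simp
  qed
  show "(\<lambda>t. 1 / ?c * L2_norm (\<lambda>\<xi>. W t \<xi> - P * S t \<xi>)) \<in> o(\<lambda>t. t powr \<beta>)"
    using o plancherel_const_pos[where 'a='a] by (simp add: less_imp_neq[symmetric])
qed (use c in auto)

lemma solution_two_sided:
  assumes P: "P \<noteq> 0"
  shows "\<exists>C1>0. \<exists>C2>0. \<forall>\<^sub>F t in at_top.
      C1 * t powr (- (1 / (2 * \<delta>) * (s - \<sigma>)) - 1 / (2 * \<delta>) * DIM('a) / 2) \<le> L2_norm (abs_D s (u t)) \<and>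
      L2_norm (abs_D s (u t)) \<le> C2 * t powr (- (1 / (2 * \<delta>) * (s - \<sigma>)) - 1 / (2 * \<delta>) * DIM('a) / 2)"
    and "\<exists>C1>0. \<exists>C2>0. \<forall>\<^sub>F t in at_top.
      C1 * t powr (- (1 / (2 * \<delta>) * s) - 1 / (2 * \<delta>) * DIM('a) / 2) \<le> L2_norm (time_deriv (\<lambda>\<tau>. abs_D s (u \<tau>)) t) \<and>
      L2_norm (time_deriv (\<lambda>\<tau>. abs_D s (u \<tau>)) t) \<le> C2 * t powr (- (1 / (2 * \<delta>) * s) - 1 / (2 * \<delta>) * DIM('a) / 2)"
proof -
  obtain c C where c: "c > 0" "C > 0"
    "\<forall>\<^sub>F t in at_top. c * t powr (- ((s - \<sigma>) / (2 * \<delta>)) - real DIM('a) / (4 * \<delta>))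
        \<le> L2_norm (profile (s - \<sigma>) (- (pi / 2)) t :: 'a \<Rightarrow> complex) \<and>
      L2_norm (profile (s - \<sigma>) (- (pi / 2)) t :: 'a \<Rightarrow> complex) \<le> C * t powr (- ((s - \<sigma>) / (2 * \<delta>)) - real DIM('a) / (4 * \<delta>))"
    using profile_norm_bounds[OF dims(1)] by blast
  show "\<exists>C1>0. \<exists>C2>0. \<forall>\<^sub>F t in at_top.
      C1 * t powr (- (1 / (2 * \<delta>) * (s - \<sigma>)) - 1 / (2 * \<delta>) * DIM('a) / 2) \<le> L2_norm (abs_D s (u t)) \<and>
      L2_norm (abs_D s (u t)) \<le> C2 * t powr (- (1 / (2 * \<delta>) * (s - \<sigma>)) - 1 / (2 * \<delta>) * DIM('a) / 2)"
    by (rule two_sided_transfer[OF P abs_D_u wt_symbols_L2(1) frequency_asymptotics(1) c(1,2)])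
       (use c(3) in \<open>simp_all add: wt_sin_symbol\<close>)
  obtain c C where c: "c > 0" "C > 0"
    "\<forall>\<^sub>F t in at_top. c * t powr (- (s / (2 * \<delta>)) - real DIM('a) / (4 * \<delta>))
        \<le> L2_norm (profile s 0 t :: 'a \<Rightarrow> complex) \<and>
      L2_norm (profile s 0 t :: 'a \<Rightarrow> complex) \<le> C * t powr (- (s / (2 * \<delta>)) - real DIM('a) / (4 * \<delta>))"
    using profile_norm_bounds[OF dims(2)] by blast
  show "\<exists>C1>0. \<exists>C2>0. \<forall>\<^sub>F t in at_top.
      C1 * t powr (- (1 / (2 * \<delta>) * s) - 1 / (2 * \<delta>) * DIM('a) / 2) \<le> L2_norm (time_deriv (\<lambda>\<tau>. abs_D s (u \<tau>)) t) \<and>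
      L2_norm (time_deriv (\<lambda>\<tau>. abs_D s (u \<tau>)) t) \<le> C2 * t powr (- (1 / (2 * \<delta>) * s) - 1 / (2 * \<delta>) * DIM('a) / 2)"
    by (rule two_sided_transfer[OF P time_derivative(2) wt_symbols_L2(2) frequency_asymptotics(2) c(1,2)])
       (use c(3) in \<open>simp_all add: wt_cos_symbol\<close>)
qed

end

theorem theorem1p2:
  fixes \<sigma> \<delta>\<^sub>2 s :: real and j :: nat
    and u0 u1 :: "real ^ 'n \<Rightarrow> complex"
    and u :: "real \<Rightarrow> real ^ 'n \<Rightarrow> complex"
    and n :: real and P\<^sub>1 :: complex
  assumes n_def: "n = real CARD('n)"
    and "\<sigma> \<ge> 1" and "\<sigma> / 2 < \<delta>\<^sub>2" and "\<delta>\<^sub>2 < \<sigma>"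
    and "j \<in> {0, 1}" and "s \<ge> 0"
    and "n > 2 * \<sigma>"
    and "u0 \<in> L1 \<inter> sobolev (s + 2 * real j * \<delta>\<^sub>2)"
    and "u1 \<in> L1 \<inter> sobolev (max (s + 2 * (real j - 1) * \<delta>\<^sub>2) 0)"
    and "sobolev_solution \<sigma> \<delta>\<^sub>2 u0 u1 u"
    and P\<^sub>1_def: "P\<^sub>1 = (\<integral>x. u1 x \<partial>lebesgue)"
  shows
    \<comment> \<open>first conjunct: all the functions whose norms are taken exist in \<open>L\<^sup>2\<close>\<close>
    "(\<forall>t>0. u t \<in> sobolev s \<and>
           (sin_profile \<sigma> \<delta>\<^sub>2 t :: real ^ 'n \<Rightarrow> complex) \<in> sobolev s \<and>
           (cos_profile \<sigma> \<delta>\<^sub>2 t :: real ^ 'n \<Rightarrow> complex) \<in> sobolev s \<and>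
           (\<exists>v. has_L2_time_derivative (\<lambda>\<tau>. abs_D s (u \<tau>)) v t))
     \<and> (\<lambda>t. L2_norm (abs_D s (\<lambda>x. u t x - P\<^sub>1 * sin_profile \<sigma> \<delta>\<^sub>2 t x)))
           \<in> o(\<lambda>t. t powr (- n / (4 * \<delta>\<^sub>2) - s / (2 * \<delta>\<^sub>2) + \<sigma> / (2 * \<delta>\<^sub>2)))
     \<and> (\<lambda>t. L2_norm (\<lambda>x. time_deriv (\<lambda>\<tau>. abs_D s (u \<tau>)) t x
                            - P\<^sub>1 * abs_D s (cos_profile \<sigma> \<delta>\<^sub>2 t) x))
           \<in> o(\<lambda>t. t powr (- n / (4 * \<delta>\<^sub>2) - s / (2 * \<delta>\<^sub>2)))
     \<and> (P\<^sub>1 \<noteq> 0 \<longrightarrow>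
           (\<exists>C\<^sub>1>0. \<exists>C\<^sub>2>0. \<forall>\<^sub>F t in at_top.
              C\<^sub>1 * t powr (- n / (4 * \<delta>\<^sub>2) - (s + (real j - 1) * \<sigma>) / (2 * \<delta>\<^sub>2))
                \<le> L2_norm ((time_deriv ^^ j) (\<lambda>\<tau>. abs_D s (u \<tau>)) t) \<and>
              L2_norm ((time_deriv ^^ j) (\<lambda>\<tau>. abs_D s (u \<tau>)) t)
                \<le> C\<^sub>2 * t powr (- n / (4 * \<delta>\<^sub>2) - (s + (real j - 1) * \<sigma>) / (2 * \<delta>\<^sub>2))))"
proof -
  have L: "u0 \<in> L1" "u0 \<in> L2" "u1 \<in> L1" "u1 \<in> L2"
    using assms(8,9) by (auto simp: sobolev_def)
  have n: "n = real DIM(real ^ 'n)" using n_def by simp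
  from sobolev_solution_frequency[OF assms(10) L] obtain U V where
    "\<And>t. t \<ge> 0 \<Longrightarrow> has_fourier (u t) (U t)"
    "\<And>t. t \<ge> 0 \<Longrightarrow> V t \<in> borel_measurable lebesgue"
    "AE \<xi> in lebesgue. \<xi> \<noteq> 0 \<and> solves_ode (norm \<xi> powr (2 * \<delta>\<^sub>2)) (norm \<xi> powr (2 * \<sigma>)) (\<lambda>t. U t \<xi>) (\<lambda>t. V t \<xi>)
       \<and> U 0 \<xi> = fourier_integral u0 \<xi> \<and> V 0 \<xi> = fourier_integral u1 \<xi>" by blast
  then interpret damped_wave_solution \<sigma> \<delta>\<^sub>2 s u0 u1 u U V
    using assms L n by unfold_locales auto
  have P: "P\<^sub>1 = P" by (simp add: P\<^sub>1_def P_def)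
  have d: "\<delta>\<^sub>2 \<noteq> 0" using assms by auto
  have e0: "- n / (4 * \<delta>\<^sub>2) - s / (2 * \<delta>\<^sub>2) + \<sigma> / (2 * \<delta>\<^sub>2)
      = - (1 / (2 * \<delta>\<^sub>2) * (s - \<sigma>)) - 1 / (2 * \<delta>\<^sub>2) * DIM(real ^ 'n) / 2"
    unfolding n using d by (simp add: field_simps)
  have e1: "- n / (4 * \<delta>\<^sub>2) - s / (2 * \<delta>\<^sub>2) = - (1 / (2 * \<delta>\<^sub>2) * s) - 1 / (2 * \<delta>\<^sub>2) * DIM(real ^ 'n) / 2"
    unfolding n using d by (simp add: field_simps)
  have ej: "- n / (4 * \<delta>\<^sub>2) - (s + (real 0 - 1) * \<sigma>) / (2 * \<delta>\<^sub>2) = - n / (4 * \<delta>\<^sub>2) - s / (2 * \<delta>\<^sub>2) + \<sigma> / (2 * \<delta>\<^sub>2)"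
    "- n / (4 * \<delta>\<^sub>2) - (s + (real 1 - 1) * \<sigma>) / (2 * \<delta>\<^sub>2) = - n / (4 * \<delta>\<^sub>2) - s / (2 * \<delta>\<^sub>2)"
    using d by (simp_all add: field_simps)
  have "\<exists>C\<^sub>1>0. \<exists>C\<^sub>2>0. \<forall>\<^sub>F t in at_top.
              C\<^sub>1 * t powr (- n / (4 * \<delta>\<^sub>2) - (s + (real j - 1) * \<sigma>) / (2 * \<delta>\<^sub>2))
                \<le> L2_norm ((time_deriv ^^ j) (\<lambda>\<tau>. abs_D s (u \<tau>)) t) \<and>
              L2_norm ((time_deriv ^^ j) (\<lambda>\<tau>. abs_D s (u \<tau>)) t)
                \<le> C\<^sub>2 * t powr (- n / (4 * \<delta>\<^sub>2) - (s + (real j - 1) * \<sigma>) / (2 * \<delta>\<^sub>2))" if "P\<^sub>1 \<noteq> 0"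
  proof -
    from that have P0: "P \<noteq> 0" using P by simp
    from assms(5) consider "j = 0" | "j = 1" by auto
    then show ?thesis
    proof cases
      case 1
      show ?thesis unfolding 1 ej(1) e0 using solution_two_sided(1)[OF P0] by simp
    next
      case 2
      show ?thesis unfolding 2 ej(2) e1 using solution_two_sided(2)[OF P0] by simp
    qed
  qed
  then show ?thesis
    using in_sobolev time_derivative(1) solution_asymptotics(1)[folded e0 P]
      solution_asymptotics(2)[folded e1 P] by blast
qed

end
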